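(* Suppose that for every prime $p$, Terao's conjecture holds over $\mathbb{F}_p$, i.e. for every $l\ge1$ and any two central arrangements $\mathcal{A}^{(1)},\mathcal{A}^{(2)}$ in $\mathbb{F}_p^l$ that are combinatorially equivalent (equivalently, have isomorphic intersection lattices), $\mathcal{A}^{(1)}$ is free if and only if $\mathcal{A}^{(2)}$ is free. Then Terao's conjecture holds over $\mathbb{Q}$: for every $l\ge1$ and any two combinatorially equivalent central arrangements $\mathcal{A}^{(1)},\mathcal{A}^{(2)}$ in $\mathbb{Q}^l$, $\mathcal{A}^{(1)}$ is free if and only if $\mathcal{A}^{(2)}$ is free.
   Context: A central arrangement $\mathcal{A}=\{H_1,\dots,H_n\}$ in $K^l$ consists of distinct linear hyperplanes $H_i=\{\alpha_i=0\}$, $\alpha_i$ linear forms in $S=K[x_1,\dots,x_l]$, $Q(\mathcal{A})=\prod\alpha_i$. Its module of logarithmic vector fields is $D(\mathcal{A})=\{\delta=\sum_i f_i\partial_{x_i}: f_i\in S,\ \delta(\alpha_i)\in\alpha_iS\ \forall i\}$; $\mathcal{A}$ is free if $D(\mathcal{A})$ is a free $S$-module (then it has a homogeneous basis, whose polynomial degrees are the exponents). Two arrangements of $n$ indexed hyperplanes $\{H^{(1)}_i\}$ in $K_1^l$ and $\{H^{(2)}_i\}$ in $K_2^l$ are combinatorially equivalent if $\dim(H^{(1)}_{i_1}\cap\dots\cap H^{(1)}_{i_k})=\dim(H^{(2)}_{i_1}\cap\dots\cap H^{(2)}_{i_k})$ for all $1\le i_1<\dots<i_k\le n$. *)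

theory Defs
  imports "HOL-Number_Theory.Residues" "HOL-Library.Multiset"
begin

text \<open>Fields are HOL-Algebra ring records (so that we can quantify over all F_p).
  Vectors of K^l: functions nat => 'a, carrier-valued below l, zero from l on.
  Polynomials of S = K[x_0,...,x_(l-1)]: functions from monomials (multisets of
  variable indices) to coefficients, finitely supported, only variables < l.\<close>

definition kspace :: "('a, 'm) ring_scheme \<Rightarrow> nat \<Rightarrow> (nat \<Rightarrow> 'a) set" where
  "kspace R l = {x. (\<forall>j<l. x j \<in> carrier R) \<and> (\<forall>j\<ge>l. x j = \<zero>\<^bsub>R\<^esub>)}"

definition lin_eval :: "('a, 'm) ring_scheme \<Rightarrow> nat \<Rightarrow> (nat \<Rightarrow> 'a) \<Rightarrow> (nat \<Rightarrow> 'a) \<Rightarrow> 'a" where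
  "lin_eval R l a x = finsum R (\<lambda>j. a j \<otimes>\<^bsub>R\<^esub> x j) {..<l}"

definition hyperplane :: "('a, 'm) ring_scheme \<Rightarrow> nat \<Rightarrow> (nat \<Rightarrow> 'a) \<Rightarrow> (nat \<Rightarrow> 'a) set" where
  "hyperplane R l a = {x \<in> kspace R l. lin_eval R l a x = \<zero>\<^bsub>R\<^esub>}"

definition lin_indep :: "('a, 'm) ring_scheme \<Rightarrow> (nat \<Rightarrow> 'a) set \<Rightarrow> bool" where
  "lin_indep R B \<longleftrightarrow> (\<forall>c. (\<forall>v\<in>B. c v \<in> carrier R) \<and>
      (\<forall>j. finsum R (\<lambda>v. c v \<otimes>\<^bsub>R\<^esub> v j) B = \<zero>\<^bsub>R\<^esub>) \<longrightarrow> (\<forall>v\<in>B. c v = \<zero>\<^bsub>R\<^esub>))"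

definition sub_dim :: "('a, 'm) ring_scheme \<Rightarrow> (nat \<Rightarrow> 'a) set \<Rightarrow> nat" where
  "sub_dim R V = Max {card B | B. B \<subseteq> V \<and> finite B \<and> lin_indep R B}"

definition central_arrangement ::
    "('a, 'm) ring_scheme \<Rightarrow> nat \<Rightarrow> nat \<Rightarrow> (nat \<Rightarrow> nat \<Rightarrow> 'a) \<Rightarrow> bool" where
  "central_arrangement R l n \<alpha> \<longleftrightarrow>
     (\<forall>i<n. \<alpha> i \<in> kspace R l \<and> \<alpha> i \<noteq> (\<lambda>_. \<zero>\<^bsub>R\<^esub>)) \<and>
     (\<forall>i<n. \<forall>j<n. i \<noteq> j \<longrightarrow> hyperplane R l (\<alpha> i) \<noteq> hyperplane R l (\<alpha> j))"

definition comb_equivalent ::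
    "('a, 'm) ring_scheme \<Rightarrow> ('b, 'n) ring_scheme \<Rightarrow> nat \<Rightarrow> nat \<Rightarrow>
     (nat \<Rightarrow> nat \<Rightarrow> 'a) \<Rightarrow> (nat \<Rightarrow> nat \<Rightarrow> 'b) \<Rightarrow> bool" where
  "comb_equivalent R1 R2 l n \<alpha> \<beta> \<longleftrightarrow>
     (\<forall>I. I \<subseteq> {..<n} \<and> I \<noteq> {} \<longrightarrow>
        sub_dim R1 (\<Inter>i\<in>I. hyperplane R1 l (\<alpha> i)) = sub_dim R2 (\<Inter>i\<in>I. hyperplane R2 l (\<beta> i)))"

type_synonym 'a mpoly = "nat multiset \<Rightarrow> 'a"

definition mpolys :: "('a, 'm) ring_scheme \<Rightarrow> nat \<Rightarrow> 'a mpoly set" where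
  "mpolys R l = {P. (\<forall>m. P m \<in> carrier R) \<and> finite {m. P m \<noteq> \<zero>\<^bsub>R\<^esub>} \<and>
                    (\<forall>m. P m \<noteq> \<zero>\<^bsub>R\<^esub> \<longrightarrow> set_mset m \<subseteq> {..<l})}"

definition mpoly_zero :: "('a, 'm) ring_scheme \<Rightarrow> 'a mpoly" where
  "mpoly_zero R = (\<lambda>_. \<zero>\<^bsub>R\<^esub>)"

definition mpoly_mult :: "('a, 'm) ring_scheme \<Rightarrow> 'a mpoly \<Rightarrow> 'a mpoly \<Rightarrow> 'a mpoly" where
  "mpoly_mult R P Q = (\<lambda>m. finsum R (\<lambda>(a, b). P a \<otimes>\<^bsub>R\<^esub> Q b) {(a, b). a + b = m})"

definition mpoly_sum :: "('a, 'm) ring_scheme \<Rightarrow> ('c \<Rightarrow> 'a mpoly) \<Rightarrow> 'c set \<Rightarrow> 'a mpoly" where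
  "mpoly_sum R F A = (\<lambda>m. finsum R (\<lambda>x. F x m) A)"

definition lin_form :: "('a, 'm) ring_scheme \<Rightarrow> nat \<Rightarrow> (nat \<Rightarrow> 'a) \<Rightarrow> 'a mpoly" where
  "lin_form R l a = (\<lambda>m. finsum R (\<lambda>j. if m = {#j#} then a j else \<zero>\<^bsub>R\<^esub>) {..<l})"

text \<open>Polynomial vector fields delta = sum_{j<l} f_j d/dx_j, represented by (f_j)_j.\<close>
definition derivations :: "('a, 'm) ring_scheme \<Rightarrow> nat \<Rightarrow> (nat \<Rightarrow> 'a mpoly) set" where
  "derivations R l = {\<delta>. (\<forall>j<l. \<delta> j \<in> mpolys R l) \<and> (\<forall>j\<ge>l. \<delta> j = mpoly_zero R)}"

definition apply_der :: "('a, 'm) ring_scheme \<Rightarrow> nat \<Rightarrow> (nat \<Rightarrow> 'a mpoly) \<Rightarrow> (nat \<Rightarrow> 'a) \<Rightarrow> 'a mpoly" where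
  "apply_der R l \<delta> a = (\<lambda>m. finsum R (\<lambda>j. a j \<otimes>\<^bsub>R\<^esub> \<delta> j m) {..<l})"

definition log_derivations ::
    "('a, 'm) ring_scheme \<Rightarrow> nat \<Rightarrow> nat \<Rightarrow> (nat \<Rightarrow> nat \<Rightarrow> 'a) \<Rightarrow> (nat \<Rightarrow> 'a mpoly) set" where
  "log_derivations R l n \<alpha> = {\<delta> \<in> derivations R l. \<forall>i<n. \<exists>g \<in> mpolys R l.
       apply_der R l \<delta> (\<alpha> i) = mpoly_mult R (lin_form R l (\<alpha> i)) g}"

definition free_submodule :: "('a, 'm) ring_scheme \<Rightarrow> nat \<Rightarrow> (nat \<Rightarrow> 'a mpoly) set \<Rightarrow> bool" where
  "free_submodule R l D \<longleftrightarrow> (\<exists>B \<subseteq> D. \<forall>\<delta>\<in>D. \<exists>!c.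
       (\<forall>b. c b \<in> mpolys R l) \<and> finite {b. c b \<noteq> mpoly_zero R} \<and>
       {b. c b \<noteq> mpoly_zero R} \<subseteq> B \<and>
       \<delta> = (\<lambda>j. mpoly_sum R (\<lambda>b. mpoly_mult R (c b) (b j)) {b. c b \<noteq> mpoly_zero R}))"

definition free_arrangement :: "('a, 'm) ring_scheme \<Rightarrow> nat \<Rightarrow> nat \<Rightarrow> (nat \<Rightarrow> nat \<Rightarrow> 'a) \<Rightarrow> bool" where
  "free_arrangement R l n \<alpha> \<longleftrightarrow> free_submodule R l (log_derivations R l n \<alpha>)"

definition terao_conjecture_over :: "('a, 'm) ring_scheme \<Rightarrow> bool" where
  "terao_conjecture_over K \<longleftrightarrow> (\<forall>l n \<alpha> \<beta>. l \<ge> 1 \<longrightarrow>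
      central_arrangement K l n \<alpha> \<longrightarrow> central_arrangement K l n \<beta> \<longrightarrow>
      comb_equivalent K K l n \<alpha> \<beta> \<longrightarrow>
      (free_arrangement K l n \<alpha> \<longleftrightarrow> free_arrangement K l n \<beta>))"

definition rat_field :: "rat ring" where
  "rat_field = \<lparr>carrier = UNIV, monoid.mult = (*), one = 1, zero = 0, add = (+)\<rparr>"

end

theory Submission
  imports Defs "HOL-Library.Poly_Mapping" "HOL-Library.Multiset_Order"
    "Jordan_Normal_Form.Determinant" "Berlekamp_Zassenhaus.Finite_Field"
begin

text \<open>Saito's criterion, in the form used here, says that a central arrangement of \<open>n\<close> hyperplanes
  is free iff it has homogeneous logarithmic derivations \<open>\<theta>\<^sub>1, \<dots>, \<theta>\<^sub>l\<close> whose degrees add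
  up to \<open>n\<close> and whose coefficient determinant is nonzero; this determinant is then a constant multiple
  of the defining polynomial. For an arrangement with integer coefficients such derivations over \<open>\<rat>\<close>
  can be reduced modulo almost all primes. Conversely, logarithmic derivations of bounded degree
  are the solutions of a finite integer linear system, and for almost all \<open>p\<close> every
  solution modulo \<open>p\<close> lifts to an integer solution. So freeness over \<open>\<rat>\<close> and over \<open>\<int>/p\<close>
  agree for all but finitely many \<open>p\<close>, and so do the dimensions of the intersections, by the same
  lifting argument.\<close>

section \<open>Determinants of functions of two indices\<close>

text \<open>The basis in the definition of freeness is an arbitrary set, possibly infinite and
  inhomogeneous, whereas reduction and lifting need data whose size does not depend on p. The degree
  form of the criterion supplies it: degrees with sum n are each at most n, so one finite integer
  system, with one exceptional integer, serves all primes and all degree sequences. Moreover the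
  nonvanishing of a determinant modulo p survives a change of the derivations modulo p and a scaling
  by integers prime to p. The passage from a basis to homogeneous rows rests on determinants alone.
  The determinant of a basis is Q times some f, explicit derivations show that no linear form of the
  arrangement divides f, so f is a unit; the component of degree n is then nonzero, and
  multilinearity selects homogeneous rows. "Almost all p" is always expressed by a nonzero integer
  that p must not divide. Finitely many such conditions combine by multiplication, and for a given
  pair of arrangements the hypothesis is applied at a single prime.\<close>

definition fdet :: "nat \<Rightarrow> (nat \<Rightarrow> nat \<Rightarrow> 'a::comm_ring_1) \<Rightarrow> 'a" where
  "fdet l A = det (mat l l (\<lambda>(i, j). A i j))"

lemma fdet_cong:
  assumes "\<And>i j. i < l \<Longrightarrow> j < l \<Longrightarrow> A i j = B i j"
  shows "fdet l A = fdet l B"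
proof -
  have "mat l l (\<lambda>(i, j). A i j) = mat l l (\<lambda>(i, j). B i j)"
    using assms by (intro eq_matI) auto
  then show ?thesis by (simp add: fdet_def)
qed

definition fadj :: "nat \<Rightarrow> (nat \<Rightarrow> nat \<Rightarrow> 'a::comm_ring_1) \<Rightarrow> nat \<Rightarrow> nat \<Rightarrow> 'a" where
  "fadj l A i j = adj_mat (mat l l (\<lambda>(i, j). A i j)) $$ (i, j)"

text \<open>Laplace expansion along row i, whose cofactors do not involve that row. In this form it
  serves both as Cramer's rule and as linearity of the determinant in a single row.\<close>

lemma fdet_update_row:
  assumes i: "i < l"
  shows "fdet l (A(i := r)) = (\<Sum>j<l. r j * fadj l A j i)"
proof -
  let ?M = "mat l l (\<lambda>(i, j). A i j)"
  let ?N = "mat l l (\<lambda>(i', j). (A(i := r)) i' j)"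
  have "mat_delete ?N i j = mat_delete ?M i j" if "j < l" for j
    using i that by (intro eq_matI) (auto simp: mat_delete_def)
  then have "cofactor ?N i j = fadj l A j i" if "j < l" for j
    using that i by (simp add: cofactor_def adj_mat_def fadj_def)
  moreover have "det ?N = (\<Sum>j<l. ?N $$ (i, j) * cofactor ?N i j)"
    using i by (intro laplace_expansion_row) auto
  ultimately show ?thesis using i by (simp add: fdet_def)
qed

lemma fadj_mult_left:
  assumes "i < l" "k < l"
  shows "(\<Sum>j<l. fadj l A i j * A j k) = (if i = k then fdet l A else 0)"
proof -
  let ?M = "mat l l (\<lambda>(i, j). A i j)"
  have adj: "adj_mat ?M \<in> carrier_mat l l" "adj_mat ?M * ?M = det ?M \<cdot>\<^sub>m 1\<^sub>m l"
    by (simp_all add: adj_mat[of _ l])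
  have "(\<Sum>j<l. fadj l A i j * A j k) = (adj_mat ?M * ?M) $$ (i, k)"
    using assms adj(1) by (auto simp: scalar_prod_def lessThan_atLeast0 fadj_def intro!: sum.cong)
  then show ?thesis using assms adj(2) by (simp add: fdet_def)
qed

lemma fadj_mult_right:
  assumes "i < l" "k < l"
  shows "(\<Sum>j<l. A i j * fadj l A j k) = (if i = k then fdet l A else 0)"
proof -
  let ?M = "mat l l (\<lambda>(i, j). A i j)"
  have adj: "adj_mat ?M \<in> carrier_mat l l" "?M * adj_mat ?M = det ?M \<cdot>\<^sub>m 1\<^sub>m l"
    by (simp_all add: adj_mat[of _ l])
  have "(\<Sum>j<l. A i j * fadj l A j k) = (?M * adj_mat ?M) $$ (i, k)"
    using assms adj(1) by (auto simp: scalar_prod_def lessThan_atLeast0 fadj_def intro!: sum.cong)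
  then show ?thesis using assms adj(2) by (simp add: fdet_def)
qed

lemma fdet_mult: "fdet l (\<lambda>i k. \<Sum>j<l. A i j * B j k) = fdet l A * fdet l B"
proof -
  let ?M = "\<lambda>A. mat l l (\<lambda>(i, j). A i j)"
  have "?M (\<lambda>i k. \<Sum>j<l. A i j * B j k) = ?M A * ?M B"
    by (intro eq_matI) (auto simp: scalar_prod_def lessThan_atLeast0 intro!: sum.cong)
  then show ?thesis by (simp add: fdet_def det_mult[of _ l])
qed

lemma fdet_diag: "fdet l (\<lambda>i j. if i = j then d i else 0) = (\<Prod>i<l. d i)"
proof -
  have "fdet l (\<lambda>i j. if i = j then d i else 0)
      = prod_list (diag_mat (mat l l (\<lambda>(i, j). if i = j then d i else 0)))"
    unfolding fdet_def by (rule det_upper_triangular[of _ l]) (auto simp: upper_triangular_def)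
  also have "\<dots> = (\<Prod>i<l. d i)"
    by (simp add: diag_mat_def prod.list_conv_set_nth lessThan_atLeast0)
  finally show ?thesis .
qed

lemma fdet_zero_row: "i < l \<Longrightarrow> (\<And>j. j < l \<Longrightarrow> A i j = 0) \<Longrightarrow> fdet l A = 0"
  using fdet_update_row[of i l A "A i"] by simp

lemma fdet_leibniz: "fdet l A = (\<Sum>p\<in>{p. p permutes {0..<l}}. signof p * (\<Prod>i=0..<l. A i (p i)))"
proof -
  have "(\<Prod>i=0..<l. mat l l (\<lambda>(i, j). A i j) $$ (i, p i)) = (\<Prod>i=0..<l. A i (p i))"
    if "p permutes {0..<l}" for p
    using permutes_in_image[OF that] by (intro prod.cong) auto
  then show ?thesis by (simp add: fdet_def det_def)
qed

lemma fdet_factor_rows: "fdet l (\<lambda>i j. c i * A i j) = (\<Prod>i<l. c i) * fdet l A"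
  by (simp add: fdet_leibniz prod.distrib sum_distrib_left lessThan_atLeast0 mult_ac)

lemma fdet_hom:
  assumes "comm_ring_hom h"
  shows "fdet l (\<lambda>i j. h (A i j)) = h (fdet l A)"
proof -
  interpret comm_ring_hom h by fact
  have "mat l l (\<lambda>(i, j). h (A i j)) = map_mat h (mat l l (\<lambda>(i, j). A i j))"
    by (intro eq_matI) auto
  then show ?thesis by (simp add: fdet_def)
qed

section \<open>Polynomials\<close>

abbreviation lookup where "lookup \<equiv> Poly_Mapping.lookup"
abbreviation single where "single \<equiv> Poly_Mapping.single"
abbreviation keys where "keys \<equiv> Poly_Mapping.keys"

type_synonym 'a mpol = "nat multiset \<Rightarrow>\<^sub>0 'a"

lemma finite_subseteq_mset: "finite {a. a \<subseteq># (m::'a multiset)}"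
proof (induction m)
  case (add x m)
  have "{a. a \<subseteq># add_mset x m} \<subseteq> {a. a \<subseteq># m} \<union> add_mset x ` {a. a \<subseteq># m}"
  proof
    fix a assume a: "a \<in> {a. a \<subseteq># add_mset x m}"
    show "a \<in> {a. a \<subseteq># m} \<union> add_mset x ` {a. a \<subseteq># m}"
    proof (cases "x \<in># a")
      case True
      then obtain b where "a = add_mset x b" by (metis mset_add)
      then show ?thesis using a by auto
    next
      case False
      then show ?thesis using a
        by (metis (no_types, lifting) UnI1 diff_single_trivial mem_Collect_eq
            subset_eq_diff_conv add_mset_add_single)
    qed
  qed
  then show ?case using add by (meson finite_Un finite_imageI finite_subset)
qed simp

lemma finite_sum_eq_mset: "finite {(a, b). a + b = (m::'a multiset)}"
proof -
  have "{(a, b). a + b = m} \<subseteq> {a. a \<subseteq># m} \<times> {a. a \<subseteq># m}" by auto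
  then show ?thesis by (rule finite_subset) (simp add: finite_subseteq_mset)
qed

text \<open>A sum over the splittings of a monomial is the shape of \<open>mpoly_mult\<close>, which
  makes the comparison with ring records immediate.\<close>

lemma lookup_mult_sum:
  fixes P Q :: "'k multiset \<Rightarrow>\<^sub>0 'a::semiring_0"
  shows "lookup (P * Q) m = (\<Sum>(a, b)\<in>{(a, b). a + b = m}. lookup P a * lookup Q b)"
proof -
  have inner: "(\<Sum>q. lookup Q q when m = a + q) = (if a \<subseteq># m then lookup Q (m - a) else 0)" for a
  proof (cases "a \<subseteq># m")
    case True
    then have "(\<lambda>q. lookup Q q when m = a + q) = (\<lambda>q. lookup Q q when q = m - a)"
      by (intro ext) (auto simp: when_def)
    then show ?thesis using True by (simp only: Sum_any_when_equal if_True)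
  next
    case False
    then have "(\<lambda>q. lookup Q q when m = a + q) = (\<lambda>q. 0)"
      by (intro ext) (simp add: when_def, metis mset_subset_eq_add_left)
    then show ?thesis using False by (simp only: if_False) simp
  qed
  have "lookup (P * Q) m = (\<Sum>a. lookup P a * (if a \<subseteq># m then lookup Q (m - a) else 0))"
    by (simp add: lookup_mult inner)
  also have "\<dots> = (\<Sum>a\<in>{a. a \<subseteq># m}. lookup P a * (if a \<subseteq># m then lookup Q (m - a) else 0))"
    by (rule Sum_any.expand_superset) (auto simp: finite_subseteq_mset split: if_splits)
  also have "\<dots> = (\<Sum>(a, b)\<in>{(a, b). a + b = m}. lookup P a * lookup Q b)"
    by (rule sum.reindex_bij_witness[of _ fst "\<lambda>a. (a, m - a)"]) auto
  finally show ?thesis .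
qed

section \<open>Restriction to given variables and to homogeneous components\<close>

definition filt :: "'k set \<Rightarrow> ('k \<Rightarrow>\<^sub>0 'a::zero) \<Rightarrow> ('k \<Rightarrow>\<^sub>0 'a)" where
  "filt M P = Abs_poly_mapping (\<lambda>m. if m \<in> M then lookup P m else 0)"

lemma lookup_filt: "lookup (filt M P) m = (if m \<in> M then lookup P m else 0)"
proof -
  have "finite {m. (if m \<in> M then lookup P m else 0) \<noteq> 0}"
    by (rule finite_subset[OF _ finite_lookup[of P]]) auto
  then show ?thesis by (simp add: filt_def)
qed

lemma filt_0 [simp]: "filt M 0 = 0"
  by (intro poly_mapping_eqI) (simp add: lookup_filt)

lemma filt_add: "filt M (P + Q) = filt M P + filt M (Q :: _ \<Rightarrow>\<^sub>0 'a::monoid_add)"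
  by (intro poly_mapping_eqI) (simp add: lookup_filt lookup_add)

lemma filt_sum: "filt M (sum f A) = (\<Sum>x\<in>A. filt M (f x :: _ \<Rightarrow>\<^sub>0 'a::comm_monoid_add))"
  by (intro poly_mapping_eqI) (simp add: lookup_filt lookup_sum)

lemma filt_commute: "filt M (filt N P) = filt N (filt M P)"
  by (intro poly_mapping_eqI) (simp add: lookup_filt)

lemma filt_filt [simp]: "filt M (filt M P) = filt M P"
  by (intro poly_mapping_eqI) (simp add: lookup_filt)

abbreviation cst :: "'a \<Rightarrow> 'a::comm_ring_1 mpol" where
  "cst c \<equiv> single {#} c"

text \<open>This is the substitution of 0 for all variables of index at least l, hence a ring
  endomorphism. The type has infinitely many variables, and K[x_0, ..., x_(l-1)] appears in it as
  the fixed points of \<open>keep l\<close>; applying \<open>keep l\<close> to a quotient brings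
  divisibility in the large ring back to the small one.\<close>

definition keep :: "nat \<Rightarrow> 'a::comm_ring_1 mpol \<Rightarrow> 'a mpol" where
  "keep l = filt {m. set_mset m \<subseteq> {..<l}}"

text \<open>Homogeneity of degree d is written \<open>hpart d P = P\<close>, so that 0 is
  homogeneous of every degree.\<close>

definition hpart :: "nat \<Rightarrow> 'a::comm_ring_1 mpol \<Rightarrow> 'a mpol" where
  "hpart d = filt {m. size m = d}"

lemma lookup_keep: "lookup (keep l P) m = (if set_mset m \<subseteq> {..<l} then lookup P m else 0)"
  by (simp add: keep_def lookup_filt)

lemma lookup_hpart: "lookup (hpart d P) m = (if size m = d then lookup P m else 0)"
  by (simp add: hpart_def lookup_filt)

lemma keep_id_iff: "keep l P = P \<longleftrightarrow> (\<forall>m. lookup P m \<noteq> 0 \<longrightarrow> set_mset m \<subseteq> {..<l})"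
  by (auto simp: poly_mapping_eq_iff fun_eq_iff lookup_keep)

lemma hpart_id_iff: "hpart d P = P \<longleftrightarrow> (\<forall>m. lookup P m \<noteq> 0 \<longrightarrow> size m = d)"
  by (auto simp: poly_mapping_eq_iff fun_eq_iff lookup_hpart)

lemma keep_mult: "keep l (P * Q) = keep l P * keep l Q"
proof (intro poly_mapping_eqI)
  fix m
  show "lookup (keep l (P * Q)) m = lookup (keep l P * keep l Q) m"
  proof (cases "set_mset m \<subseteq> {..<l}")
    case True
    then show ?thesis
      by (simp add: lookup_keep lookup_mult_sum) (rule sum.cong, auto simp: lookup_keep)
  next
    case False
    then show ?thesis
      by (simp add: lookup_keep lookup_mult_sum) (rule sum.neutral, auto)
  qed
qed

lemma keep_cst [simp]: "keep l (cst c) = cst c"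
  by (intro poly_mapping_eqI) (auto simp: lookup_keep lookup_single when_def)

lemma keep_one [simp]: "keep l 1 = 1"
  using keep_cst[of l 1] by simp

lemma comm_ring_hom_keep: "comm_ring_hom (keep l)"
  by unfold_locales (simp_all add: keep_mult, simp_all add: keep_def filt_add)

lemma keep_sum: "keep l (sum f A) = (\<Sum>x\<in>A. keep l (f x))"
  by (simp add: keep_def filt_sum)

lemma keep_0 [simp]: "keep l 0 = 0" and keep_keep [simp]: "keep l (keep l P) = keep l P"
  by (simp_all add: keep_def)

lemma hpart_0 [simp]: "hpart d 0 = 0" and hpart_hpart [simp]: "hpart d (hpart d P) = hpart d P"
  by (simp_all add: hpart_def)

lemma hpart_add: "hpart d (P + Q) = hpart d P + hpart d Q"
  by (simp add: hpart_def filt_add)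

lemma hpart_sum: "hpart d (sum f A) = (\<Sum>x\<in>A. hpart d (f x))"
  by (simp add: hpart_def filt_sum)

lemma hpart_keep: "hpart d (keep l P) = keep l (hpart d P)"
  by (simp add: hpart_def keep_def filt_commute)

text \<open>All monomials of P have size e, so only the component of Q of degree d - e contributes
  in degree d. The case e > d is separate because truncated subtraction would select the constant
  term of Q.\<close>

lemma hpart_mult_left:
  assumes "hpart e P = P"
  shows "hpart d (P * Q) = (if e \<le> d then P * hpart (d - e) Q else 0)"
proof (intro poly_mapping_eqI)
  fix m
  have P: "lookup P a \<noteq> 0 \<Longrightarrow> size a = e" for a using assms hpart_id_iff by blast
  show "lookup (hpart d (P * Q)) m = lookup (if e \<le> d then P * hpart (d - e) Q else 0) m"
  proof (cases "size m = d")
    case True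
    show ?thesis
    proof (cases "e \<le> d")
      case e: True
      have "(\<Sum>(a, b)\<in>{(a, b). a + b = m}. lookup P a * lookup Q b)
          = (\<Sum>(a, b)\<in>{(a, b). a + b = m}. lookup P a * lookup (hpart (d - e) Q) b)"
      proof (intro sum.cong refl, clarify)
        fix a b assume "m = a + b"
        then show "lookup P a * lookup Q b = lookup P a * lookup (hpart (d - e) Q) b"
          using P[of a] True by (cases "lookup P a = 0") (auto simp: lookup_hpart)
      qed
      then show ?thesis using True e by (simp add: lookup_hpart lookup_mult_sum)
    next
      case False
      have "(\<Sum>(a, b)\<in>{(a, b). a + b = m}. lookup P a * lookup Q b) = 0"
      proof (intro sum.neutral ballI, clarify)
        fix a b assume "m = a + b"
        then show "lookup P a * lookup Q b = 0"
          using P[of a] True False by (cases "lookup P a = 0") auto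
      qed
      then show ?thesis using True False by (simp add: lookup_hpart lookup_mult_sum)
    qed
  next
    case False
    have "(\<Sum>(a, b)\<in>{(a, b). a + b = m}. lookup P a * lookup (hpart (d - e) Q) b) = 0" if "e \<le> d"
    proof (intro sum.neutral ballI, clarify)
      fix a b assume "m = a + b"
      then show "lookup P a * lookup (hpart (d - e) Q) b = 0"
        using P[of a] False that by (cases "lookup P a = 0") (auto simp: lookup_hpart)
    qed
    then show ?thesis using False by (simp add: lookup_hpart lookup_mult_sum)
  qed
qed

lemma homog_mult: "hpart d P = P \<Longrightarrow> hpart e Q = Q \<Longrightarrow> hpart (d + e) (P * Q) = P * Q"
  by (simp add: hpart_mult_left)

lemma homog_cst: "hpart 0 (cst c) = cst c"
  by (simp add: hpart_id_iff lookup_single when_def)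

lemma homog_0_cst: "hpart 0 P = cst (lookup P {#})"
  by (intro poly_mapping_eqI) (auto simp: lookup_hpart lookup_single when_def)

lemma homog_prod:
  assumes "finite A" "\<And>x. x \<in> A \<Longrightarrow> hpart (d x) (f x) = f x"
  shows "hpart (sum d A) (prod f A) = prod f A"
  using assms
proof (induction A rule: finite_induct)
  case empty
  then show ?case using homog_cst[of 1] by simp
next
  case (insert x A)
  then show ?case by (simp add: homog_mult)
qed

lemma hpart_cst_mult: "hpart d (cst c * P) = cst c * hpart d P"
  by (simp add: hpart_mult_left[OF homog_cst])

lemma poly_eq_sum_hpart: "\<exists>N0. \<forall>N\<ge>N0. P = (\<Sum>d<N. hpart d P)"
proof (intro exI allI impI)
  fix N assume "Suc (Max (size ` keys P)) \<le> N"
  then have N: "lookup P m \<noteq> 0 \<Longrightarrow> size m < N" for m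
    by (rule less_le_trans[rotated]) (simp add: in_keys_iff less_Suc_eq_le)
  show "P = (\<Sum>d<N. hpart d P)"
  proof (intro poly_mapping_eqI)
    fix m
    have "lookup (\<Sum>d<N. hpart d P) m = (\<Sum>d<N. if d = size m then lookup P m else 0)"
      by (auto simp: lookup_sum lookup_hpart intro!: sum.cong)
    also have "\<dots> = lookup P m" using N[of m] by auto
    finally show "lookup P m = lookup (\<Sum>d<N. hpart d P) m" by simp
  qed
qed

text \<open>Multiplicativity of the constant coefficient is a test for units: a divisor of 1 has a
  nonzero constant coefficient, so no linear form divides 1.\<close>

lemma lookup_mult_empty: "lookup (P * Q) {#} = lookup P {#} * lookup (Q::'a::comm_ring_1 mpol) {#}"
proof -
  have "{(a, b). a + b = {#}} = {({#}, {#} :: nat multiset)}" by auto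
  then show ?thesis by (simp add: lookup_mult_sum)
qed

lemma lookup_cst_mult: "lookup (cst c * P) m = c * lookup (P::'a::comm_ring_1 mpol) m"
proof -
  have "lookup (cst c * P) m = (\<Sum>x\<in>{(a, b). a + b = m}. if x = ({#}, m) then c * lookup P m else 0)"
    unfolding lookup_mult_sum
    by (intro sum.cong refl) (auto simp: lookup_single when_def split: if_splits)
  then show ?thesis by (simp add: finite_sum_eq_mset)
qed

lemma cst_eq_0_iff [simp]: "cst c = 0 \<longleftrightarrow> c = 0"
  by (metis lookup_single_eq lookup_zero single_zero)

lemma cst_mult: "cst (a * b) = cst a * cst b"
  by (simp add: mult_single)

text \<open>Every Leibniz product takes one entry from each row, so the row degrees add up; the
  signs are constants of degree 0.\<close>

lemma fdet_homog:
  assumes "\<And>i j. i < l \<Longrightarrow> j < l \<Longrightarrow> hpart (d i) (A i j) = A i j"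
  shows "hpart (\<Sum>i<l. d i) (fdet l A) = fdet l A"
proof -
  have sgn: "signof p * P = cst (signof p) * P" for p and P :: "'a mpol"
    by (simp add: sign_def)
  have "hpart (\<Sum>i<l. d i) (\<Prod>i=0..<l. A i (p i)) = (\<Prod>i=0..<l. A i (p i))" if "p permutes {0..<l}" for p
    using permutes_in_image[OF that] assms unfolding lessThan_atLeast0
    by (intro homog_prod) auto
  then show ?thesis
    unfolding fdet_leibniz hpart_sum sgn hpart_cst_mult by (intro sum.cong) auto
qed

section \<open>Linear forms are prime\<close>

lemma poly_eq_sum_single: "P = (\<Sum>m\<in>keys P. single m (lookup P m))"
proof (rule poly_mapping_eqI)
  fix m
  have "lookup (\<Sum>m\<in>keys P. single m (lookup P m)) m
      = (\<Sum>m'\<in>keys P. if m' = m then lookup P m' else 0)"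
    by (auto simp: lookup_sum lookup_single when_def intro!: sum.cong)
  also have "\<dots> = lookup P m" by (auto simp: in_keys_iff)
  finally show "lookup P m = lookup (\<Sum>m\<in>keys P. single m (lookup P m)) m" by simp
qed

section \<open>Substitution of polynomials for the variables\<close>

definition subst :: "(nat \<Rightarrow> 'a::comm_ring_1 mpol) \<Rightarrow> 'a mpol \<Rightarrow> 'a mpol" where
  "subst v P = (\<Sum>m\<in>keys P. cst (lookup P m) * (\<Prod>j\<in>#m. v j))"

lemma subst_superset:
  "finite A \<Longrightarrow> keys P \<subseteq> A \<Longrightarrow> subst v P = (\<Sum>m\<in>A. cst (lookup P m) * (\<Prod>j\<in>#m. v j))"
  unfolding subst_def by (intro sum.mono_neutral_left) (auto simp: in_keys_iff)

lemma subst_single: "subst v (single m c) = cst c * (\<Prod>j\<in>#m. v j)"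
  by (subst subst_superset[of "{m}"]) auto

lemma subst_add: "subst v (P + Q) = subst v P + subst v Q"
proof -
  let ?A = "keys P \<union> keys Q"
  have "keys (P + Q) \<subseteq> ?A" by (rule Poly_Mapping.keys_add)
  then show ?thesis
    by (simp add: subst_superset[of ?A] lookup_add single_add algebra_simps sum.distrib)
qed

lemma subst_0 [simp]: "subst v 0 = 0"
  by (simp add: subst_def)

lemma subst_sum: "subst v (sum f A) = (\<Sum>x\<in>A. subst v (f x))"
  by (induction A rule: infinite_finite_induct) (auto simp: subst_add)

lemma subst_mult_single:
  "subst v (single a c * single b d) = subst v (single a c) * subst v (single b d)"
  by (subst mult_single) (simp add: subst_single cst_mult mult_ac)

lemma subst_mult: "subst v (P * Q) = subst v P * subst v Q"
proof -
  have "subst v (P * Q) = subst v ((\<Sum>m\<in>keys P. single m (lookup P m)) *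
      (\<Sum>m\<in>keys Q. single m (lookup Q m)))"
    by (simp only: poly_eq_sum_single[symmetric])
  also have "\<dots> = (\<Sum>a\<in>keys P. \<Sum>b\<in>keys Q.
      subst v (single a (lookup P a)) * subst v (single b (lookup Q b)))"
    by (simp only: sum_product subst_sum subst_mult_single)
  also have "\<dots> = subst v (\<Sum>m\<in>keys P. single m (lookup P m)) *
      subst v (\<Sum>m\<in>keys Q. single m (lookup Q m))"
    by (simp add: sum_product subst_sum)
  also have "\<dots> = subst v P * subst v Q" by (simp only: poly_eq_sum_single[symmetric])
  finally show ?thesis .
qed

text \<open>A substitution that is the identity modulo d on the variables is so on monomials, by
  telescoping products, and hence on all polynomials.\<close>

lemma dvd_subst_diff:
  assumes "\<And>j. d dvd v j - single {#j#} 1"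
  shows "d dvd subst v P - P"
proof -
  have mon: "d dvd (\<Prod>j\<in>#m. v j) - single m 1" for m
  proof (induction m)
    case (add x m)
    have "(\<Prod>j\<in>#add_mset x m. v j) - single (add_mset x m) 1
        = (v x - single {#x#} 1) * (\<Prod>j\<in>#m. v j) + single {#x#} 1 * ((\<Prod>j\<in>#m. v j) - single m 1)"
      by (simp add: algebra_simps mult_single)
    then show ?case using assms[of x] add by (metis dvd_add dvd_mult dvd_mult2)
  qed simp
  have "(\<Sum>m\<in>keys P. cst (lookup P m) * ((\<Prod>j\<in>#m. v j) - single m 1))
      = subst v P - (\<Sum>m\<in>keys P. single m (lookup P m))"
    by (simp add: subst_def right_diff_distrib sum_subtractf mult_single)
  then have "subst v P - P = (\<Sum>m\<in>keys P. cst (lookup P m) * ((\<Prod>j\<in>#m. v j) - single m 1))"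
    by (simp only: poly_eq_sum_single[symmetric])
  then show ?thesis using mon by (simp add: dvd_sum)
qed

definition lform :: "nat \<Rightarrow> (nat \<Rightarrow> 'a) \<Rightarrow> 'a::comm_ring_1 mpol" where
  "lform l a = (\<Sum>j<l. single {#j#} (a j))"

lemma lookup_lform: "lookup (lform l a) m = (\<Sum>j<l. if m = {#j#} then a j else 0)"
  by (auto simp: lform_def lookup_sum lookup_single when_def intro!: sum.cong)

lemma lookup_lform_single: "k < l \<Longrightarrow> lookup (lform l a) {#k#} = a k"
  by (simp add: lookup_lform)

lemma lookup_lform_empty: "lookup (lform l a) {#} = 0"
  by (simp add: lookup_lform)

lemma lookup_lform_nonzeroD: "lookup (lform l a) m \<noteq> 0 \<Longrightarrow> \<exists>j<l. m = {#j#}"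
  by (rule ccontr) (auto simp: lookup_lform)

lemma homog_lform: "hpart 1 (lform l a) = lform l a"
  unfolding hpart_id_iff by (auto dest!: lookup_lform_nonzeroD)

lemma keep_lform: "keep l (lform l a) = lform l a"
  unfolding keep_id_iff by (auto dest!: lookup_lform_nonzeroD)

lemma lform_scale: "lform l (\<lambda>j. c * a j) = cst c * lform l a"
  by (simp add: lform_def sum_distrib_left mult_single)

lemma prime_elem_lform:
  fixes a :: "nat \<Rightarrow> 'a::field"
  assumes k: "k < l" "a k \<noteq> 0"
  shows "prime_elem (lform l a)"
proof (rule prime_elemI)
  \<comment> \<open>The form L is solved for variable k: x_k becomes x_k - L / a_k and the other
    variables stay. This substitution kills L and is the identity modulo L, so its kernel is exactly
    the ideal of L; L is prime because the target has no zero divisors.\<close>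
  define v where "v j = single {#j#} 1 - (if j = k then cst (1 / a k) * lform l a else 0)" for j
  have "subst v (lform l a) = (\<Sum>j<l. cst (a j) * v j)"
    by (simp add: lform_def subst_sum subst_single)
  also have "\<dots> = (\<Sum>j<l. single {#j#} (a j)) -
      (\<Sum>j<l. if j = k then cst (a k) * (cst (1 / a k) * lform l a) else 0)"
    by (subst sum_subtractf[symmetric])
      (auto simp: v_def right_diff_distrib mult_single intro!: sum.cong)
  also have "\<dots> = lform l a - cst (a k) * (cst (1 / a k) * lform l a)"
    using k by (simp add: lform_def)
  also have "\<dots> = 0"
    using k by (simp add: mult.assoc[symmetric] cst_mult[symmetric])
  finally have ker: "subst v (lform l a) = 0" .
  have "lform l a dvd v j - single {#j#} 1" for j
    by (simp add: v_def)
  note mod = dvd_subst_diff[of "lform l a" v, OF this]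
  have iff: "lform l a dvd P \<longleftrightarrow> subst v P = 0" for P
  proof
    assume "lform l a dvd P"
    then show "subst v P = 0" using ker by (auto simp: subst_mult)
  next
    assume "subst v P = 0"
    then show "lform l a dvd P" using mod[of P] by simp
  qed
  show "lform l a dvd P \<or> lform l a dvd R" if "lform l a dvd P * R" for P R
    using that by (simp add: iff subst_mult)
  show "lform l a \<noteq> 0" using k lookup_lform_single[OF k(1), of a] by auto
  show "\<not> lform l a dvd 1"
  proof
    assume "lform l a dvd 1"
    then obtain g where g: "1 = lform l a * g" by auto
    have "lookup (lform l a * g) {#} = 0" by (simp add: lookup_mult_empty lookup_lform_empty)
    then show False unfolding g[symmetric] by (simp add: lookup_one)
  qed
qed

text \<open>In degree 1 only the constant term of the quotient survives, so divisibility between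
  linear forms means proportionality.\<close>

lemma lform_dvd_lformD:
  fixes a b :: "nat \<Rightarrow> 'a::field"
  assumes "lform l a dvd lform l b"
  obtains c where "\<And>k. k < l \<Longrightarrow> b k = c * a k"
proof -
  obtain g where g: "lform l b = lform l a * g" using assms by auto
  have "lform l b = hpart 1 (lform l a * g)" by (simp only: g[symmetric] homog_lform)
  also have "\<dots> = cst (lookup g {#}) * lform l a"
    by (subst hpart_mult_left[OF homog_lform]) (simp add: homog_0_cst mult.commute)
  finally have "lform l b = lform l (\<lambda>j. lookup g {#} * a j)" by (simp add: lform_scale)
  then show ?thesis using lookup_lform_single that by metis
qed

section \<open>Cancellation of prime factors\<close>

lemma prime_elem_dvd_prodD:
  fixes p :: "'a::comm_semiring_1"
  shows "prime_elem p \<Longrightarrow> p dvd prod f A \<Longrightarrow> \<exists>i\<in>A. p dvd f i"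
  by (induction A rule: infinite_finite_induct) (auto dest: prime_elem_dvd_multD prime_elem_not_unit)

lemma prod_primes_dvd:
  fixes p :: "nat \<Rightarrow> 'a::idom"
  assumes "\<And>i. i < m \<Longrightarrow> prime_elem (p i)" "\<And>i j. i < m \<Longrightarrow> j < m \<Longrightarrow> i \<noteq> j \<Longrightarrow> \<not> p i dvd p j"
    and "\<And>i. i < m \<Longrightarrow> p i dvd x"
  shows "(\<Prod>i<m. p i) dvd x"
  using assms
proof (induction m)
  case (Suc m)
  then have "(\<Prod>i<m. p i) dvd x" by simp
  then obtain g where g: "x = (\<Prod>i<m. p i) * g" by auto
  have "\<not> p m dvd (\<Prod>i<m. p i)"
  proof
    assume "p m dvd (\<Prod>i<m. p i)"
    then obtain i where "i < m" "p m dvd p i"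
      using prime_elem_dvd_prodD[OF Suc.prems(1)[of m]] by auto
    then show False using Suc.prems(2)[of m i] by simp
  qed
  moreover have "p m dvd (\<Prod>i<m. p i) * g" using Suc.prems(3)[of m] g by simp
  ultimately have "p m dvd g" using Suc.prems(1)[of m] prime_elem_dvd_mult_iff by blast
  then show ?case using g by (auto simp: mult_ac)
qed simp

lemma dvd_cancel_prime:
  fixes p :: "'a::idom"
  assumes "prime_elem p" "\<not> p dvd f" "f dvd p * y"
  shows "f dvd y"
proof -
  obtain g where g: "p * y = f * g" using assms(3) by auto
  then have "p dvd g" using assms by (metis dvd_triv_left prime_elem_dvd_mult_iff)
  then obtain h where "g = p * h" by auto
  then have "p * y = p * (f * h)" using g by (simp add: mult_ac)
  then have "y = f * h" using assms(1) by (simp add: prime_elem_def)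
  then show ?thesis by simp
qed

lemma dvd_cancel_prime_prod:
  fixes p :: "'b \<Rightarrow> 'a::idom"
  assumes "finite A" "\<And>i. i \<in> A \<Longrightarrow> prime_elem (p i)" "\<And>i. i \<in> A \<Longrightarrow> \<not> p i dvd f"
    and "f dvd (\<Prod>i\<in>A. p i) * y"
  shows "f dvd y"
  using assms
proof (induction A arbitrary: y rule: finite_induct)
  case (insert x A)
  from insert.prems(3) have "f dvd p x * ((\<Prod>i\<in>A. p i) * y)"
    using insert.hyps by (simp add: mult.assoc)
  then have "f dvd (\<Prod>i\<in>A. p i) * y"
    by (rule dvd_cancel_prime[OF insert.prems(1)[OF insertI1] insert.prems(2)[OF insertI1]])
  then show ?case by (rule insert.IH[rotated 2]) (use insert.prems in auto)
qed simp

text \<open>With y = 1 this shows that a divisor of a power of a product of primes is a unit if none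
  of the primes divides it.\<close>

lemma dvd_cancel_prime_prod_power:
  fixes p :: "'b \<Rightarrow> 'a::idom"
  assumes "finite A" "\<And>i. i \<in> A \<Longrightarrow> prime_elem (p i)" "\<And>i. i \<in> A \<Longrightarrow> \<not> p i dvd f"
    and "f dvd (\<Prod>i\<in>A. p i) ^ N * y"
  shows "f dvd y"
  using assms(4)
proof (induction N)
  case (Suc N)
  then have "f dvd (\<Prod>i\<in>A. p i) * ((\<Prod>i\<in>A. p i) ^ N * y)" by (simp add: mult_ac)
  then have "f dvd (\<Prod>i\<in>A. p i) ^ N * y"
    using dvd_cancel_prime_prod[OF assms(1), of p f "(\<Prod>i\<in>A. p i) ^ N * y"] assms(2,3) by blast
  then show ?case by (rule Suc.IH)
qed simp

section \<open>Saito's criterion\<close>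

lemma left_kernel_trivial:
  fixes A :: "nat \<Rightarrow> nat \<Rightarrow> 'a::idom"
  assumes "fdet l A \<noteq> 0" "\<And>j. j < l \<Longrightarrow> (\<Sum>i<l. f i * A i j) = 0" "k < l"
  shows "f k = 0"
proof -
  define C where "C = fadj l A"
  note C = fadj_mult_right[of _ l _ A, folded C_def]
  have "0 = (\<Sum>j<l. (\<Sum>i<l. f i * A i j) * C j k)" by (simp add: assms(2))
  also have "\<dots> = (\<Sum>i<l. f i * (\<Sum>j<l. A i j * C j k))"
    unfolding sum_distrib_left sum_distrib_right by (subst sum.swap) (simp add: mult.assoc)
  also have "\<dots> = (\<Sum>i<l. if i = k then f i * fdet l A else 0)"
    using C assms(3) by (intro sum.cong) auto
  also have "\<dots> = f k * fdet l A" using assms(3) by simp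
  finally show ?thesis using assms(1) by simp
qed

text \<open>A rank inequality over a domain: if m < l, both factors can be padded with zeros to
  square matrices, and \<open>q ^ l\<close> would be a multiple of the determinant of a matrix with
  a zero row. It later bounds the size of a basis from both sides.\<close>

lemma diagonal_factorization_le:
  fixes A B :: "nat \<Rightarrow> nat \<Rightarrow> 'a::idom"
  assumes "q \<noteq> 0"
    and AB: "\<And>i k. i < l \<Longrightarrow> k < l \<Longrightarrow> (\<Sum>j<m. A i j * B j k) = (if i = k then q else 0)"
  shows "l \<le> m"
proof (rule ccontr)
  assume m: "\<not> l \<le> m"
  define A' where "A' i j = (if j < m then A i j else 0)" for i j
  define B' where "B' j k = (if j < m then B j k else 0)" for j k
  have "fdet l A' * fdet l B' = fdet l (\<lambda>i k. \<Sum>j<l. A' i j * B' j k)" by (simp add: fdet_mult)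
  also have "\<dots> = fdet l (\<lambda>i k. if i = k then q else 0)"
  proof (rule fdet_cong)
    fix i k assume "i < l" "k < l"
    have "(\<Sum>j<l. A' i j * B' j k) = (\<Sum>j<m. A' i j * B' j k)"
      using m by (intro sum.mono_neutral_right) (auto simp: A'_def)
    also have "\<dots> = (\<Sum>j<m. A i j * B j k)" by (simp add: A'_def B'_def)
    finally show "(\<Sum>j<l. A' i j * B' j k) = (if i = k then q else 0)"
      using AB \<open>i < l\<close> \<open>k < l\<close> by simp
  qed
  also have "\<dots> = q ^ l" by (simp add: fdet_diag)
  finally have "fdet l B' \<noteq> 0" using assms(1) by auto
  moreover have "fdet l B' = 0" using m by (intro fdet_zero_row[of m]) (auto simp: B'_def)
  ultimately show False by simp
qed

lemma dvd_cst_mult_cancel: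
  fixes a :: "'a::field"
  assumes "a \<noteq> 0" "d dvd cst a * x"
  shows "d dvd x"
proof -
  have "d dvd cst (1 / a) * (cst a * x)" using assms(2) by simp
  also have "cst (1 / a) * (cst a * x) = x"
    using assms(1) by (simp add: mult.assoc[symmetric] cst_mult[symmetric])
  finally show ?thesis .
qed

section \<open>Logarithmic derivations and the defining polynomial\<close>

definition apply_lform :: "nat \<Rightarrow> (nat \<Rightarrow> 'a) \<Rightarrow> (nat \<Rightarrow> 'a mpol) \<Rightarrow> 'a::comm_ring_1 mpol" where
  "apply_lform l a \<theta> = (\<Sum>j<l. cst (a j) * \<theta> j)"

definition logder :: "nat \<Rightarrow> nat \<Rightarrow> (nat \<Rightarrow> nat \<Rightarrow> 'a) \<Rightarrow> (nat \<Rightarrow> 'a::comm_ring_1 mpol) set" where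
  "logder l n \<alpha> = {\<theta>. (\<forall>j. keep l (\<theta> j) = \<theta> j) \<and> (\<forall>j\<ge>l. \<theta> j = 0) \<and>
     (\<forall>i<n. lform l (\<alpha> i) dvd apply_lform l (\<alpha> i) \<theta>)}"

definition free_mod :: "nat \<Rightarrow> (nat \<Rightarrow> 'a::comm_ring_1 mpol) set \<Rightarrow> bool" where
  "free_mod l D \<longleftrightarrow> (\<exists>B\<subseteq>D. \<forall>\<delta>\<in>D. \<exists>!c.
     (\<forall>b. keep l (c b) = c b) \<and> finite {b. c b \<noteq> 0} \<and> {b. c b \<noteq> 0} \<subseteq> B \<and>
     \<delta> = (\<lambda>j. \<Sum>b | c b \<noteq> 0. c b * b j))"

text \<open>Distinctness of the hyperplanes enters as non-divisibility of the forms, which makes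
  them pairwise non-associated primes.\<close>

locale arrangement =
  fixes l n :: nat and \<alpha> :: "nat \<Rightarrow> nat \<Rightarrow> 'a::field"
  assumes nonzero: "i < n \<Longrightarrow> \<exists>k<l. \<alpha> i k \<noteq> 0"
    and distinct: "i < n \<Longrightarrow> j < n \<Longrightarrow> i \<noteq> j \<Longrightarrow> \<not> lform l (\<alpha> i) dvd lform l (\<alpha> j)"
begin

abbreviation L :: "nat \<Rightarrow> 'a mpol" where "L i \<equiv> lform l (\<alpha> i)"

definition Q :: "'a mpol" where "Q = (\<Prod>i<n. L i)"

abbreviation D :: "(nat \<Rightarrow> 'a mpol) set" where "D \<equiv> logder l n \<alpha>"

lemma prime_L: "i < n \<Longrightarrow> prime_elem (L i)"
  using nonzero prime_elem_lform by blast

lemma L_dvd_Q: "i < n \<Longrightarrow> L i dvd Q"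
  unfolding Q_def by (intro dvd_prodI) auto

lemma Q_nonzero: "Q \<noteq> 0"
  using prime_L by (auto simp: Q_def prime_elem_def)

lemma keep_Q: "keep l Q = Q"
proof -
  interpret comm_ring_hom "keep l" by (rule comm_ring_hom_keep)
  show ?thesis by (simp add: Q_def hom_prod keep_lform)
qed

lemma homog_Q: "hpart n Q = Q"
  using homog_prod[of "{..<n}" "\<lambda>_. 1" L, OF _ homog_lform] by (simp add: Q_def)

lemma hpart_Q_mult: "hpart n (Q * g) = Q * cst (lookup g {#})"
  by (simp add: hpart_mult_left[OF homog_Q] homog_0_cst)

text \<open>Combining the values of the rows at form i with the entries of the adjugate gives the
  scalar \<open>\<alpha> i m\<close> times the determinant. All these values are multiples of L_i,
  so L_i divides the determinant, and the forms are non-associated primes.\<close>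

lemma Q_dvd_fdet:
  assumes "\<And>i. i < l \<Longrightarrow> \<theta> i \<in> D"
  shows "Q dvd fdet l \<theta>"
  unfolding Q_def
proof (rule prod_primes_dvd)
  fix i assume i: "i < n"
  then obtain m where m: "m < l" "\<alpha> i m \<noteq> 0" using nonzero by blast
  define C where "C = fadj l \<theta>"
  note C = fadj_mult_left[of _ l _ \<theta>, folded C_def]
  have "(\<Sum>j<l. C m j * apply_lform l (\<alpha> i) (\<theta> j))
      = (\<Sum>k<l. cst (\<alpha> i k) * (\<Sum>j<l. C m j * \<theta> j k))"
    unfolding apply_lform_def sum_distrib_left by (subst sum.swap) (simp add: mult_ac)
  also have "\<dots> = (\<Sum>k<l. if k = m then cst (\<alpha> i m) * fdet l \<theta> else 0)"
    using C m by (intro sum.cong) auto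
  also have "\<dots> = cst (\<alpha> i m) * fdet l \<theta>" using m by simp
  finally have "cst (\<alpha> i m) * fdet l \<theta> = (\<Sum>j<l. C m j * apply_lform l (\<alpha> i) (\<theta> j))" by simp
  moreover have "L i dvd apply_lform l (\<alpha> i) (\<theta> j)" if "j < l" for j
    using assms[OF that] i by (simp add: logder_def)
  ultimately have "L i dvd cst (\<alpha> i m) * fdet l \<theta>" by (auto intro!: dvd_sum dvd_mult)
  then show "L i dvd fdet l \<theta>" by (rule dvd_cst_mult_cancel[OF m(2)])
qed (use prime_L distinct in auto)

lemma logder_sum:
  assumes "\<And>x. x \<in> A \<Longrightarrow> \<theta> x \<in> D" "\<And>x. x \<in> A \<Longrightarrow> keep l (f x) = f x"
  shows "(\<lambda>j. \<Sum>x\<in>A. f x * \<theta> x j) \<in> D"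
proof -
  have "apply_lform l a (\<lambda>j. \<Sum>x\<in>A. f x * \<theta> x j) = (\<Sum>x\<in>A. f x * apply_lform l a (\<theta> x))" for a
    unfolding apply_lform_def sum_distrib_left by (subst sum.swap) (simp add: mult_ac)
  then show ?thesis using assms
    by (auto simp: logder_def keep_sum keep_mult intro!: dvd_sum dvd_mult)
qed

text \<open>Multiples of a homogeneous form have multiples of it as components, so the module is
  graded.\<close>

lemma logder_hpart:
  assumes "\<delta> \<in> D"
  shows "(\<lambda>j. hpart d (\<delta> j)) \<in> D"
proof -
  have "apply_lform l a (\<lambda>j. hpart d (\<delta> j)) = hpart d (apply_lform l a \<delta>)" for a
    by (simp add: apply_lform_def hpart_sum hpart_cst_mult)
  moreover have "L i dvd hpart d (L i * g)" for i g
    by (subst hpart_mult_left[OF homog_lform]) auto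
  ultimately show ?thesis using assms
    by (auto simp: logder_def hpart_keep[symmetric] elim!: dvdE)
qed

text \<open>These fields witness that the module has full rank; their expansion in a basis ties its
  determinant to a power of \<open>Q\<close>.\<close>

lemma logder_Q_partial: "(\<lambda>k. if k = j then Q else 0) \<in> D" if "j < l"
proof -
  have "apply_lform l a (\<lambda>k. if k = j then Q else 0) = cst (a j) * Q" for a
  proof -
    have "apply_lform l a (\<lambda>k. if k = j then Q else 0) = (\<Sum>k<l. if k = j then cst (a j) * Q else 0)"
      unfolding apply_lform_def by (intro sum.cong) auto
    then show ?thesis using that by simp
  qed
  then show ?thesis using that L_dvd_Q by (auto simp: logder_def keep_Q)
qed

text \<open>By Cramer's rule the coefficient of a derivation at \<open>\<theta> i\<close> is the
  determinant with row i replaced by it, divided by the determinant of \<open>\<theta>\<close>. The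
  numerator is a multiple of \<open>Q\<close> because all its rows are logarithmic, and the
  denominator is a scalar times \<open>Q\<close>.\<close>

lemma free_if_fdet:
  assumes \<theta>: "\<And>i. i < l \<Longrightarrow> \<theta> i \<in> D" and c: "c \<noteq> 0" and det: "fdet l \<theta> = cst c * Q"
  shows "free_mod l D"
proof -
  have nz: "fdet l \<theta> \<noteq> 0" using c Q_nonzero by (simp add: det)
  define C where "C = fadj l \<theta>"
  note C = fdet_update_row[of _ l \<theta>, folded C_def] fadj_mult_left[of _ l _ \<theta>, folded C_def]
    fadj_mult_right[of _ l _ \<theta>, folded C_def]
  \<comment> \<open>Coefficients in \<open>free_mod\<close> are indexed by the basis vectors
    themselves, so the rows must be distinct. For two equal rows the adjugate identity would give
    the same sum the values 0 and the determinant.\<close>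
  have inj: "inj_on \<theta> {..<l}"
  proof (rule inj_onI, rule ccontr)
    fix i k assume ik: "i \<in> {..<l}" "k \<in> {..<l}" "\<theta> i = \<theta> k" "i \<noteq> k"
    then show False using C(3)[of i k] C(3)[of k k] nz by simp
  qed
  have zero: "\<theta> i j = 0" if "i < l" "j \<ge> l" for i j
    using \<theta>[OF that(1)] that(2) by (simp add: logder_def)
  have expand: "\<exists>f. (\<forall>i. keep l (f i) = f i) \<and> \<delta> = (\<lambda>j. \<Sum>i<l. f i * \<theta> i j)" if \<delta>: "\<delta> \<in> D" for \<delta>
  proof -
    have "Q dvd fdet l (\<theta>(i := \<delta>))" if "i < l" for i
      using \<theta> \<delta> by (intro Q_dvd_fdet) auto
    then have "\<exists>g. \<forall>i<l. fdet l (\<theta>(i := \<delta>)) = Q * g i" unfolding dvd_def by metis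
    then obtain g where g: "\<And>i. i < l \<Longrightarrow> fdet l (\<theta>(i := \<delta>)) = Q * g i" by blast
    define f where "f i = cst (1 / c) * g i" for i
    have gf: "Q * g i = fdet l \<theta> * f i" for i
    proof -
      have "fdet l \<theta> * f i = (cst c * cst (1 / c)) * (Q * g i)" by (simp add: det f_def mult_ac)
      also have "cst c * cst (1 / c) = 1" using c by (simp add: cst_mult[symmetric])
      finally show ?thesis by simp
    qed
    have eq: "\<delta> k = (\<Sum>i<l. f i * \<theta> i k)" if k: "k < l" for k
    proof -
      have "fdet l \<theta> * \<delta> k = (\<Sum>j<l. if j = k then \<delta> j * fdet l \<theta> else 0)"
        using k by (simp add: mult.commute)
      also have "\<dots> = (\<Sum>j<l. \<delta> j * (\<Sum>i<l. C j i * \<theta> i k))"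
        using C(2) k by (intro sum.cong) auto
      also have "\<dots> = (\<Sum>i<l. (\<Sum>j<l. \<delta> j * C j i) * \<theta> i k)"
        unfolding sum_distrib_left sum_distrib_right by (subst sum.swap) (simp add: mult.assoc)
      also have "\<dots> = (\<Sum>i<l. fdet l \<theta> * f i * \<theta> i k)"
        using C(1) g gf by (intro sum.cong) auto
      also have "\<dots> = fdet l \<theta> * (\<Sum>i<l. f i * \<theta> i k)" by (simp add: sum_distrib_left mult_ac)
      finally show ?thesis using nz by simp
    qed
    \<comment> \<open>The coefficients were found in the ring of all variables;
      \<open>keep l\<close> moves them to the first l variables and fixes everything else in the
      identity.\<close>
    have "\<delta> k = (\<Sum>i<l. keep l (f i) * \<theta> i k)" for k
    proof (cases "k < l")
      case True
      have "\<delta> k = keep l (\<delta> k)" using \<delta> by (simp add: logder_def)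
      also have "\<dots> = (\<Sum>i<l. keep l (f i) * keep l (\<theta> i k))" by (simp add: eq[OF True] keep_sum keep_mult)
      also have "\<dots> = (\<Sum>i<l. keep l (f i) * \<theta> i k)" using \<theta> by (intro sum.cong) (auto simp: logder_def)
      finally show ?thesis .
    next
      case False
      then show ?thesis using \<delta> zero by (simp add: logder_def)
    qed
    then show ?thesis by (intro exI[of _ "\<lambda>i. keep l (f i)"]) auto
  qed
  have supp: "(\<Sum>b | c b \<noteq> 0. c b * b j) = (\<Sum>i<l. c (\<theta> i) * \<theta> i j)"
    if "{b. c b \<noteq> 0} \<subseteq> \<theta> ` {..<l}" for c :: "(nat \<Rightarrow> 'a mpol) \<Rightarrow> 'a mpol" and j
  proof -
    have "(\<Sum>b | c b \<noteq> 0. c b * b j) = (\<Sum>b\<in>\<theta> ` {..<l}. c b * b j)"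
      using that by (intro sum.mono_neutral_left) auto
    also have "\<dots> = (\<Sum>i<l. c (\<theta> i) * \<theta> i j)" by (simp add: sum.reindex[OF inj])
    finally show ?thesis .
  qed
  show ?thesis unfolding free_mod_def
  proof (intro exI[of _ "\<theta> ` {..<l}"] conjI ballI)
    show "\<theta> ` {..<l} \<subseteq> D" using \<theta> by auto
    fix \<delta> assume \<delta>: "\<delta> \<in> D"
    obtain f where f: "\<And>i. keep l (f i) = f i" "\<delta> = (\<lambda>j. \<Sum>i<l. f i * \<theta> i j)"
      using expand[OF \<delta>] by blast
    define c where "c b = (if b \<in> \<theta> ` {..<l} then f (the_inv_into {..<l} \<theta> b) else 0)" for b
    have c_\<theta>: "c (\<theta> i) = f i" if "i < l" for i
      using that by (simp add: c_def the_inv_into_f_f[OF inj])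
    have c_supp: "{b. c b \<noteq> 0} \<subseteq> \<theta> ` {..<l}" by (auto simp: c_def)
    show "\<exists>!c. (\<forall>b. keep l (c b) = c b) \<and> finite {b. c b \<noteq> 0} \<and>
      {b. c b \<noteq> 0} \<subseteq> \<theta> ` {..<l} \<and> \<delta> = (\<lambda>j. \<Sum>b | c b \<noteq> 0. c b * b j)"
    proof (rule ex1I[of _ c])
      have "keep l (c b) = c b" for b by (simp add: c_def f)
      moreover have "finite {b. c b \<noteq> 0}" using c_supp finite_subset by blast
      moreover have "\<delta> = (\<lambda>j. \<Sum>b | c b \<noteq> 0. c b * b j)"
        unfolding supp[OF c_supp] by (simp add: f(2) c_\<theta>)
      ultimately show "(\<forall>b. keep l (c b) = c b) \<and> finite {b. c b \<noteq> 0} \<and>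
        {b. c b \<noteq> 0} \<subseteq> \<theta> ` {..<l} \<and> \<delta> = (\<lambda>j. \<Sum>b | c b \<noteq> 0. c b * b j)"
        using c_supp by blast
    next
      fix c' assume c': "(\<forall>b. keep l (c' b) = c' b) \<and> finite {b. c' b \<noteq> 0} \<and>
        {b. c' b \<noteq> 0} \<subseteq> \<theta> ` {..<l} \<and> \<delta> = (\<lambda>j. \<Sum>b | c' b \<noteq> 0. c' b * b j)"
      then have supp': "{b. c' b \<noteq> 0} \<subseteq> \<theta> ` {..<l}" by blast
      from c' have "\<delta> = (\<lambda>j. \<Sum>b | c' b \<noteq> 0. c' b * b j)" by blast
      then have \<delta>': "\<delta> = (\<lambda>j. \<Sum>i<l. c' (\<theta> i) * \<theta> i j)" unfolding supp[OF supp'] .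
      have "(\<Sum>i<l. (c' (\<theta> i) - f i) * \<theta> i j) = 0" for j
        using fun_cong[OF \<delta>', of j] fun_cong[OF f(2), of j]
        by (simp add: left_diff_distrib sum_subtractf)
      then have "c' (\<theta> i) - f i = 0" if "i < l" for i
        using left_kernel_trivial[OF nz, of "\<lambda>i. c' (\<theta> i) - f i" i] that by blast
      then have "c' (\<theta> i) = c (\<theta> i)" if "i < l" for i using that c_\<theta> by simp
      then have "c' b = c b" if "b \<in> \<theta> ` {..<l}" for b using that by auto
      moreover have "c' b = 0 \<and> c b = 0" if "b \<notin> \<theta> ` {..<l}" for b using that supp' c_supp by blast
      ultimately show "c' = c" by (metis ext)
    qed
  qed
qed

end

section \<open>From an arbitrary basis to homogeneous derivations\<close>

context arrangement
begin

text \<open>Expanding the fields \<open>Q\<close> d/dx_j in B gives a matrix c whose product with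
  the basis is \<open>Q\<close> times the identity, and uniqueness of expansions gives the product
  in the other order. The two rank inequalities force B to have l elements, and then the two
  determinants multiply to \<open>Q ^ l\<close>.\<close>

lemma basis_det_nonzero:
  assumes "free_mod l D"
  shows "\<exists>\<theta>. (\<forall>i<l. \<theta> i \<in> D) \<and> fdet l \<theta> dvd Q ^ l \<and>
    (\<forall>\<eta>\<in>D. \<exists>f. \<forall>k. \<eta> k = (\<Sum>i<l. f i * \<theta> i k))"
proof -
  obtain B where B: "B \<subseteq> D" and ex: "\<forall>\<delta>\<in>D. \<exists>!c.
     (\<forall>b. keep l (c b) = c b) \<and> finite {b. c b \<noteq> 0} \<and> {b. c b \<noteq> 0} \<subseteq> B \<and>
     \<delta> = (\<lambda>j. \<Sum>b | c b \<noteq> 0. c b * b j)"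
    using assms unfolding free_mod_def by blast
  define rep where "rep \<delta> c \<longleftrightarrow> (\<forall>b. keep l (c b) = c b) \<and> finite {b. c b \<noteq> 0} \<and>
    {b. c b \<noteq> 0} \<subseteq> B \<and> \<delta> = (\<lambda>j. \<Sum>b | c b \<noteq> 0. c b * b j)" for \<delta> and c :: "(nat \<Rightarrow> 'a mpol) \<Rightarrow> 'a mpol"
  have ex_rep: "\<exists>c. rep \<delta> c" if "\<delta> \<in> D" for \<delta>
    using ex that unfolding rep_def by blast
  have rep_unique: "c = c'" if "\<delta> \<in> D" "rep \<delta> c" "rep \<delta> c'" for \<delta> c c'
    using ex that unfolding rep_def by blast
  have rep_sum: "\<delta> k = (\<Sum>x\<in>F. c x * x k)" if "rep \<delta> c" "finite F" "{b. c b \<noteq> 0} \<subseteq> F" for \<delta> c F k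
  proof -
    have "\<delta> k = (\<Sum>b | c b \<noteq> 0. c b * b k)" using that(1) by (auto simp: rep_def)
    also have "\<dots> = (\<Sum>x\<in>F. c x * x k)" using that(2,3) by (intro sum.mono_neutral_left) auto
    finally show ?thesis .
  qed
  have repI: "rep (\<lambda>k. \<Sum>x\<in>F. c x * x k) c"
    if "finite F" "{b. c b \<noteq> 0} \<subseteq> F" "F \<subseteq> B" "\<And>b. keep l (c b) = c b" for F c
  proof -
    have "(\<Sum>x\<in>F. c x * x k) = (\<Sum>b | c b \<noteq> 0. c b * b k)" for k
      using that(1,2) by (intro sum.mono_neutral_right) auto
    then show ?thesis using that finite_subset unfolding rep_def by auto
  qed
  have "\<exists>c. \<forall>j<l. rep (\<lambda>k. if k = j then Q else 0) (c j)"
    using ex_rep[OF logder_Q_partial] by metis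
  then obtain c where c: "\<And>j. j < l \<Longrightarrow> rep (\<lambda>k. if k = j then Q else 0) (c j)" by blast
  \<comment> \<open>The finitely many basis elements that occur in the expansions of the l
    coordinate fields.\<close>
  define F0 where "F0 = (\<Union>j<l. {b. c j b \<noteq> 0})"
  have F0: "finite F0" "F0 \<subseteq> B" using c by (auto simp: F0_def rep_def)
  have keep_c: "keep l (c j b) = c j b" if "j < l" for j b using c[OF that] by (auto simp: rep_def)
  have F0_sub: "{b. c j b \<noteq> 0} \<subseteq> F0" if "j < l" for j using that by (auto simp: F0_def)
  have M1: "(\<Sum>x\<in>F. c j x * x k) = (if j = k then Q else 0)"
    if "finite F" "F0 \<subseteq> F" "j < l" for F j k
  proof -
    have "{b. c j b \<noteq> 0} \<subseteq> F" using F0_sub[OF that(3)] that(2) by blast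
    then show ?thesis using rep_sum[OF c[OF that(3)] that(1), of k] by auto
  qed
  \<comment> \<open>\<open>Q\<close> times the basis element x has two expansions: \<open>Q\<close>
    at x alone, and the one obtained by writing x in coordinates and expanding each coordinate
    field. Uniqueness equates their coefficients at y.\<close>
  have M2: "(\<Sum>j<l. x j * c j y) = (if x = y then Q else 0)" if x: "x \<in> B" for x y
  proof -
    define c1 where "c1 y = (if y = x then Q else 0)" for y
    define c2 where "c2 y = (\<Sum>j<l. x j * c j y)" for y
    have keep_x: "keep l (x j) = x j" and zero_x: "j \<ge> l \<Longrightarrow> x j = 0" for j
      using x B by (auto simp: logder_def)
    have r1: "rep (\<lambda>k. \<Sum>y\<in>insert x F0. c1 y * y k) c1"
      using F0 x by (intro repI) (auto simp: c1_def keep_Q)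
    have c2_supp: "{y. c2 y \<noteq> 0} \<subseteq> insert x F0"
    proof
      fix y assume "y \<in> {y. c2 y \<noteq> 0}"
      then obtain j where "j < l" "x j * c j y \<noteq> 0"
        unfolding c2_def by (metis (mono_tags, lifting) lessThan_iff mem_Collect_eq sum.neutral)
      then show "y \<in> insert x F0" using F0_sub by auto
    qed
    have keep_c2: "keep l (c2 y) = c2 y" for y
      by (simp add: c2_def keep_sum keep_mult keep_x keep_c)
    have r2: "rep (\<lambda>k. \<Sum>y\<in>insert x F0. c2 y * y k) c2"
      using F0 x c2_supp keep_c2 by (intro repI) auto
    have fin: "finite (insert x F0)" using F0 by simp
    have e1: "(\<Sum>y\<in>insert x F0. c1 y * y k) = Q * x k" for k
    proof -
      have "(\<Sum>y\<in>insert x F0. c1 y * y k) = (\<Sum>y\<in>insert x F0. if y = x then Q * x k else 0)"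
        by (intro sum.cong) (auto simp: c1_def)
      then show ?thesis using fin by simp
    qed
    have e2: "(\<Sum>y\<in>insert x F0. c2 y * y k) = Q * x k" for k
    proof -
      have "(\<Sum>y\<in>insert x F0. c2 y * y k) = (\<Sum>j<l. x j * (\<Sum>y\<in>insert x F0. c j y * y k))"
        unfolding c2_def sum_distrib_left sum_distrib_right by (subst sum.swap) (simp add: mult.assoc)
      also have "\<dots> = (\<Sum>j<l. if j = k then x j * Q else 0)"
        using M1[OF fin subset_insertI] by (intro sum.cong) auto
      also have "\<dots> = Q * x k" using zero_x[of k] by (simp add: mult.commute)
      finally show ?thesis .
    qed
    have "(\<lambda>k. \<Sum>y\<in>{x}. Q * y k) \<in> D"
      by (rule logder_sum[where \<theta> = "\<lambda>y. y"]) (use x B keep_Q in auto)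
    then have "(\<lambda>k. Q * x k) \<in> D" by simp
    then have "c1 = c2" using rep_unique r1 r2 unfolding e1 e2 by blast
    then have "c1 y = c2 y" by simp
    then show ?thesis unfolding c1_def c2_def by (simp add: eq_commute)
  qed
  \<comment> \<open>\<open>M1\<close> and \<open>M2\<close> bound the size from below and above. F
    is any finite set between F0 and B, so the result applies to F0 and to F0 with one more element
    of B, which shows that there is no further element.\<close>
  have card: "card F = l" if F: "finite F" "F0 \<subseteq> F" "F \<subseteq> B" for F
  proof -
    obtain b where b: "bij_betw b {..<card F} F"
      using F(1) by (metis ex_bij_betw_nat_finite lessThan_atLeast0)
    have "l \<le> card F"
    proof (rule diagonal_factorization_le[OF Q_nonzero])
      fix i k assume "i < l" "k < l"
      have "(\<Sum>j<card F. c i (b j) * b j k) = (\<Sum>x\<in>F. c i x * x k)"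
        using sum.reindex_bij_betw[OF b] by fast
      then show "(\<Sum>j<card F. c i (b j) * b j k) = (if i = k then Q else 0)"
        using M1[OF F(1,2) \<open>i < l\<close>] by simp
    qed
    moreover have "card F \<le> l"
    proof (rule diagonal_factorization_le[OF Q_nonzero])
      fix i k assume ik: "i < card F" "k < card F"
      then have "b i \<in> B" using b F(3) by (auto simp: bij_betw_def)
      moreover have "b i = b k \<longleftrightarrow> i = k" using b ik by (auto simp: bij_betw_def inj_on_def)
      ultimately show "(\<Sum>j<l. b i j * c j (b k)) = (if i = k then Q else 0)"
        using M2 by simp
    qed
    ultimately show ?thesis by simp
  qed
  have "B \<subseteq> F0"
  proof
    fix x assume "x \<in> B"
    then have "card (insert x F0) = l" "card F0 = l" using F0 by (auto intro!: card)
    then show "x \<in> F0" using F0(1) by (metis card_insert_disjoint n_not_Suc_n)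
  qed
  then have BF: "B = F0" using F0 by blast
  obtain \<theta> where \<theta>: "bij_betw \<theta> {..<l} B"
    using F0(1) card[OF F0(1) order_refl F0(2)] unfolding BF
    by (metis ex_bij_betw_nat_finite lessThan_atLeast0)
  show ?thesis
  proof (intro exI[of _ \<theta>] conjI allI impI ballI)
    show "\<theta> i \<in> D" if "i < l" for i using \<theta> B that by (auto simp: bij_betw_def)
    have "fdet l (\<lambda>j i. c j (\<theta> i)) * fdet l \<theta> = fdet l (\<lambda>j k. \<Sum>i<l. c j (\<theta> i) * \<theta> i k)"
      by (simp add: fdet_mult)
    also have "\<dots> = fdet l (\<lambda>j k. if j = k then Q else 0)"
    proof (rule fdet_cong)
      fix j k assume "j < l" "k < l"
      have "(\<Sum>i<l. c j (\<theta> i) * \<theta> i k) = (\<Sum>x\<in>F0. c j x * x k)"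
        using sum.reindex_bij_betw[OF \<theta>] unfolding BF by fast
      then show "(\<Sum>i<l. c j (\<theta> i) * \<theta> i k) = (if j = k then Q else 0)"
        using M1[OF F0(1) order_refl \<open>j < l\<close>] by simp
    qed
    also have "\<dots> = Q ^ l" by (simp add: fdet_diag)
    finally show "fdet l \<theta> dvd Q ^ l" by (metis dvd_triv_right)
    show "\<exists>f. \<forall>k. \<eta> k = (\<Sum>i<l. f i * \<theta> i k)" if \<eta>: "\<eta> \<in> D" for \<eta>
    proof -
      obtain g where g: "rep \<eta> g" using ex_rep[OF \<eta>] by blast
      then have "{b. g b \<noteq> 0} \<subseteq> F0" using BF by (simp add: rep_def)
      then have "\<eta> k = (\<Sum>x\<in>F0. g x * x k)" for k using rep_sum[OF g F0(1)] by blast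
      also have "(\<Sum>x\<in>F0. g x * x k) = (\<Sum>i<l. g (\<theta> i) * \<theta> i k)" for k
        using sum.reindex_bij_betw[OF \<theta>, of "\<lambda>x. g x * x k"] unfolding BF by simp
      finally show ?thesis by (intro exI[of _ "\<lambda>i. g (\<theta> i)"]) simp
    qed
  qed
qed

text \<open>The matrix \<open>E\<close> below has as rows multiples of vectors that are killed by the form at \<open>i\<close>,
  except for row \<open>k\<close>; it is diagonalised by replacing the \<open>k\<close>-th unit column by the coefficient
  vector of that form.\<close>

lemma special_fdet:
  assumes i: "i < n" and P: "P = (\<Prod>i'\<in>{..<n} - {i}. L i')"
  shows "\<exists>\<eta> u c. (\<forall>r<l. \<eta> r \<in> D) \<and> fdet l \<eta> * u = P ^ l * L i * cst c \<and> c \<noteq> 0"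
proof -
  obtain k where k: "k < l" "\<alpha> i k \<noteq> 0" using nonzero[OF i] by blast
  define E where "E r j = (if r = k then if j = k then L i else 0
     else (if j = r then cst (\<alpha> i k) else 0) + (if j = k then - cst (\<alpha> i r) else 0))" for r j
  define M where "M j s = (if s = k then cst (\<alpha> i j) else if j = s then 1 else 0)" for j s
  have PQ: "Q = L i * P" unfolding Q_def P using i by (subst prod.remove[of _ i]) auto
  have L_P: "L i' dvd P" if "i' < n" "i' \<noteq> i" for i' unfolding P using that by (intro dvd_prodI) auto
  have keep_P: "keep l P = P"
  proof -
    interpret comm_ring_hom "keep l" by (rule comm_ring_hom_keep)
    show ?thesis by (simp add: P hom_prod keep_lform)
  qed
  have keep_E: "keep l (E r j) = E r j" for r j
  proof -
    interpret comm_ring_hom "keep l" by (rule comm_ring_hom_keep)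
    show ?thesis by (simp add: E_def keep_lform hom_add hom_uminus)
  qed
  have apply_E: "apply_lform l a (\<lambda>j. P * E r j) = P * (if r = k then cst (a k) * L i
      else cst (a r * \<alpha> i k - a k * \<alpha> i r))" if "r < l" for a r
  proof -
    have "apply_lform l a (\<lambda>j. P * E r j) = (\<Sum>j<l. if r = k then if j = k then P * (cst (a k) * L i) else 0
       else (if j = r then P * cst (a r * \<alpha> i k) else 0) + (if j = k then - (P * cst (a k * \<alpha> i r)) else 0))"
      unfolding apply_lform_def E_def cst_mult by (intro sum.cong) (auto simp: algebra_simps)
    then show ?thesis using that k(1) by (simp add: sum.distrib single_diff algebra_simps)
  qed
  \<comment> \<open>P is a multiple of every form but the i-th, so the factor P takes care of all
    hyperplanes other than i, and the rows of E are tangent to hyperplane i.\<close>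
  define \<eta> where "\<eta> r j = (if j < l then P * E r j else 0)" for r j
  have apply_\<eta>: "apply_lform l a (\<eta> r) = apply_lform l a (\<lambda>j. P * E r j)" for a r
    unfolding apply_lform_def by (intro sum.cong) (auto simp: \<eta>_def)
  have "\<eta> r \<in> D" if r: "r < l" for r
  proof -
    have "L i' dvd apply_lform l (\<alpha> i') (\<eta> r)" if "i' < n" for i'
    proof (cases "i' = i")
      case True
      then show ?thesis unfolding apply_\<eta> apply_E[OF r] by (simp add: mult.commute)
    next
      case False
      then show ?thesis unfolding apply_\<eta> apply_E[OF r] using L_P[OF that] by auto
    qed
    then show ?thesis by (auto simp: logder_def \<eta>_def keep_mult keep_P keep_E)
  qed
  moreover have "fdet l \<eta> * fdet l M = P ^ l * L i * cst (\<alpha> i k ^ l)"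
  proof -
    have "fdet l \<eta> = fdet l (\<lambda>r j. P * E r j)" by (rule fdet_cong) (simp add: \<eta>_def)
    also have "\<dots> = P ^ l * fdet l E" using fdet_factor_rows[of l "\<lambda>_. P" E] by simp
    finally have *: "fdet l \<eta> * fdet l M = P ^ l * (fdet l E * fdet l M)" by simp
    have "fdet l E * fdet l M = fdet l (\<lambda>r s. \<Sum>j<l. E r j * M j s)" by (simp add: fdet_mult)
    also have "\<dots> = fdet l (\<lambda>r s. if r = s then (if r = k then L i else 1) * cst (\<alpha> i k) else 0)"
    proof (rule fdet_cong)
      fix r s assume r: "r < l" and s: "s < l"
      have "(\<Sum>j<l. E r j * M j s) = (\<Sum>j<l. if r = k then if j = k then L i * M k s else 0
         else (if j = r then cst (\<alpha> i k) * M r s else 0) + (if j = k then - (cst (\<alpha> i r) * M k s) else 0))"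
        by (intro sum.cong) (auto simp: E_def algebra_simps)
      also have "\<dots> = (if r = k then L i * M k s else cst (\<alpha> i k) * M r s - cst (\<alpha> i r) * M k s)"
        using r k(1) by (simp add: sum.distrib)
      also have "\<dots> = (if r = s then (if r = k then L i else 1) * cst (\<alpha> i k) else 0)"
        by (auto simp: M_def mult.commute)
      finally show "(\<Sum>j<l. E r j * M j s) = (if r = s then (if r = k then L i else 1) * cst (\<alpha> i k) else 0)" .
    qed
    also have "\<dots> = (\<Prod>r<l. (if r = k then L i else 1)) * cst (\<alpha> i k) ^ l"
      by (simp add: fdet_diag prod.distrib)
    also have "(\<Prod>r<l. (if r = k then L i else 1)) = L i" using k(1) by simp
    also have "cst (\<alpha> i k) ^ l = cst (\<alpha> i k ^ l)"
      by (induction l) (simp_all add: cst_mult)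
    finally show ?thesis unfolding * by (simp add: mult.assoc)
  qed
  ultimately show ?thesis
    using k(2) by (intro exI[of _ \<eta>] exI[of _ "fdet l M"] exI[of _ "\<alpha> i k ^ l"]) simp
qed

text \<open>The determinant of a basis is \<open>Q * f\<close> and divides \<open>Q ^ l\<close>.
  Once no form divides f, it is a unit; its constant term is then nonzero, and the component of
  degree n of the determinant is this scalar times \<open>Q\<close>.\<close>

lemma hpart_fdet_if_free:
  assumes "free_mod l D"
  shows "\<exists>\<theta>. (\<forall>i<l. \<theta> i \<in> D) \<and> hpart n (fdet l \<theta>) \<noteq> 0"
proof -
  obtain \<theta> where "\<forall>i<l. \<theta> i \<in> D" and dvd_Q: "fdet l \<theta> dvd Q ^ l"
    and span: "\<forall>\<eta>\<in>D. \<exists>f. \<forall>k. \<eta> k = (\<Sum>i<l. f i * \<theta> i k)"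
    using basis_det_nonzero[OF assms] by blast
  then have \<theta>: "\<theta> i \<in> D" if "i < l" for i using that by blast
  obtain f where f: "fdet l \<theta> = Q * f" using Q_dvd_fdet[of \<theta>] \<theta> by (auto elim: dvdE)
  have det_dvd: "fdet l \<theta> dvd fdet l \<eta>" if "\<And>r. r < l \<Longrightarrow> \<eta> r \<in> D" for \<eta>
  proof -
    have "\<forall>r. \<exists>g. r < l \<longrightarrow> (\<forall>k. \<eta> r k = (\<Sum>i<l. g i * \<theta> i k))" using span that by blast
    then have "\<exists>g. \<forall>r. r < l \<longrightarrow> (\<forall>k. \<eta> r k = (\<Sum>i<l. g r i * \<theta> i k))" by (rule choice)
    then obtain g where "\<And>r k. r < l \<Longrightarrow> \<eta> r k = (\<Sum>i<l. g r i * \<theta> i k)" by blast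
    then have "fdet l \<eta> = fdet l (\<lambda>r k. \<Sum>i<l. g r i * \<theta> i k)" by (intro fdet_cong) auto
    then show ?thesis by (simp add: fdet_mult)
  qed
  have "\<not> L i dvd f" if i: "i < n" for i
  proof
    assume Lf: "L i dvd f"
    define P where "P = (\<Prod>i'\<in>{..<n} - {i}. L i')"
    have Q: "Q = L i * P" unfolding Q_def P_def using i by (subst prod.remove[of _ i]) auto
    \<comment> \<open>The determinant of these fields divides a scalar times
      \<open>P ^ l * L i\<close>, in which L_i occurs only once. It is also a multiple of
      \<open>Q * f\<close>, and \<open>Q\<close> uses up that single factor, so L_i cannot divide f
      as well.\<close>
    obtain \<eta> u c where \<eta>: "\<forall>r<l. \<eta> r \<in> D" "fdet l \<eta> * u = P ^ l * L i * cst c" "c \<noteq> 0"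
      using special_fdet[OF i P_def] by blast
    have P0: "P \<noteq> 0" "L i \<noteq> 0" using Q Q_nonzero by auto
    have "Q * f dvd fdet l \<eta> * u" using det_dvd[of \<eta>] \<eta>(1) f by simp
    \<comment> \<open>One factor P is split off the power, to cancel \<open>Q\<close> together with
      L_i; l is positive because the form has a nonzero coefficient.\<close>
    moreover obtain l' where l': "l = Suc l'" using nonzero[OF i] by (cases l) auto
    have "P ^ l = P * P ^ l'" by (subst l') simp
    then have "fdet l \<eta> * u = (L i * P) * (cst c * P ^ l')"
      unfolding \<eta>(2) by (simp only: mult_ac)
    ultimately have "(L i * P) * f dvd (L i * P) * (cst c * P ^ l')" by (simp only: Q)
    then have "f dvd cst c * P ^ l'" using P0 by (subst (asm) dvd_mult_cancel_left) auto
    then have "L i dvd P ^ l'" using Lf \<eta>(3) dvd_cst_mult_cancel dvd_trans by blast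
    then have "L i dvd P" using prime_L[OF i] prime_elem_dvd_power by blast
    then obtain i' where "i' < n" "i' \<noteq> i" "L i dvd L i'"
      unfolding P_def using prime_elem_dvd_prodD[OF prime_L[OF i]] by blast
    then show False using distinct i by blast
  qed
  moreover have "f dvd (\<Prod>i<n. L i) ^ l * 1" using dvd_Q f by (metis Q_def dvd_mult_right mult.right_neutral)
  ultimately have "f dvd 1" using prime_L by (intro dvd_cancel_prime_prod_power[of "{..<n}" L f l 1]) auto
  then obtain g where g: "1 = f * g" by auto
  have "lookup f {#} * lookup g {#} = lookup (f * g) {#}" by (simp add: lookup_mult_empty)
  also have "\<dots> = 1" unfolding g[symmetric] by simp
  finally have "lookup f {#} \<noteq> 0" by auto
  then have "hpart n (fdet l \<theta>) \<noteq> 0" using Q_nonzero by (simp add: f hpart_Q_mult)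
  then show ?thesis using \<theta> by blast
qed

text \<open>Splitting a row into its components writes the determinant as a sum, one summand of
  which keeps a nonzero component of degree n. This component, and not merely the determinant, is
  the invariant, because in the end it pins the sum of the degrees to n.\<close>

lemma homogenize_rows:
  assumes "\<And>i. i < l \<Longrightarrow> \<theta> i \<in> D" "hpart n (fdet l \<theta>) \<noteq> 0" "r \<le> l"
  shows "\<exists>d \<theta>. (\<forall>i<l. \<theta> i \<in> D) \<and> hpart n (fdet l \<theta>) \<noteq> 0 \<and> (\<forall>i<r. \<forall>j. hpart (d i) (\<theta> i j) = \<theta> i j)"
  using assms(3)
proof (induction r)
  case 0
  then show ?case using assms(1,2) by auto
next
  case (Suc r)
  then obtain d \<theta> where \<theta>: "\<forall>i<l. \<theta> i \<in> D" "hpart n (fdet l \<theta>) \<noteq> 0"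
      "\<forall>i<r. \<forall>j. hpart (d i) (\<theta> i j) = \<theta> i j"
    using Suc_leD by blast
  have r: "r < l" using Suc.prems by simp
  define C where "C = fadj l \<theta>"
  note C = fdet_update_row[of _ l \<theta>, folded C_def]
  have "\<forall>j. \<exists>N0. \<forall>N\<ge>N0. \<theta> r j = (\<Sum>e<N. hpart e (\<theta> r j))"
    using poly_eq_sum_hpart by blast
  then have "\<exists>N0. \<forall>j. \<forall>N\<ge>N0 j. \<theta> r j = (\<Sum>e<N. hpart e (\<theta> r j))" by (rule choice)
  then obtain N0 where N0: "\<And>j N. N0 j \<le> N \<Longrightarrow> \<theta> r j = (\<Sum>e<N. hpart e (\<theta> r j))" by blast
  \<comment> \<open>A common bound, so that all entries of the row split over the same range of
    degrees.\<close>
  define N where "N = (\<Sum>j<l. N0 j)"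
  have N: "\<theta> r j = (\<Sum>e<N. hpart e (\<theta> r j))" if "j < l" for j
    using that unfolding N_def by (intro N0 member_le_sum) auto
  have "fdet l \<theta> = (\<Sum>j<l. \<theta> r j * C j r)" using C[OF r, of "\<theta> r"] by simp
  also have "\<dots> = (\<Sum>j<l. (\<Sum>e<N. hpart e (\<theta> r j)) * C j r)" using N by (intro sum.cong) auto
  also have "\<dots> = (\<Sum>e<N. fdet l (\<theta>(r := \<lambda>j. hpart e (\<theta> r j))))"
    unfolding C[OF r] sum_distrib_right by (rule sum.swap)
  finally have "(\<Sum>e<N. hpart n (fdet l (\<theta>(r := \<lambda>j. hpart e (\<theta> r j))))) \<noteq> 0"
    using \<theta>(2) by (simp add: hpart_sum)
  then obtain e where e: "hpart n (fdet l (\<theta>(r := \<lambda>j. hpart e (\<theta> r j)))) \<noteq> 0"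
    by (metis (no_types, lifting) sum.neutral)
  show ?case
  proof (intro exI conjI)
    show "\<forall>i<l. (\<theta>(r := \<lambda>j. hpart e (\<theta> r j))) i \<in> D" using \<theta>(1) logder_hpart r by simp
    show "\<forall>i<Suc r. \<forall>j. hpart ((d(r := e)) i) ((\<theta>(r := \<lambda>j. hpart e (\<theta> r j))) i j)
        = (\<theta>(r := \<lambda>j. hpart e (\<theta> r j))) i j"
      using \<theta>(3) by (auto simp: less_Suc_eq)
  qed (rule e)
qed

text \<open>The degrees replace the usual condition that the determinant be a scalar times
  \<open>Q\<close>: it is always a multiple of \<open>Q\<close>, and a nonzero multiple that is
  homogeneous of the same degree n differs from \<open>Q\<close> by a scalar.\<close>

theorem saito_criterion:
  "free_mod l D \<longleftrightarrow> (\<exists>d \<theta>. (\<forall>i<l. \<theta> i \<in> D \<and> (\<forall>j. hpart (d i) (\<theta> i j) = \<theta> i j)) \<and>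
     (\<Sum>i<l. d i) = n \<and> fdet l \<theta> \<noteq> 0)"
proof
  assume "free_mod l D"
  then obtain \<theta>0 where "\<forall>i<l. \<theta>0 i \<in> D" "hpart n (fdet l \<theta>0) \<noteq> 0"
    using hpart_fdet_if_free by blast
  then obtain d \<theta> where \<theta>: "\<forall>i<l. \<theta> i \<in> D" "hpart n (fdet l \<theta>) \<noteq> 0"
      "\<forall>i<l. \<forall>j. hpart (d i) (\<theta> i j) = \<theta> i j"
    using homogenize_rows[of \<theta>0 l] by auto
  have "hpart (\<Sum>i<l. d i) (fdet l \<theta>) = fdet l \<theta>" using \<theta>(3) by (intro fdet_homog) auto
  \<comment> \<open>The determinant is homogeneous of degree the sum of the d i and has a nonzero
    component of degree n, so the two degrees agree.\<close>
  then have "(\<Sum>i<l. d i) = n"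
  proof -
    obtain m where "lookup (hpart n (fdet l \<theta>)) m \<noteq> 0"
      using \<theta>(2) by (auto simp: poly_mapping_eq_iff fun_eq_iff)
    then have "size m = n" "lookup (fdet l \<theta>) m \<noteq> 0" by (auto simp: lookup_hpart split: if_splits)
    then show ?thesis using \<open>hpart (\<Sum>i<l. d i) (fdet l \<theta>) = fdet l \<theta>\<close>
      unfolding hpart_id_iff by auto
  qed
  then show "\<exists>d \<theta>. (\<forall>i<l. \<theta> i \<in> D \<and> (\<forall>j. hpart (d i) (\<theta> i j) = \<theta> i j)) \<and>
     (\<Sum>i<l. d i) = n \<and> fdet l \<theta> \<noteq> 0"
    using \<theta> by (intro exI[of _ d] exI[of _ \<theta>]) auto
next
  assume "\<exists>d \<theta>. (\<forall>i<l. \<theta> i \<in> D \<and> (\<forall>j. hpart (d i) (\<theta> i j) = \<theta> i j)) \<and>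
     (\<Sum>i<l. d i) = n \<and> fdet l \<theta> \<noteq> 0"
  then obtain d \<theta> where \<theta>: "\<And>i. i < l \<Longrightarrow> \<theta> i \<in> D"
      "\<And>i j. i < l \<Longrightarrow> hpart (d i) (\<theta> i j) = \<theta> i j" "(\<Sum>i<l. d i) = n" "fdet l \<theta> \<noteq> 0"
    by auto
  obtain f where f: "fdet l \<theta> = Q * f" using Q_dvd_fdet[of \<theta>] \<theta>(1) by (auto elim: dvdE)
  have "hpart n (fdet l \<theta>) = fdet l \<theta>" using fdet_homog[of l d \<theta>] \<theta>(2,3) by simp
  then have "fdet l \<theta> = Q * cst (lookup f {#})" unfolding f hpart_Q_mult by (rule sym)
  then have "fdet l \<theta> = cst (lookup f {#}) * Q" by (simp only: mult.commute)
  moreover from this have "lookup f {#} \<noteq> 0" using \<theta>(4) by auto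
  ultimately show "free_mod l D" using free_if_fdet[of \<theta>] \<theta>(1) by blast
qed

end

section \<open>Transfer to ring records\<close>

text \<open>The conjecture is stated over ring records, the algebra above over type classes;
  \<open>emb\<close> identifies the type with the carrier of the record. The instances are the
  rationals and the integers modulo a prime.\<close>

locale field_record =
  fixes R :: "('b, 'm) ring_scheme" and emb :: "'a::field \<Rightarrow> 'b"
  assumes cring: "cring R"
    and emb_bij: "bij_betw emb UNIV (carrier R)"
    and emb_0: "emb 0 = \<zero>\<^bsub>R\<^esub>"
    and emb_add: "emb (x + y) = emb x \<oplus>\<^bsub>R\<^esub> emb y"
    and emb_mult: "emb (x * y) = emb x \<otimes>\<^bsub>R\<^esub> emb y"
begin

interpretation R: cring R by (rule cring)

lemma emb_carrier: "emb x \<in> carrier R"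
  using emb_bij by (auto simp: bij_betw_def)

lemma emb_inject: "emb x = emb y \<longleftrightarrow> x = y"
  using emb_bij by (auto simp: bij_betw_def inj_on_def)

lemma emb_eq_0_iff: "emb x = \<zero>\<^bsub>R\<^esub> \<longleftrightarrow> x = 0"
  using emb_inject emb_0 by metis

lemma emb_onto: "y \<in> carrier R \<Longrightarrow> \<exists>x. y = emb x"
  using emb_bij by (auto simp: bij_betw_def)

text \<open>For infinite A both sums are 0 by convention.\<close>

lemma emb_sum: "finsum R (\<lambda>x. emb (f x)) A = emb (sum f A)"
  by (induction A rule: infinite_finite_induct)
    (simp_all add: emb_0 emb_add emb_carrier R.finsum_infinite)

definition emb_poly :: "'a mpol \<Rightarrow> 'b mpoly" where
  "emb_poly P = (\<lambda>m. emb (lookup P m))"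

lemma emb_poly_inject: "emb_poly P = emb_poly P' \<longleftrightarrow> P = P'"
  by (auto simp: emb_poly_def fun_eq_iff emb_inject poly_mapping_eq_iff)

lemma emb_poly_0: "emb_poly 0 = mpoly_zero R"
  by (simp add: emb_poly_def mpoly_zero_def emb_0)

lemma emb_poly_eq_0_iff: "emb_poly P = mpoly_zero R \<longleftrightarrow> P = 0"
  using emb_poly_0 emb_poly_inject by metis

lemma emb_poly_mem_iff: "emb_poly P \<in> mpolys R l \<longleftrightarrow> keep l P = P"
  by (simp add: mpolys_def emb_poly_def emb_carrier emb_eq_0_iff keep_id_iff)

lemma emb_poly_onto:
  assumes "p \<in> mpolys R l"
  shows "\<exists>P. keep l P = P \<and> p = emb_poly P"
proof -
  have "\<forall>m. \<exists>x. p m = emb x" using assms emb_onto by (auto simp: mpolys_def)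
  then have "\<exists>q. \<forall>m. p m = emb (q m)" by (rule choice)
  then obtain q where q: "\<And>m. p m = emb (q m)" by blast
  then have "finite {m. q m \<noteq> 0}" using assms by (simp add: mpolys_def emb_eq_0_iff)
  then have "p = emb_poly (Abs_poly_mapping q)" by (simp add: emb_poly_def q fun_eq_iff)
  then show ?thesis using assms emb_poly_mem_iff by blast
qed

lemma emb_poly_mult: "mpoly_mult R (emb_poly P) (emb_poly P') = emb_poly (P * P')"
  unfolding mpoly_mult_def emb_poly_def lookup_mult_sum
  by (simp add: emb_sum[symmetric] emb_mult case_prod_unfold)

lemma emb_poly_lform: "lin_form R l (\<lambda>j. emb (a j)) = emb_poly (lform l a)"
  unfolding lin_form_def emb_poly_def lookup_lform emb_sum[symmetric]
  by (simp add: if_distrib emb_0 cong: if_cong)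

definition emb_vec :: "(nat \<Rightarrow> 'a mpol) \<Rightarrow> nat \<Rightarrow> 'b mpoly" where
  "emb_vec \<theta> = (\<lambda>j. emb_poly (\<theta> j))"

lemma emb_vec_inject: "emb_vec \<theta> = emb_vec \<theta>' \<longleftrightarrow> \<theta> = \<theta>'"
  by (simp add: emb_vec_def fun_eq_iff[where 'a = nat] emb_poly_inject)

lemma emb_vec_apply: "apply_der R l (emb_vec \<theta>) (\<lambda>j. emb (a j)) = emb_poly (apply_lform l a \<theta>)"
  by (simp add: apply_der_def emb_vec_def emb_poly_def apply_lform_def lookup_sum lookup_cst_mult
      emb_sum[symmetric] emb_mult)

lemma log_derivations_emb:
  "log_derivations R l n (\<lambda>i j. emb (\<alpha> i j)) = emb_vec ` logder l n \<alpha>"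
proof
  show "emb_vec ` logder l n \<alpha> \<subseteq> log_derivations R l n (\<lambda>i j. emb (\<alpha> i j))"
  proof
    fix \<delta> assume "\<delta> \<in> emb_vec ` logder l n \<alpha>"
    then obtain \<theta> where \<theta>: "\<theta> \<in> logder l n \<alpha>" and \<delta>: "\<delta> = emb_vec \<theta>" by blast
    have "\<exists>g\<in>mpolys R l. apply_der R l \<delta> (\<lambda>j. emb (\<alpha> i j)) =
        mpoly_mult R (lin_form R l (\<lambda>j. emb (\<alpha> i j))) g" if i: "i < n" for i
    proof -
      obtain g where g: "apply_lform l (\<alpha> i) \<theta> = lform l (\<alpha> i) * g"
        using \<theta> i unfolding logder_def dvd_def by blast
      \<comment> \<open>The quotient g lives in the ring of all variables. The left side and the
        form are fixed by \<open>keep l\<close>, so g may be replaced by \<open>keep l g\<close>,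
        whose embedding lies in \<open>mpolys R l\<close>.\<close>
      have "apply_lform l (\<alpha> i) \<theta> = keep l (apply_lform l (\<alpha> i) \<theta>)"
        using \<theta> by (simp add: apply_lform_def keep_sum keep_mult logder_def)
      also have "\<dots> = lform l (\<alpha> i) * keep l g" by (simp add: g keep_mult keep_lform)
      finally have eq: "apply_lform l (\<alpha> i) \<theta> = lform l (\<alpha> i) * keep l g" .
      show ?thesis
        by (rule bexI[of _ "emb_poly (keep l g)"])
          (simp_all only: \<delta> emb_vec_apply emb_poly_lform emb_poly_mult eq emb_poly_mem_iff keep_keep)
    qed
    moreover have "\<delta> \<in> derivations R l"
      using \<theta> by (auto simp: \<delta> derivations_def emb_vec_def emb_poly_mem_iff emb_poly_0 logder_def)
    ultimately show "\<delta> \<in> log_derivations R l n (\<lambda>i j. emb (\<alpha> i j))"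
      by (simp add: log_derivations_def)
  qed
  show "log_derivations R l n (\<lambda>i j. emb (\<alpha> i j)) \<subseteq> emb_vec ` logder l n \<alpha>"
  proof
    fix \<delta> assume \<delta>: "\<delta> \<in> log_derivations R l n (\<lambda>i j. emb (\<alpha> i j))"
    have "\<exists>P. keep l P = P \<and> (j \<ge> l \<longrightarrow> P = 0) \<and> \<delta> j = emb_poly P" for j
    proof (cases "j < l")
      case True
      then show ?thesis using \<delta> emb_poly_onto[of "\<delta> j" l]
        by (auto simp: log_derivations_def derivations_def)
    next
      case False
      then show ?thesis using \<delta>
        by (intro exI[of _ 0]) (auto simp: log_derivations_def derivations_def emb_poly_0)
    qed
    then have "\<exists>\<theta>. \<forall>j. keep l (\<theta> j) = \<theta> j \<and> (j \<ge> l \<longrightarrow> \<theta> j = 0) \<and> \<delta> j = emb_poly (\<theta> j)"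
      by (intro choice) blast
    then obtain \<theta> where \<theta>0: "\<And>j. keep l (\<theta> j) = \<theta> j \<and> (j \<ge> l \<longrightarrow> \<theta> j = 0) \<and> \<delta> j = emb_poly (\<theta> j)"
      by blast
    then have \<theta>: "keep l (\<theta> j) = \<theta> j" "j \<ge> l \<Longrightarrow> \<theta> j = 0" "\<delta> = emb_vec \<theta>" for j
      by (auto simp: emb_vec_def)
    have "lform l (\<alpha> i) dvd apply_lform l (\<alpha> i) \<theta>" if i: "i < n" for i
    proof -
      obtain g where g: "g \<in> mpolys R l" "apply_der R l \<delta> (\<lambda>j. emb (\<alpha> i j)) =
          mpoly_mult R (lin_form R l (\<lambda>j. emb (\<alpha> i j))) g"
        using \<delta> i unfolding log_derivations_def by blast
      obtain P where P: "g = emb_poly P" using emb_poly_onto[OF g(1)] by blast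
      show ?thesis using g(2)
        unfolding P \<theta>(3) emb_vec_apply emb_poly_lform emb_poly_mult emb_poly_inject by simp
    qed
    then show "\<delta> \<in> emb_vec ` logder l n \<alpha>" using \<theta> by (auto simp: logder_def)
  qed
qed

lemma free_submodule_emb: "free_submodule R l (emb_vec ` D) \<longleftrightarrow> free_mod l D"
proof -
  define P where "P B \<delta> c \<longleftrightarrow> (\<forall>b. keep l (c b) = c b) \<and> finite {b. c b \<noteq> 0} \<and>
    {b. c b \<noteq> 0} \<subseteq> B \<and> \<delta> = (\<lambda>j. \<Sum>b | c b \<noteq> 0. c b * b j)"
    for B \<delta> and c :: "(nat \<Rightarrow> 'a mpol) \<Rightarrow> 'a mpol"
  define P' where "P' B \<delta> c \<longleftrightarrow> (\<forall>b. c b \<in> mpolys R l) \<and> finite {b. c b \<noteq> mpoly_zero R} \<and>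
    {b. c b \<noteq> mpoly_zero R} \<subseteq> B \<and>
    \<delta> = (\<lambda>j. mpoly_sum R (\<lambda>b. mpoly_mult R (c b) (b j)) {b. c b \<noteq> mpoly_zero R})"
    for B \<delta> and c :: "(nat \<Rightarrow> 'b mpoly) \<Rightarrow> 'b mpoly"
  \<comment> \<open>Coefficient functions over the record are also defined on vectors outside the
    range of \<open>emb_vec\<close>; there C is zero, as the support condition demands.\<close>
  define C where "C c b' = (if b' \<in> range emb_vec then emb_poly (c (the_inv emb_vec b')) else mpoly_zero R)"
    for c :: "(nat \<Rightarrow> 'a mpol) \<Rightarrow> 'a mpol" and b'
  have inj: "inj emb_vec" by (simp add: inj_def emb_vec_inject)
  have C_emb: "C c (emb_vec b) = emb_poly (c b)" for c b by (simp add: C_def the_inv_f_f[OF inj])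
  have C_inj: "c = c'" if "C c = C c'" for c c'
    using fun_cong[OF that] C_emb emb_poly_inject by (metis ext)
  have supp: "{b'. C c b' \<noteq> mpoly_zero R} = emb_vec ` {b. c b \<noteq> 0}" for c
  proof -
    have "C c b' \<noteq> mpoly_zero R \<longleftrightarrow> (\<exists>b. b' = emb_vec b \<and> c b \<noteq> 0)" for b'
      by (auto simp: C_def emb_poly_eq_0_iff the_inv_f_f[OF inj] emb_vec_inject)
    then show ?thesis by auto
  qed
  have sum: "mpoly_sum R (\<lambda>b'. mpoly_mult R (C c b') (b' j)) (emb_vec ` A)
      = emb_poly (\<Sum>b\<in>A. c b * b j)" for c j A
  proof
    fix m
    have "mpoly_mult R (C c b') (b' j) m = emb (lookup (c (the_inv emb_vec b') * the_inv emb_vec b' j) m)"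
      if b': "b' \<in> emb_vec ` A" for b'
    proof -
      obtain b where b: "b' = emb_vec b" using b' by blast
      have "mpoly_mult R (C c b') (b' j) = emb_poly (c b * b j)"
        unfolding b C_emb by (simp add: emb_vec_def emb_poly_mult)
      then show ?thesis by (simp add: b the_inv_f_f[OF inj] emb_poly_def)
    qed
    then have "mpoly_sum R (\<lambda>b'. mpoly_mult R (C c b') (b' j)) (emb_vec ` A) m
        = finsum R (\<lambda>b'. emb (lookup (c (the_inv emb_vec b') * the_inv emb_vec b' j) m)) (emb_vec ` A)"
      unfolding mpoly_sum_def by (intro R.finsum_cong') (auto simp: emb_carrier)
    also have "\<dots> = emb (\<Sum>b\<in>A. lookup (c b * b j) m)"
      unfolding emb_sum by (subst sum.reindex) (auto simp: the_inv_f_f[OF inj] intro: inj_on_subset[OF inj])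
    finally show "mpoly_sum R (\<lambda>b'. mpoly_mult R (C c b') (b' j)) (emb_vec ` A) m
        = emb_poly (\<Sum>b\<in>A. c b * b j) m"
      by (simp add: emb_poly_def lookup_sum)
  qed
  have P_iff: "P' (emb_vec ` B) (emb_vec \<delta>) (C c) \<longleftrightarrow> P B \<delta> c" for B \<delta> c
  proof -
    have "(\<forall>b'. C c b' \<in> mpolys R l) \<longleftrightarrow> (\<forall>b. keep l (c b) = c b)"
    proof
      assume "\<forall>b'. C c b' \<in> mpolys R l"
      then show "\<forall>b. keep l (c b) = c b" using C_emb[of c] emb_poly_mem_iff by metis
    next
      assume "\<forall>b. keep l (c b) = c b"
      then show "\<forall>b'. C c b' \<in> mpolys R l"
        unfolding C_def by (auto simp: emb_poly_mem_iff emb_poly_0[symmetric])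
    qed
    moreover have "finite (emb_vec ` {b. c b \<noteq> 0}) \<longleftrightarrow> finite {b. c b \<noteq> 0}"
      by (rule finite_image_iff) (rule inj_on_subset[OF inj], simp)
    moreover have "emb_vec ` {b. c b \<noteq> 0} \<subseteq> emb_vec ` B \<longleftrightarrow> {b. c b \<noteq> 0} \<subseteq> B"
      by (rule inj_image_subset_iff[OF inj])
    moreover have "emb_vec \<delta> = (\<lambda>j. emb_poly (\<Sum>b | c b \<noteq> 0. c b * b j)) \<longleftrightarrow>
        \<delta> = (\<lambda>j. \<Sum>b | c b \<noteq> 0. c b * b j)"
      by (simp add: emb_vec_def fun_eq_iff[where 'a = nat] emb_poly_inject)
    ultimately show ?thesis unfolding P_def P'_def supp sum by simp
  qed
  have C_onto: "\<exists>c. c' = C c" if c': "P' (emb_vec ` B) \<delta> c'" for B \<delta> c'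
  proof -
    have "\<forall>b. \<exists>Q. c' (emb_vec b) = emb_poly Q"
      using c' emb_poly_onto unfolding P'_def by blast
    then have "\<exists>c. \<forall>b. c' (emb_vec b) = emb_poly (c b)" by (rule choice)
    then obtain c where c: "\<And>b. c' (emb_vec b) = emb_poly (c b)" by blast
    have "c' b' = C c b'" for b'
    proof (cases "b' \<in> range emb_vec")
      case True
      then show ?thesis using c C_emb by auto
    next
      case False
      then have "c' b' = mpoly_zero R" using c' unfolding P'_def by blast
      then show ?thesis using False by (simp add: C_def)
    qed
    then show ?thesis by blast
  qed
  \<comment> \<open>C is injective and reaches every admissible coefficient function over the
    record, so unique existence transfers in both directions.\<close>
  have ex1: "(\<exists>!c. P' (emb_vec ` B) (emb_vec \<delta>) c) \<longleftrightarrow> (\<exists>!c. P B \<delta> c)" for B \<delta>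
  proof
    assume "\<exists>!c. P' (emb_vec ` B) (emb_vec \<delta>) c"
    then show "\<exists>!c. P B \<delta> c" using P_iff C_inj C_onto by metis
  next
    assume "\<exists>!c. P B \<delta> c"
    then obtain c where "P B \<delta> c" "\<And>c'. P B \<delta> c' \<Longrightarrow> c' = c" by blast
    then show "\<exists>!c. P' (emb_vec ` B) (emb_vec \<delta>) c"
      using P_iff C_onto by (intro ex1I[of _ "C c"]) blast+
  qed
  have ex_image: "(\<exists>B'\<subseteq>emb_vec ` D. \<Phi> B') \<longleftrightarrow> (\<exists>B\<subseteq>D. \<Phi> (emb_vec ` B))" for \<Phi>
    by (auto simp: subset_image_iff)
  have "free_submodule R l (emb_vec ` D) \<longleftrightarrow>
      (\<exists>B'\<subseteq>emb_vec ` D. \<forall>\<delta>'\<in>emb_vec ` D. \<exists>!c. P' B' \<delta>' c)"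
    unfolding free_submodule_def P'_def by blast
  also have "\<dots> \<longleftrightarrow> (\<exists>B\<subseteq>D. \<forall>\<delta>'\<in>emb_vec ` D. \<exists>!c. P' (emb_vec ` B) \<delta>' c)"
    by (rule ex_image)
  also have "\<dots> \<longleftrightarrow> (\<exists>B\<subseteq>D. \<forall>\<delta>\<in>D. \<exists>!c. P B \<delta> c)" by (simp add: ex1)
  also have "\<dots> \<longleftrightarrow> free_mod l D" unfolding free_mod_def P_def by blast
  finally show ?thesis .
qed

section \<open>Hyperplanes over ring records\<close>

lemma lin_eval_emb: "lin_eval R l (\<lambda>j. emb (a j)) (\<lambda>j. emb (x j)) = emb (\<Sum>j<l. a j * x j)"
  unfolding lin_eval_def by (simp add: emb_sum[symmetric] emb_mult)

lemma kspace_emb: "x \<in> kspace R l \<longleftrightarrow> (\<exists>y. x = (\<lambda>j. emb (y j)) \<and> (\<forall>j\<ge>l. y j = 0))"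
proof
  assume x: "x \<in> kspace R l"
  have "\<forall>j. \<exists>y. x j = emb y"
  proof
    fix j show "\<exists>y. x j = emb y"
    proof (cases "j < l")
      case True
      then show ?thesis using x emb_onto by (simp add: kspace_def)
    next
      case False
      then show ?thesis using x emb_0 by (metis (mono_tags, lifting) kspace_def mem_Collect_eq not_less)
    qed
  qed
  then have "\<exists>y. \<forall>j. x j = emb (y j)" by (rule choice)
  then obtain y where y: "\<And>j. x j = emb (y j)" by blast
  moreover have "\<forall>j\<ge>l. y j = 0" using x y emb_eq_0_iff by (auto simp: kspace_def)
  ultimately show "\<exists>y. x = (\<lambda>j. emb (y j)) \<and> (\<forall>j\<ge>l. y j = 0)" by blast
next
  assume "\<exists>y. x = (\<lambda>j. emb (y j)) \<and> (\<forall>j\<ge>l. y j = 0)"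
  then show "x \<in> kspace R l" by (auto simp: kspace_def emb_carrier emb_0)
qed

lemma hyperplane_emb: "hyperplane R l (\<lambda>j. emb (a j)) =
    {\<lambda>j. emb (y j) | y. (\<forall>j\<ge>l. y j = 0) \<and> (\<Sum>j<l. a j * y j) = 0}"
proof -
  have "x \<in> hyperplane R l (\<lambda>j. emb (a j)) \<longleftrightarrow>
      (\<exists>y. x = (\<lambda>j. emb (y j)) \<and> (\<forall>j\<ge>l. y j = 0) \<and> (\<Sum>j<l. a j * y j) = 0)" for x
  proof
    assume "x \<in> hyperplane R l (\<lambda>j. emb (a j))"
    then obtain y where "x = (\<lambda>j. emb (y j))" "\<forall>j\<ge>l. y j = 0"
        "lin_eval R l (\<lambda>j. emb (a j)) x = \<zero>\<^bsub>R\<^esub>"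
      unfolding hyperplane_def kspace_emb by blast
    then show "\<exists>y. x = (\<lambda>j. emb (y j)) \<and> (\<forall>j\<ge>l. y j = 0) \<and> (\<Sum>j<l. a j * y j) = 0"
      by (intro exI[of _ y]) (simp add: lin_eval_emb emb_eq_0_iff)
  next
    assume "\<exists>y. x = (\<lambda>j. emb (y j)) \<and> (\<forall>j\<ge>l. y j = 0) \<and> (\<Sum>j<l. a j * y j) = 0"
    then show "x \<in> hyperplane R l (\<lambda>j. emb (a j))"
      unfolding hyperplane_def mem_Collect_eq kspace_emb by (auto simp: lin_eval_emb emb_0)
  qed
  then show ?thesis by blast
qed

lemma arrangement_if_central:
  assumes "central_arrangement R l n (\<lambda>i j. emb (\<alpha> i j))"
  shows "arrangement l n \<alpha>"
proof
  show nz: "\<exists>k<l. \<alpha> i k \<noteq> 0" if "i < n" for i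
  proof (rule ccontr)
    assume *: "\<not> (\<exists>k<l. \<alpha> i k \<noteq> 0)"
    have "(\<lambda>j. emb (\<alpha> i j)) \<in> kspace R l" "(\<lambda>j. emb (\<alpha> i j)) \<noteq> (\<lambda>_. \<zero>\<^bsub>R\<^esub>)"
      using assms that by (auto simp: central_arrangement_def)
    moreover from this(1) have "\<alpha> i j = 0" for j
      using * by (cases "j < l") (auto simp: kspace_def emb_eq_0_iff)
    ultimately show False by (simp add: emb_0)
  qed
  show "\<not> lform l (\<alpha> i) dvd lform l (\<alpha> j)" if ij: "i < n" "j < n" "i \<noteq> j" for i j
  proof
    assume "lform l (\<alpha> i) dvd lform l (\<alpha> j)"
    then obtain c where c: "\<And>k. k < l \<Longrightarrow> \<alpha> j k = c * \<alpha> i k"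
      using lform_dvd_lformD by blast
    then have "c \<noteq> 0" using nz[OF ij(2)] by auto
    have "(\<Sum>k<l. \<alpha> j k * y k) = c * (\<Sum>k<l. \<alpha> i k * y k)" for y
      using c by (simp add: sum_distrib_left mult.assoc)
    then have "hyperplane R l (\<lambda>k. emb (\<alpha> i k)) = hyperplane R l (\<lambda>k. emb (\<alpha> j k))"
      unfolding hyperplane_emb using \<open>c \<noteq> 0\<close> by simp
    then show False using assms ij unfolding central_arrangement_def by blast
  qed
qed

theorem free_arrangement_iff:
  assumes "central_arrangement R l n (\<lambda>i j. emb (\<alpha> i j))"
  shows "free_arrangement R l n (\<lambda>i j. emb (\<alpha> i j)) \<longleftrightarrow>
    (\<exists>d \<theta>. (\<forall>i<l. \<theta> i \<in> logder l n \<alpha> \<and> (\<forall>j. hpart (d i) (\<theta> i j) = \<theta> i j)) \<and>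
     (\<Sum>i<l. d i) = n \<and> fdet l \<theta> \<noteq> 0)"
proof -
  interpret arrangement l n \<alpha> by (rule arrangement_if_central[OF assms])
  show ?thesis
    unfolding free_arrangement_def log_derivations_emb free_submodule_emb by (rule saito_criterion)
qed

end

section \<open>Lifting solutions of integer linear systems\<close>

text \<open>Gaussian elimination without division.\<close>

lemma lift_linear_system:
  fixes F :: "'i \<Rightarrow> 'x \<Rightarrow> int"
  assumes "finite I" "finite X"
  shows "\<exists>N\<noteq>0. \<forall>m v. (\<forall>i\<in>I. m dvd (\<Sum>x\<in>X. F i x * v x)) \<longrightarrow>
    (\<exists>w. (\<forall>i\<in>I. (\<Sum>x\<in>X. F i x * w x) = 0) \<and> (\<forall>x\<in>X. m dvd w x - N * v x))"
  using assms(1)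
proof (induction I arbitrary: F rule: finite_induct)
  case empty
  have "\<exists>w. \<forall>x\<in>X. m dvd w x - 1 * v x" for m :: int and v :: "'x \<Rightarrow> int"
    by (rule exI[of _ v]) simp
  then show ?case by (intro exI[of _ 1]) simp
next
  case (insert k I)
  show ?case
  proof (cases "\<forall>x\<in>X. F k x = 0")
    case True
    then have "(\<Sum>x\<in>X. F k x * w x) = 0" for w by simp
    then show ?thesis using insert.IH[of F] by simp
  next
    case False
    then obtain x0 where x0: "x0 \<in> X" "F k x0 \<noteq> 0" by blast
    \<comment> \<open>The pivot. N becomes the product of all pivots, so it depends on the system
      but not on the modulus or on v.\<close>
    define a where "a = F k x0"
    define F' where "F' i x = a * F i x - F i x0 * F k x" for i x
    have F'_sum: "(\<Sum>x\<in>X. F' i x * v x) = a * (\<Sum>x\<in>X. F i x * v x) - F i x0 * (\<Sum>x\<in>X. F k x * v x)"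
      for i v by (simp add: F'_def left_diff_distrib sum_subtractf sum_distrib_left mult.assoc)
    obtain N where N: "N \<noteq> 0" and lift: "\<And>m v. \<forall>i\<in>I. m dvd (\<Sum>x\<in>X. F' i x * v x) \<Longrightarrow>
        \<exists>w. (\<forall>i\<in>I. (\<Sum>x\<in>X. F' i x * w x) = 0) \<and> (\<forall>x\<in>X. m dvd w x - N * v x)"
      using insert.IH[of F'] by blast
    have "\<exists>w. (\<forall>i\<in>insert k I. (\<Sum>x\<in>X. F i x * w x) = 0) \<and> (\<forall>x\<in>X. m dvd w x - (a * N) * v x)"
      if v: "\<forall>i\<in>insert k I. m dvd (\<Sum>x\<in>X. F i x * v x)" for m v
    proof -
      have "\<forall>i\<in>I. m dvd (\<Sum>x\<in>X. F' i x * v x)" using v by (simp add: F'_sum)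
      then obtain w' where w': "\<And>i. i \<in> I \<Longrightarrow> (\<Sum>x\<in>X. F' i x * w' x) = 0"
          "\<And>x. x \<in> X \<Longrightarrow> m dvd w' x - N * v x"
        using lift by blast
      \<comment> \<open>Scaling the other coordinates by the pivot lets equation k be solved for the
        coordinate x0 without a division.\<close>
      define w where "w x = (if x = x0 then - (\<Sum>y\<in>X - {x0}. F k y * w' y) else a * w' x)" for x
      have split: "(\<Sum>x\<in>X. f x) = f x0 + (\<Sum>y\<in>X - {x0}. f y)" for f :: "'x \<Rightarrow> int"
        using sum.remove[OF assms(2) x0(1)] .
      have w_k: "(\<Sum>x\<in>X. F k x * w x) = 0"
      proof -
        have "(\<Sum>y\<in>X - {x0}. F k y * w y) = a * (\<Sum>y\<in>X - {x0}. F k y * w' y)"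
          unfolding sum_distrib_left by (intro sum.cong) (auto simp: w_def)
        then show ?thesis by (simp add: split w_def[of x0] a_def)
      qed
      have w_i: "(\<Sum>x\<in>X. F i x * w x) = 0" if "i \<in> I" for i
      proof -
        have F'_x0: "F' i x0 = 0" by (simp add: F'_def a_def)
        have "(\<Sum>x\<in>X. F' i x * w x) = (\<Sum>y\<in>X - {x0}. a * (F' i y * w' y))"
          unfolding split F'_x0 by (simp, intro sum.cong) (auto simp: w_def)
        also have "\<dots> = a * (\<Sum>x\<in>X. F' i x * w' x)"
          by (simp add: split F'_x0 sum_distrib_left)
        also have "\<dots> = 0" using w'(1)[OF that] by simp
        finally have "a * (\<Sum>x\<in>X. F i x * w x) = 0" by (simp add: F'_sum w_k)
        then show ?thesis using x0(2) by (simp add: a_def)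
      qed
      have "m dvd w x - (a * N) * v x" if x: "x \<in> X" for x
      proof (cases "x = x0")
        case True
        \<comment> \<open>The coordinate x0 was computed from the others; its congruence uses that v
          itself solves equation k modulo m.\<close>
        have eq: "w x0 - (a * N) * v x0
            = - (\<Sum>y\<in>X - {x0}. F k y * (w' y - N * v y)) - N * (\<Sum>x\<in>X. F k x * v x)"
          by (simp add: split w_def a_def right_diff_distrib sum_subtractf sum_distrib_left algebra_simps)
        have "m dvd (\<Sum>y\<in>X - {x0}. F k y * (w' y - N * v y))"
          using w'(2) by (intro dvd_sum) auto
        moreover have "m dvd N * (\<Sum>x\<in>X. F k x * v x)" using v by auto
        ultimately show ?thesis unfolding True eq by (intro dvd_diff) simp_all
      next
        case False
        then have "w x - (a * N) * v x = a * (w' x - N * v x)" by (simp add: w_def algebra_simps)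
        then show ?thesis using w'(2)[OF x] by simp
      qed
      then show ?thesis using w_k w_i by blast
    qed
    moreover have "a * N \<noteq> 0" using N x0(2) by (simp add: a_def)
    ultimately show ?thesis by blast
  qed
qed

section \<open>Saito's criterion with integer polynomials\<close>

lemma dvd_prod_diff:
  fixes a b :: "'i \<Rightarrow> 'a::comm_ring_1"
  assumes "\<And>i. i \<in> A \<Longrightarrow> d dvd a i - b i"
  shows "d dvd prod a A - prod b A"
  using assms
proof (induction A rule: infinite_finite_induct)
  case (insert x A)
  have "a x * prod a A - b x * prod b A = (a x - b x) * prod a A + b x * (prod a A - prod b A)"
    by (simp add: algebra_simps)
  moreover have "d dvd a x - b x" "d dvd prod a A - prod b A" using insert by auto
  ultimately show ?case using insert.hyps by (metis dvd_add dvd_mult dvd_mult2 prod.insert)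
qed auto

lemma dvd_fdet_diff:
  assumes "\<And>i j. i < l \<Longrightarrow> j < l \<Longrightarrow> d dvd A i j - B i j"
  shows "d dvd fdet l A - fdet l B"
proof -
  have "d dvd (\<Prod>i=0..<l. A i (p i)) - (\<Prod>i=0..<l. B i (p i))" if "p permutes {0..<l}" for p
    using permutes_in_image[OF that] assms by (intro dvd_prod_diff) auto
  then show ?thesis
    unfolding fdet_leibniz sum_subtractf[symmetric] right_diff_distrib[symmetric]
    by (intro dvd_sum dvd_mult) auto
qed

lemma cst_dvd_iff: "cst (p::int) dvd P \<longleftrightarrow> (\<forall>m. p dvd lookup P m)"
proof
  assume "cst p dvd P"
  then show "\<forall>m. p dvd lookup P m" by (auto simp: lookup_cst_mult elim!: dvdE)
next
  assume *: "\<forall>m. p dvd lookup P m"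
  have "finite {m. lookup P m div p \<noteq> 0}"
    by (rule finite_subset[OF _ finite_lookup[of P]]) auto
  then have "P = cst p * Abs_poly_mapping (\<lambda>m. lookup P m div p)"
    using * by (intro poly_mapping_eqI) (simp add: lookup_cst_mult)
  then show "cst p dvd P" by (metis dvd_triv_left)
qed

text \<open>The field enters this form of the criterion only as an integer p, so that different
  fields can be compared over the same integer polynomials. Multiples of \<open>cst p\<close> are
  the polynomials whose coefficients all vanish modulo p.\<close>

definition crit :: "int \<Rightarrow> nat \<Rightarrow> nat \<Rightarrow> (nat \<Rightarrow> nat \<Rightarrow> int) \<Rightarrow> bool" where
  "crit p l n \<alpha> \<longleftrightarrow> (\<exists>d \<theta>. (\<forall>i<l.
     (\<forall>j. hpart (d i) (\<theta> i j) = \<theta> i j \<and> keep l (\<theta> i j) = \<theta> i j \<and> (j \<ge> l \<longrightarrow> \<theta> i j = 0)) \<and>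
     (\<forall>k<n. \<exists>g. keep l g = g \<and> cst p dvd apply_lform l (\<alpha> k) (\<theta> i) - lform l (\<alpha> k) * g)) \<and>
     (\<Sum>i<l. d i) = n \<and> \<not> cst p dvd fdet l \<theta>)"

text \<open>The same integer derivations serve modulo p; only their determinant could vanish there,
  and N is one of its nonzero coefficients.\<close>

lemma crit_mod_prime:
  assumes "crit 0 l n \<alpha>"
  shows "\<exists>N\<noteq>0. \<forall>p. \<not> p dvd N \<longrightarrow> crit p l n \<alpha>"
proof -
  obtain d \<theta> where \<theta>: "\<forall>i<l.
     (\<forall>j. hpart (d i) (\<theta> i j) = \<theta> i j \<and> keep l (\<theta> i j) = \<theta> i j \<and> (j \<ge> l \<longrightarrow> \<theta> i j = 0)) \<and>
     (\<forall>k<n. \<exists>g. keep l g = g \<and> cst 0 dvd apply_lform l (\<alpha> k) (\<theta> i) - lform l (\<alpha> k) * g)"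
     "(\<Sum>i<l. d i) = n" "\<not> cst 0 dvd fdet l \<theta>"
    using assms unfolding crit_def by blast
  then obtain m where m: "lookup (fdet l \<theta>) m \<noteq> 0" unfolding cst_dvd_iff by auto
  have "crit p l n \<alpha>" if p: "\<not> p dvd lookup (fdet l \<theta>) m" for p
    unfolding crit_def
  proof (intro exI conjI)
    show "\<not> cst p dvd fdet l \<theta>" using p by (auto simp: cst_dvd_iff)
    have "\<exists>g. keep l g = g \<and> cst p dvd apply_lform l (\<alpha> k) (\<theta> i) - lform l (\<alpha> k) * g"
      if ik: "i < l" "k < n" for i k
    proof -
      obtain g where "keep l g = g" "cst 0 dvd apply_lform l (\<alpha> k) (\<theta> i) - lform l (\<alpha> k) * g"
        using \<theta>(1) ik by blast
      then show ?thesis by (intro exI[of _ g]) simp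
    qed
    then show "\<forall>i<l. (\<forall>j. hpart (d i) (\<theta> i j) = \<theta> i j \<and> keep l (\<theta> i j) = \<theta> i j \<and> (j \<ge> l \<longrightarrow> \<theta> i j = 0)) \<and>
     (\<forall>k<n. \<exists>g. keep l g = g \<and> cst p dvd apply_lform l (\<alpha> k) (\<theta> i) - lform l (\<alpha> k) * g)"
      using \<theta>(1) by blast
  qed (rule \<theta>(2))
  then show ?thesis using m by blast
qed

lemma finite_bounded_msets: "finite {m. set_mset m \<subseteq> {..<l::nat} \<and> size m \<le> n}"
proof (induction n)
  case 0
  have "{m. set_mset m \<subseteq> {..<l} \<and> size m \<le> 0} \<subseteq> {{#}}" by auto
  then show ?case by (rule finite_subset) simp
next
  case (Suc n)
  let ?M = "\<lambda>n. {m. set_mset m \<subseteq> {..<l} \<and> size m \<le> n}"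
  have "?M (Suc n) \<subseteq> insert {#} ((\<lambda>(x, m). add_mset x m) ` ({..<l} \<times> ?M n))"
  proof
    fix m assume m: "m \<in> ?M (Suc n)"
    show "m \<in> insert {#} ((\<lambda>(x, m). add_mset x m) ` ({..<l} \<times> ?M n))"
    proof (cases m)
      case (add x m')
      then show ?thesis using m by (intro insertI2 image_eqI[of _ _ "(x, m')"]) auto
    qed simp
  qed
  then show ?case
    by (rule finite_subset) (intro finite.insertI finite_imageI finite_cartesian_product finite_lessThan Suc)
qed

text \<open>Being logarithmic, with the quotients as further unknowns, is a linear system over the
  integers: coordinate \<open>q < l\<close> is a component of the vector field and coordinate \<open>l + k\<close> is its
  quotient by the form \<open>k\<close>.\<close>

lemma lift_log_system:
  fixes \<alpha> :: "nat \<Rightarrow> nat \<Rightarrow> int" and l n :: nat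
  defines "M \<equiv> {m. set_mset m \<subseteq> {..<l} \<and> size m \<le> n}"
  shows "\<exists>N\<noteq>0. \<forall>p V. (\<forall>q<l + n. \<forall>m. lookup (V q) m \<noteq> 0 \<longrightarrow> m \<in> M) \<longrightarrow>
    (\<forall>k<n. cst p dvd apply_lform l (\<alpha> k) V - lform l (\<alpha> k) * V (l + k)) \<longrightarrow>
    (\<exists>W. (\<forall>q<l + n. \<forall>m. lookup (W q) m \<noteq> 0 \<longrightarrow> m \<in> M) \<and>
      (\<forall>k<n. apply_lform l (\<alpha> k) W = lform l (\<alpha> k) * W (l + k)) \<and>
      (\<forall>q<l + n. cst p dvd W q - cst N * V q))"
proof -
  have fin_M: "finite M" unfolding M_def by (rule finite_bounded_msets)
  \<comment> \<open>Row k of the system with polynomial coefficients: the constants of form k at the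
    components, and minus the form at its own quotient.\<close>
  define U where "U k q = (if q < l then cst (\<alpha> k q) else if q = l + k then - lform l (\<alpha> k) else 0)" for k q
  have U: "apply_lform l (\<alpha> k) V - lform l (\<alpha> k) * V (l + k) = (\<Sum>q<l + n. U k q * V q)"
    if "k < n" for k V
  proof -
    have "(\<Sum>q<l + n. U k q * V q) = (\<Sum>q<l. U k q * V q) + (\<Sum>q=l..<l + n. U k q * V q)"
      unfolding lessThan_atLeast0 by (rule sum.atLeastLessThan_concat[symmetric]) auto
    also have "(\<Sum>q<l. U k q * V q) = apply_lform l (\<alpha> k) V"
      unfolding apply_lform_def by (intro sum.cong) (auto simp: U_def)
    also have "(\<Sum>q=l..<l + n. U k q * V q) =
        (\<Sum>q=l..<l + n. if q = l + k then - lform l (\<alpha> k) * V (l + k) else 0)"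
      by (intro sum.cong) (auto simp: U_def)
    also have "\<dots> = - lform l (\<alpha> k) * V (l + k)" using that by simp
    finally show ?thesis by simp
  qed
  \<comment> \<open>The scalar unknowns are the coefficients of the l + n coordinates at the
    monomials in M; \<open>G k x\<close> below is the polynomial by which the unknown x enters
    relation k.\<close>
  define X where "X = {..<l + n} \<times> M"
  define poly where "poly v q = (\<Sum>m\<in>M. single m (v (q, m)))" for v :: "nat \<times> nat multiset \<Rightarrow> int" and q
  define G where "G k x = U k (fst x) * single (snd x) 1" for k and x :: "nat \<times> nat multiset"
  have lookup_poly: "lookup (poly v q) m = (if m \<in> M then v (q, m) else 0)" for v q m
  proof -
    have "lookup (poly v q) m = (\<Sum>m'\<in>M. if m' = m then v (q, m') else 0)"
      unfolding poly_def by (auto simp: lookup_sum lookup_single when_def intro!: sum.cong)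
    then show ?thesis using fin_M by simp
  qed
  have poly_lookup: "poly (\<lambda>(q, m). lookup (V q) m) q = V q"
    if "\<forall>m. lookup (V q) m \<noteq> 0 \<longrightarrow> m \<in> M" for V q
    using that by (intro poly_mapping_eqI) (auto simp: lookup_poly)
  have expand: "lookup (\<Sum>q<l + n. U k q * poly v q) m = (\<Sum>x\<in>X. lookup (G k x) m * v x)" for k v m
  proof -
    have "(\<Sum>q<l + n. U k q * poly v q) = (\<Sum>q<l + n. \<Sum>m\<in>M. cst (v (q, m)) * G k (q, m))"
      unfolding poly_def sum_distrib_left G_def
      by (intro sum.cong refl) (simp add: mult.left_commute mult_single)
    also have "\<dots> = (\<Sum>x\<in>X. cst (v x) * G k x)"
      unfolding X_def by (simp add: sum.cartesian_product case_prod_unfold)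
    finally show ?thesis by (simp add: lookup_sum lookup_cst_mult mult.commute[of _ "v _"])
  qed
  \<comment> \<open>Only the scalar equations in which some unknown really occurs, which are
    finitely many; at all other pairs (k, m) the equation is 0 = 0.\<close>
  define I where "I = (\<Union>k<n. \<Union>x\<in>X. Pair k ` keys (G k x))"
  have fin_X: "finite X" using fin_M by (simp add: X_def)
  have fin_I: "finite I" using fin_X by (auto simp: I_def)
  obtain N where N: "N \<noteq> 0" and lift: "\<And>p v. \<forall>i\<in>I. p dvd (\<Sum>x\<in>X. lookup (G (fst i) x) (snd i) * v x) \<Longrightarrow>
      \<exists>w. (\<forall>i\<in>I. (\<Sum>x\<in>X. lookup (G (fst i) x) (snd i) * w x) = 0) \<and> (\<forall>x\<in>X. p dvd w x - N * v x)"
    using lift_linear_system[OF fin_I fin_X, of "\<lambda>i x. lookup (G (fst i) x) (snd i)"] by blast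
  have "\<exists>W. (\<forall>q<l + n. \<forall>m. lookup (W q) m \<noteq> 0 \<longrightarrow> m \<in> M) \<and>
      (\<forall>k<n. apply_lform l (\<alpha> k) W = lform l (\<alpha> k) * W (l + k)) \<and>
      (\<forall>q<l + n. cst p dvd W q - cst N * V q)"
    if V: "\<forall>q<l + n. \<forall>m. lookup (V q) m \<noteq> 0 \<longrightarrow> m \<in> M"
      and log: "\<forall>k<n. cst p dvd apply_lform l (\<alpha> k) V - lform l (\<alpha> k) * V (l + k)" for p V
  proof -
    define v where "v = (\<lambda>(q, m). lookup (V q) m)"
    have poly_v: "poly v q = V q" if "q < l + n" for q using poly_lookup V that by (simp add: v_def)
    have "p dvd (\<Sum>x\<in>X. lookup (G k x) m * v x)" if "k < n" for k m
    proof -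
      have "(\<Sum>q<l + n. U k q * poly v q) = apply_lform l (\<alpha> k) V - lform l (\<alpha> k) * V (l + k)"
        unfolding U[OF that] by (intro sum.cong) (auto simp: poly_v)
      then show ?thesis using log that unfolding expand[symmetric] by (simp add: cst_dvd_iff)
    qed
    then have "\<forall>i\<in>I. p dvd (\<Sum>x\<in>X. lookup (G (fst i) x) (snd i) * v x)" by (auto simp: I_def)
    then obtain w where w: "\<forall>i\<in>I. (\<Sum>x\<in>X. lookup (G (fst i) x) (snd i) * w x) = 0"
        "\<forall>x\<in>X. p dvd w x - N * v x"
      using lift by blast
    show ?thesis
    proof (intro exI[of _ "poly w"] conjI allI impI)
      show "m \<in> M" if "lookup (poly w q) m \<noteq> 0" for q m using that by (auto simp: lookup_poly split: if_splits)
      show "cst p dvd poly w q - cst N * V q" if "q < l + n" for q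
        unfolding cst_dvd_iff
      proof
        fix m
        show "p dvd lookup (poly w q - cst N * V q) m"
          unfolding poly_v[OF that, symmetric] using w(2) that
          by (auto simp: lookup_minus lookup_cst_mult lookup_poly X_def)
      qed
      show "apply_lform l (\<alpha> k) (poly w) = lform l (\<alpha> k) * poly w (l + k)" if k: "k < n" for k
      proof -
        have "(\<Sum>x\<in>X. lookup (G k x) m * w x) = 0" for m
        proof (cases "(k, m) \<in> I")
          case True
          then show ?thesis using w(1) by fastforce
        next
          case False
          then have "m \<notin> keys (G k x)" if "x \<in> X" for x using that k unfolding I_def by blast
          then have "lookup (G k x) m = 0" if "x \<in> X" for x using that by (simp add: in_keys_iff)
          then show ?thesis by simp
        qed
        then have "(\<Sum>q<l + n. U k q * poly w q) = 0"
          by (intro poly_mapping_eqI) (simp add: expand)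
        then show ?thesis using U[OF k, of "poly w"] by simp
      qed
    qed
  qed
  then show ?thesis using N by (intro exI[of _ N]) blast
qed

text \<open>N can be chosen before p, the degrees and the derivations: the degrees are at most n,
  which bounds the monomials of every system to be lifted.\<close>

lemma crit_from_prime:
  "\<exists>N\<noteq>0. \<forall>p. prime p \<longrightarrow> \<not> p dvd N \<longrightarrow> crit p l n \<alpha> \<longrightarrow> crit 0 l n \<alpha>"
proof -
  define M where "M = {m. set_mset m \<subseteq> {..<l} \<and> size m \<le> n}"
  obtain N where N: "N \<noteq> 0" and lift: "\<forall>p V. (\<forall>q<l + n. \<forall>m. lookup (V q) m \<noteq> 0 \<longrightarrow> m \<in> M) \<longrightarrow>
    (\<forall>k<n. cst p dvd apply_lform l (\<alpha> k) V - lform l (\<alpha> k) * V (l + k)) \<longrightarrow>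
    (\<exists>W. (\<forall>q<l + n. \<forall>m. lookup (W q) m \<noteq> 0 \<longrightarrow> m \<in> M) \<and>
      (\<forall>k<n. apply_lform l (\<alpha> k) W = lform l (\<alpha> k) * W (l + k)) \<and>
      (\<forall>q<l + n. cst p dvd W q - cst N * V q))"
    using lift_log_system[where l = l and n = n and \<alpha> = \<alpha>, folded M_def] by (elim exE conjE) (rule that)
  have "crit 0 l n \<alpha>" if p: "prime p" "\<not> p dvd N" and "crit p l n \<alpha>" for p
  proof -
    obtain d \<theta> where \<theta>: "\<forall>i<l.
     (\<forall>j. hpart (d i) (\<theta> i j) = \<theta> i j \<and> keep l (\<theta> i j) = \<theta> i j \<and> (j \<ge> l \<longrightarrow> \<theta> i j = 0)) \<and>
     (\<forall>k<n. \<exists>g. keep l g = g \<and> cst p dvd apply_lform l (\<alpha> k) (\<theta> i) - lform l (\<alpha> k) * g)"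
      "(\<Sum>i<l. d i) = n" "\<not> cst p dvd fdet l \<theta>"
      using \<open>crit p l n \<alpha>\<close> unfolding crit_def by blast
    have d_le: "d i \<le> n" if "i < l" for i using \<theta>(2) that member_le_sum[of i "{..<l}" d] by simp
    have hpart_L: "hpart e (lform l (\<alpha> k) * g) = lform l (\<alpha> k) * (if 1 \<le> e then hpart (e - 1) g else 0)"
      for e g k by (simp only: hpart_mult_left[OF homog_lform] split: if_splits) simp
    have hpart_apply: "hpart e (apply_lform l (\<alpha> k) V) = apply_lform l (\<alpha> k) (\<lambda>j. hpart e (V j))" for e k V
      by (simp add: apply_lform_def hpart_sum hpart_cst_mult)
    have "\<exists>\<eta>. (\<forall>j. hpart (d i) (\<eta> j) = \<eta> j \<and> keep l (\<eta> j) = \<eta> j \<and> (j \<ge> l \<longrightarrow> \<eta> j = 0)) \<and>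
      (\<forall>k<n. \<exists>g. keep l g = g \<and> cst 0 dvd apply_lform l (\<alpha> k) \<eta> - lform l (\<alpha> k) * g) \<and>
      (\<forall>j<l. cst p dvd \<eta> j - cst N * \<theta> i j)" if i: "i < l" for i
    proof -
      have "\<forall>k. \<exists>g. k < n \<longrightarrow> keep l g = g \<and> cst p dvd apply_lform l (\<alpha> k) (\<theta> i) - lform l (\<alpha> k) * g"
        using \<theta>(1) i by blast
      then have "\<exists>g. \<forall>k<n. keep l (g k) = g k \<and> cst p dvd apply_lform l (\<alpha> k) (\<theta> i) - lform l (\<alpha> k) * g k"
        by (rule choice)
      then obtain g where g: "\<And>k. k < n \<Longrightarrow> keep l (g k) = g k"
          "\<And>k. k < n \<Longrightarrow> cst p dvd apply_lform l (\<alpha> k) (\<theta> i) - lform l (\<alpha> k) * g k"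
        by blast
      \<comment> \<open>The quotient given by \<open>crit\<close> need not be homogeneous, but only
        its component of degree d i - 1 takes part in a relation of degree d i. In degree 0 there is
        no such component, and the quotient becomes 0.\<close>
      define h where "h k = (if 1 \<le> d i then hpart (d i - 1) (g k) else 0)" for k
      define V where "V q = (if q < l then \<theta> i q else h (q - l))" for q
      have \<theta>i: "hpart (d i) (\<theta> i j) = \<theta> i j" "keep l (\<theta> i j) = \<theta> i j" for j using \<theta>(1) i by blast+
      have "m \<in> M" if q: "q < l + n" and nz: "lookup (V q) m \<noteq> 0" for q m
      proof (cases "q < l")
        case True
        then have "lookup (\<theta> i q) m \<noteq> 0" using nz by (simp add: V_def)
        then have "size m = d i" "set_mset m \<subseteq> {..<l}"
          using \<theta>i(1)[of q, unfolded hpart_id_iff] \<theta>i(2)[of q, unfolded keep_id_iff] by blast+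
        then show ?thesis using d_le[OF i] by (simp add: M_def)
      next
        case False
        then have "lookup (g (q - l)) m \<noteq> 0" "size m = d i - 1"
          using nz by (auto simp: V_def h_def lookup_hpart split: if_splits)
        moreover have "keep l (g (q - l)) = g (q - l)" using g(1) False q by simp
        ultimately show ?thesis using d_le[OF i] unfolding M_def keep_id_iff by auto
      qed
      moreover have "cst p dvd apply_lform l (\<alpha> k) V - lform l (\<alpha> k) * V (l + k)" if k: "k < n" for k
      proof -
        obtain r where r: "apply_lform l (\<alpha> k) (\<theta> i) - lform l (\<alpha> k) * g k = cst p * r"
          using g(2)[OF k] by blast
        have "apply_lform l (\<alpha> k) V = apply_lform l (\<alpha> k) (\<theta> i)"
          unfolding apply_lform_def by (intro sum.cong) (auto simp: V_def)
        also have "\<dots> = hpart (d i) (apply_lform l (\<alpha> k) (\<theta> i))" by (simp add: hpart_apply \<theta>i)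
        also have "apply_lform l (\<alpha> k) (\<theta> i) = lform l (\<alpha> k) * g k + cst p * r"
          using r by (simp add: algebra_simps)
        also have "hpart (d i) \<dots> = lform l (\<alpha> k) * h k + cst p * hpart (d i) r"
          by (simp add: hpart_add hpart_L h_def hpart_cst_mult)
        finally have V: "apply_lform l (\<alpha> k) V = lform l (\<alpha> k) * h k + cst p * hpart (d i) r" .
        have "V (l + k) = h k" by (simp add: V_def)
        then show ?thesis unfolding V by simp
      qed
      ultimately obtain W where W: "\<forall>q<l + n. \<forall>m. lookup (W q) m \<noteq> 0 \<longrightarrow> m \<in> M"
          "\<forall>k<n. apply_lform l (\<alpha> k) W = lform l (\<alpha> k) * W (l + k)"
          "\<forall>q<l + n. cst p dvd W q - cst N * V q"
        using lift[rule_format, of V p] by blast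
      have keep_W: "keep l (W q) = W q" if "q < l + n" for q
        using W(1) that unfolding keep_id_iff M_def by blast
      \<comment> \<open>The lift W need not be homogeneous either. Its component of degree d i still
        satisfies the relations, and it stays congruent to N times \<open>\<theta> i\<close> because
        that row is homogeneous.\<close>
      define \<eta> where "\<eta> j = (if j < l then hpart (d i) (W j) else 0)" for j
      show ?thesis
      proof (intro exI[of _ \<eta>] conjI allI impI)
        show "hpart (d i) (\<eta> j) = \<eta> j" for j by (simp add: \<eta>_def)
        show "keep l (\<eta> j) = \<eta> j" for j by (simp add: \<eta>_def hpart_keep[symmetric] keep_W)
        show "\<eta> j = 0" if "l \<le> j" for j using that by (simp add: \<eta>_def)
        show "\<exists>g. keep l g = g \<and> cst 0 dvd apply_lform l (\<alpha> k) \<eta> - lform l (\<alpha> k) * g" if k: "k < n" for k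
        proof -
          define g' where "g' = (if 1 \<le> d i then hpart (d i - 1) (W (l + k)) else 0)"
          have "apply_lform l (\<alpha> k) \<eta> = apply_lform l (\<alpha> k) (\<lambda>j. hpart (d i) (W j))"
            unfolding apply_lform_def by (intro sum.cong) (auto simp: \<eta>_def)
          also have "\<dots> = lform l (\<alpha> k) * g'"
            using W(2) k by (simp only: hpart_apply[symmetric] hpart_L g'_def)
          finally have "apply_lform l (\<alpha> k) \<eta> = lform l (\<alpha> k) * g'" .
          moreover have "keep l g' = g'" using keep_W[of "l + k"] k by (simp add: g'_def hpart_keep[symmetric])
          ultimately show ?thesis by (intro exI[of _ g']) simp
        qed
        show "cst p dvd \<eta> j - cst N * \<theta> i j" if j: "j < l" for j
        proof -
          have "cst p dvd W j - cst N * V j" using W(3) j by simp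
          then obtain r where r: "W j - cst N * \<theta> i j = cst p * r"
            using j unfolding V_def dvd_def by auto
          then have "W j = cst N * \<theta> i j + cst p * r" by (simp add: algebra_simps)
          then have "\<eta> j = cst N * \<theta> i j + cst p * hpart (d i) r"
            using j by (simp add: \<eta>_def hpart_add hpart_cst_mult \<theta>i)
          then show ?thesis by simp
        qed
      qed
    qed
    then have "\<forall>i. \<exists>\<eta>. i < l \<longrightarrow> (\<forall>j. hpart (d i) (\<eta> j) = \<eta> j \<and> keep l (\<eta> j) = \<eta> j \<and> (j \<ge> l \<longrightarrow> \<eta> j = 0)) \<and>
      (\<forall>k<n. \<exists>g. keep l g = g \<and> cst 0 dvd apply_lform l (\<alpha> k) \<eta> - lform l (\<alpha> k) * g) \<and>
      (\<forall>j<l. cst p dvd \<eta> j - cst N * \<theta> i j)" by blast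
    then have "\<exists>\<eta>. \<forall>i<l. (\<forall>j. hpart (d i) (\<eta> i j) = \<eta> i j \<and> keep l (\<eta> i j) = \<eta> i j \<and> (j \<ge> l \<longrightarrow> \<eta> i j = 0)) \<and>
      (\<forall>k<n. \<exists>g. keep l g = g \<and> cst 0 dvd apply_lform l (\<alpha> k) (\<eta> i) - lform l (\<alpha> k) * g) \<and>
      (\<forall>j<l. cst p dvd \<eta> i j - cst N * \<theta> i j)" by (rule choice)
    then obtain \<eta> where \<eta>: "\<forall>i<l. (\<forall>j. hpart (d i) (\<eta> i j) = \<eta> i j \<and> keep l (\<eta> i j) = \<eta> i j \<and> (j \<ge> l \<longrightarrow> \<eta> i j = 0)) \<and>
      (\<forall>k<n. \<exists>g. keep l g = g \<and> cst 0 dvd apply_lform l (\<alpha> k) (\<eta> i) - lform l (\<alpha> k) * g) \<and>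
      (\<forall>j<l. cst p dvd \<eta> i j - cst N * \<theta> i j)" by blast
    \<comment> \<open>This determinant is congruent modulo p to N^l times that of
      \<open>\<theta>\<close>. Since p is prime and does not divide N, its vanishing would make p
      divide every coefficient of \<open>fdet l \<theta>\<close>.\<close>
    have "fdet l \<eta> \<noteq> 0"
    proof
      assume "fdet l \<eta> = 0"
      moreover have "cst p dvd fdet l \<eta> - fdet l (\<lambda>i j. cst N * \<theta> i j)"
        using \<eta> by (intro dvd_fdet_diff) blast
      moreover have "fdet l (\<lambda>i j. cst N * \<theta> i j) = cst (N ^ l) * fdet l \<theta>"
      proof -
        have "(cst N :: int mpol) ^ l = cst (N ^ l)" by (induction l) (simp_all add: cst_mult)
        then show ?thesis using fdet_factor_rows[of l "\<lambda>_. cst N" \<theta>] by simp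
      qed
      ultimately have "cst p dvd cst (N ^ l) * fdet l \<theta>" by simp
      then have "p dvd N ^ l * lookup (fdet l \<theta>) m" for m by (simp add: cst_dvd_iff lookup_cst_mult)
      then have "p dvd lookup (fdet l \<theta>) m" for m
        using p prime_dvd_multD prime_dvd_power by blast
      then show False using \<theta>(3) by (simp add: cst_dvd_iff)
    qed
    then show ?thesis unfolding crit_def using \<eta> \<theta>(2)
      by (intro exI[of _ d] exI[of _ \<eta>]) simp
  qed
  then show ?thesis using N by blast
qed

section \<open>Integer polynomials and their images over a field\<close>

declare single_of_int [simp del]

text \<open>Coefficientwise maps that fix 0 create no new monomials, so they preserve homogeneity
  and the set of variables.\<close>

lemma filt_map_zero: "(\<And>m. lookup P' m \<noteq> 0 \<Longrightarrow> lookup P m \<noteq> 0) \<Longrightarrow> filt M P = P \<Longrightarrow> filt M P' = P'"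
  unfolding poly_mapping_eq_iff fun_eq_iff lookup_filt by metis

definition of_int_mpol :: "int mpol \<Rightarrow> 'a::comm_ring_1 mpol" where
  "of_int_mpol P = Poly_Mapping.map of_int P"

lemma lookup_of_int_mpol: "lookup (of_int_mpol P) m = of_int (lookup P m)"
  by (simp add: of_int_mpol_def map.rep_eq when_def)

lemma of_int_mpol_mult: "of_int_mpol (P * Q) = of_int_mpol P * of_int_mpol Q"
  by (intro poly_mapping_eqI) (simp add: lookup_of_int_mpol lookup_mult_sum case_prod_unfold)

lemma of_int_mpol_cst: "of_int_mpol (cst c) = cst (of_int c)"
  by (intro poly_mapping_eqI) (simp add: lookup_of_int_mpol lookup_single when_def)

lemma comm_ring_hom_of_int_mpol: "comm_ring_hom of_int_mpol"
proof
  show "of_int_mpol 1 = 1" using of_int_mpol_cst[of 1] by simp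
  show "of_int_mpol 0 = 0" "of_int_mpol (P + P') = of_int_mpol P + of_int_mpol P'" for P P'
    by (intro poly_mapping_eqI; simp add: lookup_of_int_mpol lookup_add)+
qed (rule of_int_mpol_mult)

lemma of_int_mpol_diff: "of_int_mpol (P - Q) = of_int_mpol P - of_int_mpol Q"
  by (intro poly_mapping_eqI) (simp add: lookup_of_int_mpol lookup_minus)

lemma of_int_mpol_lform: "of_int_mpol (lform l a) = lform l (\<lambda>j. of_int (a j))"
  by (intro poly_mapping_eqI) (simp add: lookup_of_int_mpol lookup_lform if_distrib cong: if_cong)

lemma of_int_mpol_apply_lform:
  "of_int_mpol (apply_lform l a \<theta>) = apply_lform l (\<lambda>j. of_int (a j)) (\<lambda>j. of_int_mpol (\<theta> j))"
  by (intro poly_mapping_eqI) (simp add: lookup_of_int_mpol apply_lform_def lookup_sum lookup_cst_mult)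

lemma of_int_mpol_keep: "keep l P = P \<Longrightarrow> keep l (of_int_mpol P) = of_int_mpol P"
  unfolding keep_def by (erule filt_map_zero[rotated]) (auto simp: lookup_of_int_mpol)

lemma of_int_mpol_hpart: "hpart d P = P \<Longrightarrow> hpart d (of_int_mpol P) = of_int_mpol P"
  unfolding hpart_def by (erule filt_map_zero[rotated]) (auto simp: lookup_of_int_mpol)

text \<open>A zero coefficient is lifted to 0 and not to some other multiple of p, so that lifting
  adds no monomials.\<close>

definition lift_poly :: "'a::comm_ring_1 mpol \<Rightarrow> int mpol" where
  "lift_poly P = Poly_Mapping.map (\<lambda>x. SOME k. of_int k = x) P"

lemma lookup_lift_poly: "lookup (lift_poly P) m = (if lookup P m = 0 then 0 else SOME k. of_int k = lookup P m)"
  by (simp add: lift_poly_def map.rep_eq when_def)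

lemma of_int_lift_poly:
  assumes "\<And>m. lookup P m \<in> range of_int"
  shows "of_int_mpol (lift_poly P) = P"
proof (intro poly_mapping_eqI)
  fix m
  obtain k where "of_int k = lookup P m" using assms[of m] by auto
  then have "of_int (SOME k. of_int k = lookup P m) = lookup P m" by (rule someI)
  then show "lookup (of_int_mpol (lift_poly P)) m = lookup P m"
    by (simp add: lookup_of_int_mpol lookup_lift_poly)
qed

lemma lift_poly_0 [simp]: "lift_poly 0 = 0"
  by (intro poly_mapping_eqI) (simp add: lookup_lift_poly)

lemma lift_poly_keep: "keep l P = P \<Longrightarrow> keep l (lift_poly P) = lift_poly P"
  unfolding keep_def by (erule filt_map_zero[rotated]) (auto simp: lookup_lift_poly split: if_splits)

lemma lift_poly_hpart: "hpart d P = P \<Longrightarrow> hpart d (lift_poly P) = lift_poly P"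
  unfolding hpart_def by (erule filt_map_zero[rotated]) (auto simp: lookup_lift_poly split: if_splits)

text \<open>Besides primes, \<open>p = 0\<close> is allowed here and in \<open>crit\<close>, and stands for the rationals.\<close>

definition prime_field :: "int \<Rightarrow> 'a::field itself \<Rightarrow> bool" where
  "prime_field p _ \<longleftrightarrow> (\<forall>x. (of_int x :: 'a) = 0 \<longleftrightarrow> p dvd x) \<and>
     (\<forall>A :: 'a set. finite A \<longrightarrow> (\<exists>N. (of_int N :: 'a) \<noteq> 0 \<and> (\<forall>x\<in>A. of_int N * x \<in> range of_int)))"

lemma prime_field_of_int_eq_0_iff:
  "prime_field p TYPE('a::field) \<Longrightarrow> (of_int x :: 'a) = 0 \<longleftrightarrow> p dvd x"
  by (simp add: prime_field_def)

lemma prime_field_denominator: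
  assumes "prime_field p TYPE('a::field)" "finite (A :: 'a set)"
  shows "\<exists>N. (of_int N :: 'a) \<noteq> 0 \<and> (\<forall>x\<in>A. of_int N * x \<in> range of_int)"
proof -
  have "finite A \<longrightarrow> (\<exists>N. (of_int N :: 'a) \<noteq> 0 \<and> (\<forall>x\<in>A. of_int N * x \<in> range of_int))"
    using assms(1) unfolding prime_field_def by (elim conjE) (erule spec)
  then show ?thesis using assms(2) by (rule mp)
qed

lemma of_int_mpol_eq_0_iff:
  assumes "prime_field p TYPE('a::field)"
  shows "(of_int_mpol P :: 'a mpol) = 0 \<longleftrightarrow> cst p dvd P"
proof -
  have "(of_int_mpol P :: 'a mpol) = 0 \<longleftrightarrow> (\<forall>m. (of_int (lookup P m) :: 'a) = 0)"
    by (simp add: poly_mapping_eq_iff fun_eq_iff lookup_of_int_mpol)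
  then show ?thesis by (simp add: prime_field_of_int_eq_0_iff[OF assms] cst_dvd_iff)
qed

text \<open>From right to left the coefficients are mapped into the field. In the other direction
  one integer N, nonzero in the field, clears the denominators of rows and quotients; scaling by it
  preserves degrees, divisibility and the nonvanishing of the determinant.\<close>

lemma saito_iff_crit:
  assumes pf: "prime_field p TYPE('a::field)"
  shows "(\<exists>d \<theta>. (\<forall>i<l. \<theta> i \<in> logder l n (\<lambda>i j. of_int (\<alpha> i j) :: 'a) \<and> (\<forall>j. hpart (d i) (\<theta> i j) = \<theta> i j)) \<and>
     (\<Sum>i<l. d i) = n \<and> fdet l \<theta> \<noteq> 0) \<longleftrightarrow> crit p l n \<alpha>" (is "?S \<longleftrightarrow> _")
proof
  assume "crit p l n \<alpha>"
  then obtain d \<theta> where \<theta>: "\<forall>i<l.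
     (\<forall>j. hpart (d i) (\<theta> i j) = \<theta> i j \<and> keep l (\<theta> i j) = \<theta> i j \<and> (j \<ge> l \<longrightarrow> \<theta> i j = 0)) \<and>
     (\<forall>k<n. \<exists>g. keep l g = g \<and> cst p dvd apply_lform l (\<alpha> k) (\<theta> i) - lform l (\<alpha> k) * g)"
     "(\<Sum>i<l. d i) = n" "\<not> cst p dvd fdet l \<theta>"
    unfolding crit_def by blast
  define \<theta>' :: "nat \<Rightarrow> nat \<Rightarrow> 'a mpol" where "\<theta>' i j = of_int_mpol (\<theta> i j)" for i j
  have "\<theta>' i \<in> logder l n (\<lambda>i j. of_int (\<alpha> i j))" if i: "i < l" for i
  proof -
    have "lform l (\<lambda>j. of_int (\<alpha> k j)) dvd apply_lform l (\<lambda>j. of_int (\<alpha> k j)) (\<theta>' i)" if k: "k < n" for k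
    proof -
      obtain g where "cst p dvd apply_lform l (\<alpha> k) (\<theta> i) - lform l (\<alpha> k) * g" using \<theta>(1) i k by blast
      then have "(of_int_mpol (apply_lform l (\<alpha> k) (\<theta> i) - lform l (\<alpha> k) * g) :: 'a mpol) = 0"
        using of_int_mpol_eq_0_iff[OF pf] by blast
      moreover have "\<theta>' i = (\<lambda>j. of_int_mpol (\<theta> i j))" by (simp add: \<theta>'_def fun_eq_iff)
      ultimately show ?thesis
        unfolding of_int_mpol_diff of_int_mpol_apply_lform of_int_mpol_mult of_int_mpol_lform
        by simp
    qed
    moreover have "of_int_mpol 0 = (0 :: 'a mpol)" by (intro poly_mapping_eqI) (simp add: lookup_of_int_mpol)
    ultimately show ?thesis using \<theta>(1) i by (simp add: logder_def \<theta>'_def of_int_mpol_keep)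
  qed
  moreover have "fdet l \<theta>' \<noteq> 0"
  proof -
    have "fdet l \<theta>' = of_int_mpol (fdet l \<theta>)"
      unfolding \<theta>'_def by (rule fdet_hom[OF comm_ring_hom_of_int_mpol])
    then show ?thesis using \<theta>(3) of_int_mpol_eq_0_iff[OF pf] by simp
  qed
  moreover have "hpart (d i) (\<theta>' i j) = \<theta>' i j" if "i < l" for i j
    using \<theta>(1) that by (simp add: \<theta>'_def of_int_mpol_hpart)
  ultimately show ?S using \<theta>(2) by (intro exI[of _ d] exI[of _ \<theta>']) simp
next
  let ?a = "\<lambda>i j. of_int (\<alpha> i j) :: 'a"
  assume ?S
  then obtain d \<theta> where \<theta>: "\<And>i. i < l \<Longrightarrow> \<theta> i \<in> logder l n ?a"
      "\<And>i j. i < l \<Longrightarrow> hpart (d i) (\<theta> i j) = \<theta> i j" "(\<Sum>i<l. d i) = n" "fdet l \<theta> \<noteq> 0"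
    by auto
  have "\<exists>g. apply_lform l (?a k) (\<theta> i) = lform l (?a k) * g" if "i < l" "k < n" for i k
    using \<theta>(1)[OF that(1)] that(2) unfolding logder_def by (blast elim: dvdE)
  then have "\<forall>x. \<exists>g. fst x < l \<longrightarrow> snd x < n \<longrightarrow>
      apply_lform l (?a (snd x)) (\<theta> (fst x)) = lform l (?a (snd x)) * g" by blast
  then have "\<exists>g. \<forall>x. fst x < l \<longrightarrow> snd x < n \<longrightarrow>
      apply_lform l (?a (snd x)) (\<theta> (fst x)) = lform l (?a (snd x)) * g x" by (rule choice)
  then obtain g where g: "\<And>i k. i < l \<Longrightarrow> k < n \<Longrightarrow>
      apply_lform l (?a k) (\<theta> i) = lform l (?a k) * g (i, k)" by fastforce
  \<comment> \<open>The quotients are included, so that the divisibility relations lift to integer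
    congruences along with the rows.\<close>
  define A where "A = (\<Union>i<l. \<Union>j<l. lookup (\<theta> i j) ` keys (\<theta> i j)) \<union>
    (\<Union>x\<in>{..<l} \<times> {..<n}. lookup (g x) ` keys (g x))"
  have "finite A" by (simp add: A_def)
  then have "\<exists>N. (of_int N :: 'a) \<noteq> 0 \<and> (\<forall>x\<in>A. of_int N * x \<in> range of_int)"
    by (rule prime_field_denominator[OF pf])
  then obtain N where N: "(of_int N :: 'a) \<noteq> 0" "\<forall>x\<in>A. of_int N * x \<in> range of_int"
    by (elim exE conjE) (rule that)
  have zero: "(0 :: 'a) \<in> range of_int" by (metis of_int_0 rangeI)
  have N_lookup: "of_int N * lookup P m \<in> range of_int" if "lookup P ` keys P \<subseteq> A" for P :: "'a mpol" and m
  proof (cases "m \<in> keys P")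
    case True
    then have "lookup P m \<in> A" using that by blast
    then show ?thesis using N(2) by (rule bspec[rotated])
  next
    case False
    then show ?thesis using zero by (simp add: in_keys_iff)
  qed
  define \<theta>' where "\<theta>' i j = lift_poly (cst (of_int N) * \<theta> i j)" for i j
  have zero_\<theta>: "\<theta> i j = 0" if "i < l" "j \<ge> l" for i j using \<theta>(1)[OF that(1)] that(2) by (simp add: logder_def)
  have keep_\<theta>: "keep l (\<theta> i j) = \<theta> i j" if "i < l" for i j using \<theta>(1)[OF that(1)] by (simp add: logder_def)
  have of_int_\<theta>': "of_int_mpol (\<theta>' i j) = cst (of_int N) * \<theta> i j" if "i < l" for i j
  proof (cases "j < l")
    case True
    then show ?thesis using that unfolding \<theta>'_def
      by (intro of_int_lift_poly) (unfold lookup_cst_mult, rule N_lookup, auto simp: A_def)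
  next
    case False
    then show ?thesis using zero_\<theta>[OF that, of j] unfolding \<theta>'_def
      by (intro of_int_lift_poly) (simp add: zero)
  qed
  show "crit p l n \<alpha>"
    unfolding crit_def
  proof (intro exI[of _ d] exI[of _ \<theta>'] conjI allI impI)
    show "hpart (d i) (\<theta>' i j) = \<theta>' i j" if "i < l" for i j
      unfolding \<theta>'_def using that \<theta>(2) by (intro lift_poly_hpart) (simp add: hpart_cst_mult)
    show "keep l (\<theta>' i j) = \<theta>' i j" if "i < l" for i j
      unfolding \<theta>'_def using that keep_\<theta> by (intro lift_poly_keep) (simp add: keep_mult)
    show "\<theta>' i j = 0" if "i < l" "l \<le> j" for i j using that zero_\<theta> by (simp add: \<theta>'_def)
    show "\<exists>g. keep l g = g \<and> cst p dvd apply_lform l (\<alpha> k) (\<theta>' i) - lform l (\<alpha> k) * g"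
      if ik: "i < l" "k < n" for i k
    proof -
      \<comment> \<open>Divisibility in \<open>logder\<close> allows a quotient in any variables;
        \<open>keep l\<close> restricts it as \<open>crit\<close> demands.\<close>
      define h where "h = lift_poly (keep l (cst (of_int N) * g (i, k)))"
      have "of_int_mpol h = keep l (cst (of_int N) * g (i, k))"
        unfolding h_def
      proof (rule of_int_lift_poly)
        fix m
        have "lookup (g (i, k)) ` keys (g (i, k)) \<subseteq> A" using ik by (auto simp: A_def)
        then show "lookup (keep l (cst (of_int N) * g (i, k))) m \<in> range of_int"
          using N_lookup zero by (simp add: lookup_keep lookup_cst_mult)
      qed
      moreover have "apply_lform l (?a k) (\<theta> i) = lform l (?a k) * keep l (g (i, k))"
      proof -
        have "apply_lform l (?a k) (\<theta> i) = keep l (apply_lform l (?a k) (\<theta> i))"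
          using ik(1) by (simp add: apply_lform_def keep_sum keep_mult keep_\<theta>)
        then show ?thesis by (simp add: g[OF ik] keep_mult keep_lform)
      qed
      moreover have "apply_lform l (?a k) (\<lambda>j. cst (of_int N) * \<theta> i j) = cst (of_int N) * apply_lform l (?a k) (\<theta> i)"
        by (simp add: apply_lform_def sum_distrib_left mult.left_commute)
      ultimately have "of_int_mpol (apply_lform l (\<alpha> k) (\<theta>' i) - lform l (\<alpha> k) * h) = (0 :: 'a mpol)"
        unfolding of_int_mpol_diff of_int_mpol_apply_lform of_int_mpol_mult of_int_mpol_lform
        by (simp add: of_int_\<theta>'[OF ik(1)] keep_mult)
      then have "cst p dvd apply_lform l (\<alpha> k) (\<theta>' i) - lform l (\<alpha> k) * h"
        using of_int_mpol_eq_0_iff[OF pf] by blast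
      moreover have "keep l h = h" unfolding h_def by (intro lift_poly_keep) simp
      ultimately show ?thesis by blast
    qed
    have "(of_int_mpol (fdet l \<theta>') :: 'a mpol) = fdet l (\<lambda>i j. of_int_mpol (\<theta>' i j))"
      by (rule fdet_hom[OF comm_ring_hom_of_int_mpol, symmetric])
    also have "\<dots> = fdet l (\<lambda>i j. cst (of_int N) * \<theta> i j)"
      by (rule fdet_cong) (simp add: of_int_\<theta>')
    also have "\<dots> = cst (of_int N) ^ l * fdet l \<theta>"
      using fdet_factor_rows[of l "\<lambda>_. cst (of_int N)" \<theta>] by simp
    finally have "(of_int_mpol (fdet l \<theta>') :: 'a mpol) \<noteq> 0" using N(1) \<theta>(4) by simp
    then show "\<not> cst p dvd fdet l \<theta>'" using of_int_mpol_eq_0_iff[OF pf] by blast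
  qed (rule \<theta>(3))
qed

section \<open>Rational and finite prime fields\<close>

lemma common_denominator:
  assumes "finite (A :: rat set)"
  shows "\<exists>N::int. N \<noteq> 0 \<and> (\<forall>x\<in>A. of_int N * x \<in> range of_int)"
  using assms
proof (induction A rule: finite_induct)
  case empty
  then show ?case by (intro exI[of _ 1]) simp
next
  case (insert x A)
  then obtain N :: int where N: "N \<noteq> 0" "\<forall>x\<in>A. of_int N * x \<in> range of_int" by blast
  obtain a b :: int where ab: "b > 0" "x = of_int a / of_int b"
    by (metis Fract_of_int_quotient Rat_cases)
  have "of_int (b * N) * y \<in> range of_int" if "y \<in> insert x A" for y
  proof (cases "y = x")
    case True
    then have "of_int (b * N) * y = of_int (N * a)" using ab by simp
    then show ?thesis by (metis rangeI)
  next
    case False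
    then have "of_int N * y \<in> range of_int" using N(2) that by blast
    then obtain k where "of_int N * y = of_int k" by (rule rangeE)
    then have "of_int (b * N) * y = of_int (b * k)" by (simp add: mult.assoc)
    then show ?thesis by (metis rangeI)
  qed
  moreover have "b * N \<noteq> 0" using N ab by simp
  ultimately show ?case by blast
qed

lemma prime_field_rat: "prime_field 0 TYPE(rat)"
  using common_denominator by (auto simp: prime_field_def)

lemma field_record_rat: "field_record rat_field (\<lambda>x. x)"
proof (rule field_record.intro)
  show "cring rat_field"
    by (intro cringI abelian_groupI comm_monoidI)
      (auto simp: rat_field_def algebra_simps intro: exI[of _ "- _"])
qed (auto simp: rat_field_def bij_betw_def)

section \<open>Dimensions of intersections\<close>

text \<open>The integer counterpart of having k linearly independent vectors in the intersection,
  again with p = 0 for the rationals, where vectors and relations are cleared of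
  denominators.\<close>

definition dim_crit :: "int \<Rightarrow> nat \<Rightarrow> (nat \<Rightarrow> nat \<Rightarrow> int) \<Rightarrow> nat set \<Rightarrow> nat \<Rightarrow> bool" where
  "dim_crit p l \<alpha> I k \<longleftrightarrow> (\<exists>b. (\<forall>s. \<forall>j\<ge>l. b s j = 0) \<and>
     (\<forall>i\<in>I. \<forall>s<k. p dvd (\<Sum>j<l. \<alpha> i j * b s j)) \<and>
     (\<forall>c. (\<forall>j<l. p dvd (\<Sum>s<k. c s * b s j)) \<longrightarrow> (\<forall>s<k. p dvd c s)))"

text \<open>The same vectors b serve modulo p. The lifting lemma is applied to the relations among
  them, with the coefficients as unknowns: a relation c modulo p lifts to an integer relation
  congruent to N times c, which must be trivial.\<close>

lemma dim_crit_mod_prime: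
  assumes "dim_crit 0 l \<alpha> I k"
  shows "\<exists>N\<noteq>0. \<forall>p. prime p \<longrightarrow> \<not> p dvd N \<longrightarrow> dim_crit p l \<alpha> I k"
proof -
  obtain b where b: "\<forall>s. \<forall>j\<ge>l. b s j = 0" "\<forall>i\<in>I. \<forall>s<k. 0 dvd (\<Sum>j<l. \<alpha> i j * b s j)"
    "\<forall>c. (\<forall>j<l. 0 dvd (\<Sum>s<k. c s * b s j)) \<longrightarrow> (\<forall>s<k. 0 dvd c s)"
    using assms unfolding dim_crit_def by blast
  obtain N where N: "N \<noteq> 0" "\<forall>p c. (\<forall>j\<in>{..<l}. p dvd (\<Sum>s\<in>{..<k}. b s j * c s)) \<longrightarrow>
      (\<exists>w. (\<forall>j\<in>{..<l}. (\<Sum>s\<in>{..<k}. b s j * w s) = 0) \<and> (\<forall>s\<in>{..<k}. p dvd w s - N * c s))"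
    using lift_linear_system[of "{..<l}" "{..<k}" "\<lambda>j s. b s j"] by auto
  have "p dvd c s" if p: "prime p" "\<not> p dvd N" and c: "\<forall>j<l. p dvd (\<Sum>s<k. c s * b s j)" and s: "s < k"
    for p c s
  proof -
    have "\<forall>j\<in>{..<l}. p dvd (\<Sum>s\<in>{..<k}. b s j * c s)" using c by (simp add: mult.commute)
    then obtain w where w: "\<forall>j\<in>{..<l}. (\<Sum>s\<in>{..<k}. b s j * w s) = 0" "\<forall>s\<in>{..<k}. p dvd w s - N * c s"
      using N(2) by blast
    have "w s = 0" using b(3)[rule_format, of w s] w(1) s by (simp add: mult.commute)
    moreover have "p dvd w s - N * c s" using w(2) s by blast
    ultimately have "p dvd N * c s" by simp
    then show ?thesis using p prime_dvd_multD by blast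
  qed
  moreover have "\<forall>i\<in>I. \<forall>s<k. p dvd (\<Sum>j<l. \<alpha> i j * b s j)" for p using b(2) by simp
  ultimately have "\<forall>p. prime p \<longrightarrow> \<not> p dvd N \<longrightarrow> dim_crit p l \<alpha> I k"
    unfolding dim_crit_def using b(1) by (intro allI impI exI[of _ b]) blast
  then show ?thesis using N(1) by blast
qed

lemma eq_0_if_powers_dvd:
  fixes p x :: int
  assumes "prime p" "\<And>e. p ^ e dvd x"
  shows "x = 0"
proof (rule ccontr)
  assume "x \<noteq> 0"
  then have "p ^ nat \<bar>x\<bar> \<le> \<bar>x\<bar>" using dvd_imp_le_int assms(2) prime_ge_0_int[OF assms(1)] by fastforce
  moreover have "(2::int) ^ nat \<bar>x\<bar> \<le> p ^ nat \<bar>x\<bar>"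
    using prime_ge_2_int[OF assms(1)] by (intro power_mono) auto
  moreover have "int (nat \<bar>x\<bar>) < 2 ^ nat \<bar>x\<bar>" by (metis of_nat_less_two_power)
  ultimately show False by simp
qed

text \<open>The vectors are lifted to integer solutions congruent to N times the given ones. They
  are independent by descent, since the coefficients of an integer relation are divisible by
  p.\<close>

lemma dim_crit_from_prime:
  assumes "finite I"
  shows "\<exists>N\<noteq>0. \<forall>p k. prime p \<longrightarrow> \<not> p dvd N \<longrightarrow> dim_crit p l \<alpha> I k \<longrightarrow> dim_crit 0 l \<alpha> I k"
proof -
  obtain N where N: "N \<noteq> 0" "\<forall>p v. (\<forall>i\<in>I. p dvd (\<Sum>j\<in>{..<l}. \<alpha> i j * v j)) \<longrightarrow>
      (\<exists>w. (\<forall>i\<in>I. (\<Sum>j\<in>{..<l}. \<alpha> i j * w j) = 0) \<and> (\<forall>j\<in>{..<l}. p dvd w j - N * v j))"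
    using lift_linear_system[OF assms finite_lessThan[of l], of \<alpha>] by blast
  have "dim_crit 0 l \<alpha> I k" if p: "prime p" "\<not> p dvd N" and crit: "dim_crit p l \<alpha> I k" for p k
  proof -
    obtain b where b: "\<forall>s. \<forall>j\<ge>l. b s j = 0" "\<forall>i\<in>I. \<forall>s<k. p dvd (\<Sum>j<l. \<alpha> i j * b s j)"
      "\<forall>c. (\<forall>j<l. p dvd (\<Sum>s<k. c s * b s j)) \<longrightarrow> (\<forall>s<k. p dvd c s)"
      using crit unfolding dim_crit_def by blast
    have "\<forall>s. \<exists>w. s < k \<longrightarrow> (\<forall>i\<in>I. (\<Sum>j\<in>{..<l}. \<alpha> i j * w j) = 0) \<and> (\<forall>j\<in>{..<l}. p dvd w j - N * b s j)"
      using N(2) b(2) by blast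
    then have "\<exists>w. \<forall>s<k. (\<forall>i\<in>I. (\<Sum>j\<in>{..<l}. \<alpha> i j * w s j) = 0) \<and> (\<forall>j\<in>{..<l}. p dvd w s j - N * b s j)"
      by (rule choice)
    then obtain w where w: "\<And>s i. s < k \<Longrightarrow> i \<in> I \<Longrightarrow> (\<Sum>j<l. \<alpha> i j * w s j) = 0"
        "\<And>s j. s < k \<Longrightarrow> j < l \<Longrightarrow> p dvd w s j - N * b s j" by auto
    define w' where "w' s j = (if j < l then w s j else 0)" for s j
    have dvd_sol: "p dvd c s" if c: "\<forall>j<l. (\<Sum>s<k. c s * w' s j) = 0" and s: "s < k" for c s
    proof -
      have "p dvd (\<Sum>s<k. c s * b s j)" if j: "j < l" for j
      proof -
        have "p dvd (\<Sum>s<k. c s * (w s j - N * b s j))" using w(2) j by (intro dvd_sum) auto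
        also have "(\<Sum>s<k. c s * (w s j - N * b s j)) = - (N * (\<Sum>s<k. c s * b s j))"
          using c j by (simp add: w'_def right_diff_distrib sum_subtractf sum_distrib_left mult.left_commute)
        finally have "p dvd N * (\<Sum>s<k. c s * b s j)" by simp
        then show ?thesis using p prime_dvd_multD by blast
      qed
      then show ?thesis using b(3) s by blast
    qed
    \<comment> \<open>Dividing all coefficients of a relation by p gives another integer relation,
      so they are divisible by every power of p.\<close>
    have pow: "p ^ e dvd c s" if "\<forall>j<l. (\<Sum>s<k. c s * w' s j) = 0" "s < k" for c s e
      using that
    proof (induction e arbitrary: c s)
      case (Suc e)
      define c' where "c' s = c s div p" for s
      have c: "c s = p * c' s" if "s < k" for s using dvd_sol[OF Suc.prems(1) that] by (simp add: c'_def)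
      have "(\<Sum>s<k. c' s * w' s j) = 0" if "j < l" for j
      proof -
        have "0 = (\<Sum>s<k. c s * w' s j)" using Suc.prems(1) that by simp
        also have "\<dots> = (\<Sum>s<k. p * (c' s * w' s j))" using c by (intro sum.cong) auto
        also have "\<dots> = p * (\<Sum>s<k. c' s * w' s j)" by (simp add: sum_distrib_left)
        finally show ?thesis using p(1) by auto
      qed
      then have "p ^ e dvd c' s" using Suc.IH Suc.prems(2) by blast
      then show ?case using c[OF Suc.prems(2)] by (simp add: mult_dvd_mono)
    qed simp
    have "c s = 0" if "\<forall>j<l. (\<Sum>s<k. c s * w' s j) = 0" "s < k" for c s
    proof (rule eq_0_if_powers_dvd[OF p(1)])
      show "p ^ e dvd c s" for e using pow that by blast
    qed
    then show ?thesis unfolding dim_crit_def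
      by (intro exI[of _ w']) (simp add: w(1) w'_def)
  qed
  then show ?thesis using N(1) by blast
qed

text \<open>By counting: forming linear combinations of the vectors is an injection from p^k
  coefficient families into p^l residue vectors.\<close>

lemma dim_crit_prime_le:
  fixes p :: int
  assumes p: "prime p" and "dim_crit p l \<alpha> I k"
  shows "k \<le> l"
proof -
  obtain b where indep: "\<forall>c. (\<forall>j<l. p dvd (\<Sum>s<k. c s * b s j)) \<longrightarrow> (\<forall>s<k. p dvd c s)"
    using assms(2) unfolding dim_crit_def by blast
  let ?P = "{0..<p}"
  define \<phi> where "\<phi> c = restrict (\<lambda>j. (\<Sum>s<k. c s * b s j) mod p) {..<l}" for c
  have "inj_on \<phi> (PiE {..<k} (\<lambda>_. ?P))"
  proof (rule inj_onI)
    fix c c' assume c: "c \<in> PiE {..<k} (\<lambda>_. ?P)" and c': "c' \<in> PiE {..<k} (\<lambda>_. ?P)" and eq: "\<phi> c = \<phi> c'"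
    have "p dvd (\<Sum>s<k. (c s - c' s) * b s j)" if "j < l" for j
    proof -
      have "(\<Sum>s<k. c s * b s j) mod p = (\<Sum>s<k. c' s * b s j) mod p"
        using fun_cong[OF eq, of j] that by (simp add: \<phi>_def)
      then show ?thesis by (simp add: mod_eq_dvd_iff left_diff_distrib sum_subtractf)
    qed
    then have "p dvd c s - c' s" if "s < k" for s
      using indep[rule_format, of "\<lambda>s. c s - c' s"] that by blast
    then have "c s mod p = c' s mod p" if "s < k" for s using that by (simp add: mod_eq_dvd_iff)
    moreover have "c s mod p = c s" "c' s mod p = c' s" if "s < k" for s
      using that PiE_mem[OF c, of s] PiE_mem[OF c', of s] by simp_all
    ultimately have "c s = c' s" if "s < k" for s using that by metis
    then show "c = c'" by (intro PiE_ext[OF c c']) simp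
  qed
  moreover have "\<phi> ` PiE {..<k} (\<lambda>_. ?P) \<subseteq> PiE {..<l} (\<lambda>_. ?P)"
  proof
    fix f assume "f \<in> \<phi> ` PiE {..<k} (\<lambda>_. ?P)"
    then obtain c where "f = \<phi> c" by blast
    then show "f \<in> PiE {..<l} (\<lambda>_. ?P)"
      using prime_gt_0_int[OF p] by (simp add: \<phi>_def restrict_PiE_iff)
  qed
  moreover have "finite (PiE {..<l} (\<lambda>_. ?P))" by (intro finite_PiE) auto
  ultimately have "card (PiE {..<k} (\<lambda>_. ?P)) \<le> card (PiE {..<l} (\<lambda>_. ?P))" by (rule card_inj_on_le)
  then have "nat p ^ k \<le> nat p ^ l" by (simp add: card_PiE)
  moreover have "1 < nat p" using prime_gt_1_int[OF p] by simp
  ultimately show ?thesis by (simp add: power_increasing_iff)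
qed

lemma ex_prime_not_dvd:
  assumes "(N::int) \<noteq> 0"
  obtains p where "prime (p::nat)" "\<not> int p dvd N"
proof -
  obtain p where p: "prime p" "nat \<bar>N\<bar> < p" using bigger_prime by blast
  then have "\<not> int p dvd N" using dvd_imp_le_int[OF assms, of "int p"] by auto
  then show ?thesis using that p(1) by blast
qed

text \<open>Lifting has one exceptional integer for all k, whereas reduction has one for each k.
  Since only k up to l occur, a finite product combines them.\<close>

lemma dim_crit_iff_prime:
  assumes "finite I"
  shows "\<exists>N\<noteq>0. \<forall>p k. prime p \<longrightarrow> \<not> p dvd N \<longrightarrow> (dim_crit p l \<alpha> I k \<longleftrightarrow> dim_crit 0 l \<alpha> I k)"
proof -
  obtain N0 where N0: "N0 \<noteq> 0"
      "\<And>p k. prime p \<Longrightarrow> \<not> p dvd N0 \<Longrightarrow> dim_crit p l \<alpha> I k \<Longrightarrow> dim_crit 0 l \<alpha> I k"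
    using dim_crit_from_prime[OF assms, of l \<alpha>] by blast
  have "\<forall>k. \<exists>N. N \<noteq> 0 \<and> (dim_crit 0 l \<alpha> I k \<longrightarrow> (\<forall>p. prime p \<longrightarrow> \<not> p dvd N \<longrightarrow> dim_crit p l \<alpha> I k))"
  proof
    fix k
    show "\<exists>N. N \<noteq> 0 \<and> (dim_crit 0 l \<alpha> I k \<longrightarrow> (\<forall>p. prime p \<longrightarrow> \<not> p dvd N \<longrightarrow> dim_crit p l \<alpha> I k))"
    proof (cases "dim_crit 0 l \<alpha> I k")
      case True
      then show ?thesis using dim_crit_mod_prime by blast
    qed (intro exI[of _ 1], simp)
  qed
  then have "\<exists>N. \<forall>k. N k \<noteq> 0 \<and> (dim_crit 0 l \<alpha> I k \<longrightarrow> (\<forall>p. prime p \<longrightarrow> \<not> p dvd N k \<longrightarrow> dim_crit p l \<alpha> I k))"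
    by (rule choice)
  then obtain N where N: "\<And>k. N k \<noteq> 0"
      "\<And>k p. dim_crit 0 l \<alpha> I k \<Longrightarrow> prime p \<Longrightarrow> \<not> p dvd N k \<Longrightarrow> dim_crit p l \<alpha> I k" by blast
  \<comment> \<open>The bound over the rationals is obtained by passing to a single prime at which
    the k vectors stay independent.\<close>
  have le: "k \<le> l" if k: "dim_crit 0 l \<alpha> I k" for k
  proof -
    obtain p where "prime (p::nat)" "\<not> int p dvd N k" using ex_prime_not_dvd[OF N(1)] by blast
    then show ?thesis using N(2)[OF k, of "int p"] dim_crit_prime_le[of "int p"] by simp
  qed
  have "dim_crit p l \<alpha> I k \<longleftrightarrow> dim_crit 0 l \<alpha> I k" if p: "prime p" "\<not> p dvd N0 * (\<Prod>k\<le>l. N k)" for p k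
  proof
    show "dim_crit 0 l \<alpha> I k" if "dim_crit p l \<alpha> I k" using N0(2) p that by (meson dvd_mult2)
    show "dim_crit p l \<alpha> I k" if k: "dim_crit 0 l \<alpha> I k"
    proof (rule N(2)[OF k p(1)])
      have "N k dvd (\<Prod>k\<le>l. N k)" using le[OF k] by (intro dvd_prodI) auto
      then show "\<not> p dvd N k" using p(2) by (meson dvd_mult dvd_trans)
    qed
  qed
  moreover have "N0 * (\<Prod>k\<le>l. N k) \<noteq> 0" using N0(1) N(1) by simp
  ultimately show ?thesis by blast
qed

section \<open>Dimensions over ring records\<close>

context field_record
begin

interpretation R: cring R by (rule cring)

lemma emb_vec_mem_hyperplane:
  assumes "\<forall>j\<ge>l. y j = 0"
  shows "(\<lambda>j. emb (y j)) \<in> hyperplane R l (\<lambda>j. emb (a j)) \<longleftrightarrow> (\<Sum>j<l. a j * y j) = 0"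
proof -
  have "(\<lambda>j. emb (y j)) = (\<lambda>j. emb (y' j)) \<longleftrightarrow> y = y'" for y'
    by (auto simp: fun_eq_iff emb_inject)
  then show ?thesis using assms unfolding hyperplane_emb by auto
qed

text \<open>The set on the left is the one maximised in \<open>sub_dim\<close>. Coordinates of
  vectors and coefficients of relations lie in the field, those of \<open>dim_crit\<close> are
  integers; a common denominator translates finitely many of them at a time.\<close>

lemma independent_cards_eq:
  assumes pf: "prime_field p TYPE('a)" and I: "I \<noteq> {}"
  shows "{card B | B. B \<subseteq> (\<Inter>i\<in>I. hyperplane R l (\<lambda>j. emb (of_int (\<alpha> i j)))) \<and> finite B \<and> lin_indep R B}
    = {k. dim_crit p l \<alpha> I k}" (is "?L = _")
proof (intro equalityI subsetI)
  note p = prime_field_of_int_eq_0_iff[OF pf]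
  have denom: "\<exists>N. (of_int N :: 'a) \<noteq> 0 \<and> (\<forall>x\<in>A. of_int N * x \<in> range of_int)" if "finite A" for A :: "'a set"
    by (rule prime_field_denominator[OF pf that])
  {
    fix k assume "k \<in> ?L"
    then obtain B where B: "k = card B" "B \<subseteq> (\<Inter>i\<in>I. hyperplane R l (\<lambda>j. emb (of_int (\<alpha> i j))))"
      "finite B" "lin_indep R B" by blast
    obtain v where v: "bij_betw v {..<k} B"
      using B(1,3) by (metis ex_bij_betw_nat_finite lessThan_atLeast0)
    have "\<exists>y. s < k \<longrightarrow> v s = (\<lambda>j. emb (y j)) \<and> (\<forall>j\<ge>l. y j = 0) \<and> (\<forall>i\<in>I. (\<Sum>j<l. of_int (\<alpha> i j) * y j) = 0)" for s
    proof (cases "s < k")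
      case True
      then have vs: "v s \<in> hyperplane R l (\<lambda>j. emb (of_int (\<alpha> i j)))" if "i \<in> I" for i
        using v B(2) that by (auto simp: bij_betw_def)
      \<comment> \<open>Membership in at least one hyperplane provides the zero entries from l on;
        an empty intersection of sets would give no such information.\<close>
      then obtain y where y: "v s = (\<lambda>j. emb (y j))" "\<forall>j\<ge>l. y j = 0"
        using I unfolding hyperplane_emb by blast
      then have "\<forall>i\<in>I. (\<Sum>j<l. of_int (\<alpha> i j) * y j) = 0"
        using vs emb_vec_mem_hyperplane[OF y(2)] by simp
      then show ?thesis using y by blast
    qed simp
    then have "\<exists>y. \<forall>s. s < k \<longrightarrow> v s = (\<lambda>j. emb (y s j)) \<and> (\<forall>j\<ge>l. y s j = 0) \<and>
        (\<forall>i\<in>I. (\<Sum>j<l. of_int (\<alpha> i j) * y s j) = 0)" by (intro choice) blast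
    then obtain y where y: "\<And>s. s < k \<Longrightarrow> v s = (\<lambda>j. emb (y s j))" "\<And>s j. s < k \<Longrightarrow> j \<ge> l \<Longrightarrow> y s j = 0"
        "\<And>s i. s < k \<Longrightarrow> i \<in> I \<Longrightarrow> (\<Sum>j<l. of_int (\<alpha> i j) * y s j) = 0" by blast
    have fin: "finite (\<Union>s<k. y s ` {..<l})" by simp
    obtain N where N: "(of_int N :: 'a) \<noteq> 0" "\<forall>x\<in>(\<Union>s<k. y s ` {..<l}). of_int N * x \<in> range of_int"
      using denom[OF fin] by (elim exE conjE) (rule that)
    have "\<exists>b. of_int N * x = (of_int b :: 'a)" if "x \<in> (\<Union>s<k. y s ` {..<l})" for x
      using bspec[OF N(2) that] by (rule rangeE) (rule exI)
    then have "\<forall>z. \<exists>b. fst z < k \<longrightarrow> snd z < l \<longrightarrow> of_int N * y (fst z) (snd z) = (of_int b :: 'a)" by blast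
    then have "\<exists>b. \<forall>z. fst z < k \<longrightarrow> snd z < l \<longrightarrow> of_int N * y (fst z) (snd z) = (of_int (b z) :: 'a)" by (rule choice)
    then obtain b0 where b0: "\<And>s j. s < k \<Longrightarrow> j < l \<Longrightarrow> of_int N * y s j = (of_int (b0 (s, j)) :: 'a)" by fastforce
    define b where "b s j = (if j < l then b0 (s, j) else 0)" for s j
    have b: "of_int (b s j) = of_int N * y s j" if "s < k" for s j
      using b0[OF that] y(2)[OF that] by (simp add: b_def)
    have "dim_crit p l \<alpha> I k" unfolding dim_crit_def
    proof (intro exI[of _ b] conjI allI ballI impI)
      show "b s j = 0" if "l \<le> j" for s j using that by (simp add: b_def)
      show "p dvd (\<Sum>j<l. \<alpha> i j * b s j)" if "i \<in> I" "s < k" for i s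
      proof -
        have "(of_int (\<Sum>j<l. \<alpha> i j * b s j) :: 'a) = of_int N * (\<Sum>j<l. of_int (\<alpha> i j) * y s j)"
          using that(2) by (simp add: b sum_distrib_left mult.left_commute)
        also have "\<dots> = 0" using y(3) that by simp
        finally show ?thesis by (rule iffD1[OF p])
      qed
      show "p dvd c s" if c: "\<forall>j<l. p dvd (\<Sum>s<k. c s * b s j)" and s: "s < k" for c s
      proof -
        have rel: "(\<Sum>s<k. of_int (c s) * y s j) = 0" for j
        proof (cases "j < l")
          case True
          have "of_int N * (\<Sum>s<k. of_int (c s) * y s j) = (\<Sum>s<k. of_int (c s) * (of_int N * y s j))"
            by (simp add: sum_distrib_left mult.left_commute)
          also have "\<dots> = of_int (\<Sum>s<k. c s * b s j)" by (simp add: b)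
          also have "\<dots> = 0" by (rule iffD2[OF p]) (use c True in blast)
          finally show ?thesis using N(1) by simp
        next
          case False
          then show ?thesis using y(2) by simp
        qed
        define c' where "c' x = emb (of_int (c (the_inv_into {..<k} v x)))" for x
        have inj: "inj_on v {..<k}" using v by (simp add: bij_betw_def)
        have c'_v: "c' (v s) = emb (of_int (c s))" if "s < k" for s
          using that by (simp add: c'_def the_inv_into_f_f[OF inj])
        have "finsum R (\<lambda>x. c' x \<otimes>\<^bsub>R\<^esub> x j) B = \<zero>\<^bsub>R\<^esub>" for j
        proof -
          have img: "B = v ` {..<k}" using v by (simp add: bij_betw_def)
          have "finsum R (\<lambda>x. c' x \<otimes>\<^bsub>R\<^esub> x j) B = finsum R (\<lambda>s. c' (v s) \<otimes>\<^bsub>R\<^esub> v s j) {..<k}"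
            unfolding img by (rule R.finsum_reindex[OF _ inj]) (auto simp: y(1) c'_def emb_carrier)
          also have "\<dots> = finsum R (\<lambda>s. emb (of_int (c s) * y s j)) {..<k}"
          proof (rule R.finsum_cong')
            fix s assume "s \<in> {..<k}"
            then have s: "s < k" by simp
            show "c' (v s) \<otimes>\<^bsub>R\<^esub> v s j = emb (of_int (c s) * y s j)"
              unfolding c'_v[OF s] emb_mult by (simp add: y(1)[OF s])
          qed (auto simp: emb_carrier)
          finally show ?thesis by (simp add: emb_sum rel emb_0)
        qed
        moreover have "c' x \<in> carrier R" for x by (simp add: c'_def emb_carrier)
        ultimately have "\<forall>x\<in>B. c' x = \<zero>\<^bsub>R\<^esub>" using B(4) unfolding lin_indep_def by blast
        then have "c' (v s) = \<zero>\<^bsub>R\<^esub>" using v s by (auto simp: bij_betw_def)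
        then show ?thesis using c'_v[OF s] p by (simp add: emb_eq_0_iff)
      qed
    qed
    then show "k \<in> {k. dim_crit p l \<alpha> I k}" by simp
  }
  {
    fix k assume "k \<in> {k. dim_crit p l \<alpha> I k}"
    then obtain b where b: "\<forall>s. \<forall>j\<ge>l. b s j = 0" "\<forall>i\<in>I. \<forall>s<k. p dvd (\<Sum>j<l. \<alpha> i j * b s j)"
      "\<forall>c. (\<forall>j<l. p dvd (\<Sum>s<k. c s * b s j)) \<longrightarrow> (\<forall>s<k. p dvd c s)"
      unfolding dim_crit_def by blast
    define v where "v s = (\<lambda>j. emb (of_int (b s j)))" for s
    \<comment> \<open>Two equal vectors would give a relation with coefficients 1 and -1, so the
      image really has k elements.\<close>
    have inj: "inj_on v {..<k}"
    proof (rule inj_onI, rule ccontr)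
      fix s t assume st: "s \<in> {..<k}" "t \<in> {..<k}" "v s = v t" "s \<noteq> t"
      define c where "c r = (if r = s then 1 else 0) + (if r = t then - 1 else 0 :: int)" for r
      have "p dvd (\<Sum>r<k. c r * b r j)" for j
      proof -
        have "(\<Sum>r<k. c r * b r j) = (\<Sum>r<k. (if r = s then b s j else 0) + (if r = t then - b t j else 0))"
          using st(4) by (intro sum.cong) (auto simp: c_def)
        also have "\<dots> = b s j - b t j" using st(1,2) by (simp add: sum.distrib)
        finally have "(of_int (\<Sum>r<k. c r * b r j) :: 'a) = of_int (b s j) - of_int (b t j)" by simp
        also have "\<dots> = 0" using fun_cong[OF st(3), of j] by (simp add: v_def emb_inject)
        finally show ?thesis by (rule iffD1[OF p])
      qed
      then have "p dvd c s" using b(3) st(1) by blast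
      then have "p dvd 1" using st(4) by (simp add: c_def)
      then have "(of_int 1 :: 'a) = 0" by (rule iffD2[OF p])
      then show False by simp
    qed
    have "v ` {..<k} \<subseteq> (\<Inter>i\<in>I. hyperplane R l (\<lambda>j. emb (of_int (\<alpha> i j))))"
    proof clarify
      fix s i assume si: "s < k" "i \<in> I"
      have "(\<Sum>j<l. of_int (\<alpha> i j) * of_int (b s j)) = (of_int (\<Sum>j<l. \<alpha> i j * b s j) :: 'a)" by simp
      also have "\<dots> = 0" by (rule iffD2[OF p]) (use b(2) si in blast)
      finally show "v s \<in> hyperplane R l (\<lambda>j. emb (of_int (\<alpha> i j)))"
        unfolding v_def using b(1) by (subst emb_vec_mem_hyperplane) auto
    qed
    moreover have "lin_indep R (v ` {..<k})"
      unfolding lin_indep_def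
    proof (intro allI impI ballI)
      fix c x assume c: "(\<forall>x\<in>v ` {..<k}. c x \<in> carrier R) \<and>
        (\<forall>j. finsum R (\<lambda>x. c x \<otimes>\<^bsub>R\<^esub> x j) (v ` {..<k}) = \<zero>\<^bsub>R\<^esub>)" and x: "x \<in> v ` {..<k}"
      have "\<forall>s. \<exists>y. s < k \<longrightarrow> c (v s) = emb y" using c emb_onto by blast
      then have "\<exists>y. \<forall>s<k. c (v s) = emb (y s)" by (rule choice)
      then obtain y where y: "\<And>s. s < k \<Longrightarrow> c (v s) = emb (y s)" by blast
      have rel: "(\<Sum>s<k. y s * of_int (b s j)) = 0" for j
      proof -
        have "finsum R (\<lambda>x. c x \<otimes>\<^bsub>R\<^esub> x j) (v ` {..<k}) = finsum R (\<lambda>s. c (v s) \<otimes>\<^bsub>R\<^esub> v s j) {..<k}"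
          by (rule R.finsum_reindex[OF _ inj]) (auto simp: v_def y emb_carrier c)
        also have "\<dots> = finsum R (\<lambda>s. emb (y s * of_int (b s j))) {..<k}"
        proof (rule R.finsum_cong')
          fix s assume "s \<in> {..<k}"
          then show "c (v s) \<otimes>\<^bsub>R\<^esub> v s j = emb (y s * of_int (b s j))"
            using y[of s] unfolding emb_mult by (simp add: v_def)
        qed (auto simp: emb_carrier)
        finally have "emb (\<Sum>s<k. y s * of_int (b s j)) = \<zero>\<^bsub>R\<^esub>" using c by (simp add: emb_sum)
        then show ?thesis by (simp add: emb_eq_0_iff)
      qed
      \<comment> \<open>The relation has coefficients y in the field, while independence of b is
        known for integers only, so its denominators are cleared.\<close>
      obtain N where N: "(of_int N :: 'a) \<noteq> 0" "\<forall>x\<in>y ` {..<k}. of_int N * x \<in> range of_int"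
        using denom[of "y ` {..<k}", OF finite_imageI[OF finite_lessThan]] by (elim exE conjE) (rule that)
      have "\<exists>e. of_int N * y s = (of_int e :: 'a)" if "s < k" for s
        using bspec[OF N(2) imageI, of s] that by (auto elim!: rangeE)
      then have "\<forall>s. \<exists>e. s < k \<longrightarrow> of_int N * y s = (of_int e :: 'a)" by blast
      then have "\<exists>e. \<forall>s<k. of_int N * y s = (of_int (e s) :: 'a)" by (rule choice)
      then obtain e where e: "\<And>s. s < k \<Longrightarrow> of_int N * y s = (of_int (e s) :: 'a)" by blast
      have "p dvd (\<Sum>s<k. e s * b s j)" for j
      proof -
        have "(of_int (\<Sum>s<k. e s * b s j) :: 'a) = (\<Sum>s<k. of_int N * y s * of_int (b s j))"
          by (simp add: e)
        also have "\<dots> = of_int N * (\<Sum>s<k. y s * of_int (b s j))"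
          by (simp add: sum_distrib_left mult.assoc)
        also have "\<dots> = 0" by (simp add: rel)
        finally show ?thesis by (rule iffD1[OF p])
      qed
      then have e_dvd: "p dvd e s" if "s < k" for s using b(3) that by blast
      have "(of_int (e s) :: 'a) = 0" if "s < k" for s by (rule iffD2[OF p e_dvd[OF that]])
      then have "y s = 0" if "s < k" for s using e[OF that] N(1) that by simp
      then show "c x = \<zero>\<^bsub>R\<^esub>" using x y by (auto simp: emb_0)
    qed
    moreover have "card (v ` {..<k}) = k" using card_image[OF inj] by simp
    ultimately show "k \<in> ?L" by (intro CollectI exI[of _ "v ` {..<k}"]) simp
  }
qed

end

section \<open>Reduction modulo a variable prime\<close>

text \<open>To speak about \<open>\<int>/p\<int>\<close> as a type for a bound variable \<open>p\<close>, a property of primes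
  is proved for one prime that violates it if any prime does; this prime is a constant, so it
  can serve as the size of a type.\<close>

definition fp_crit :: "int \<Rightarrow> bool" where
  "fp_crit p \<longleftrightarrow>
     (\<forall>l n \<alpha>. central_arrangement (residue_ring p) l n (\<lambda>i j. \<alpha> i j mod p) \<longrightarrow>
       (free_arrangement (residue_ring p) l n (\<lambda>i j. \<alpha> i j mod p) \<longleftrightarrow> crit p l n \<alpha>)) \<and>
     (\<forall>l \<alpha> I. I \<noteq> {} \<longrightarrow> {card B | B. B \<subseteq> (\<Inter>i\<in>I. hyperplane (residue_ring p) l (\<lambda>j. \<alpha> i j mod p)) \<and>
       finite B \<and> lin_indep (residue_ring p) B} = {k. dim_crit p l \<alpha> I k}) \<and>
     (\<forall>l a y. (\<forall>j\<ge>l. y j = 0) \<longrightarrow> ((\<lambda>j. y j mod p) \<in> hyperplane (residue_ring p) l (\<lambda>j. a j mod p) \<longleftrightarrow>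
       p dvd (\<Sum>j<l. a j * y j)))"

text \<open>The default 2 keeps the constant prime if no prime violates \<open>fp_crit\<close>, as
  the class instance for the index type requires.\<close>

definition bad_prime :: nat where
  "bad_prime = (if \<exists>p. prime p \<and> \<not> fp_crit (int p) then SOME p. prime p \<and> \<not> fp_crit (int p) else 2)"

lemma prime_bad_prime: "prime bad_prime"
  unfolding bad_prime_def by (smt (verit) someI_ex two_is_prime_nat)

lemma fp_crit_if_bad_prime: "fp_crit (int bad_prime) \<Longrightarrow> prime p \<Longrightarrow> fp_crit (int p)"
  unfolding bad_prime_def by (smt (verit) someI_ex)

typedef bad_index = "{0..<bad_prime}"
  using prime_gt_0_nat[OF prime_bad_prime] by auto

lemma card_bad_index: "CARD(bad_index) = bad_prime"
  using type_definition.card[OF type_definition_bad_index] by simp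

instance bad_index :: prime_card
  by standard (simp add: card_bad_index prime_bad_prime)

type_synonym fp = "bad_index mod_ring"

lemma of_int_fp: "to_int_mod_ring (of_int x :: fp) = x mod int bad_prime"
  unfolding of_int_of_int_mod_ring by transfer (simp add: card_bad_index)

lemma of_int_to_int_fp: "of_int (to_int_mod_ring (x :: fp)) = x"
  by (simp add: of_int_of_int_mod_ring)

lemma prime_field_fp: "prime_field (int bad_prime) TYPE(fp)"
proof -
  have "(of_int x :: fp) = 0 \<longleftrightarrow> int bad_prime dvd x" for x
  proof -
    have "(of_int x :: fp) = 0 \<longleftrightarrow> to_int_mod_ring (of_int x :: fp) = 0"
      by (metis of_int_0 of_int_fp of_int_to_int_fp mod_0)
    then show ?thesis by (simp add: of_int_fp dvd_eq_mod_eq_0)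
  qed
  \<comment> \<open>Every element is the image of an integer, so the denominator 1 serves every
    finite set.\<close>
  moreover have "x \<in> range of_int" for x :: fp by (metis of_int_to_int_fp rangeI)
  ultimately show ?thesis unfolding prime_field_def
    by (metis mult_1 of_int_1 one_neq_zero)
qed

lemma field_record_fp: "field_record (residue_ring (int bad_prime)) (to_int_mod_ring :: fp \<Rightarrow> int)"
proof (rule field_record.intro)
  interpret residues "int bad_prime" "residue_ring (int bad_prime)"
    using prime_gt_1_nat[OF prime_bad_prime] by unfold_locales simp_all
  show "cring (residue_ring (int bad_prime))" by (rule cring)
  have "range (to_int_mod_ring :: fp \<Rightarrow> int) = carrier (residue_ring (int bad_prime))"
    unfolding range_to_int_mod_ring card_bad_index by (auto simp: residue_ring_def)
  moreover have "inj (to_int_mod_ring :: fp \<Rightarrow> int)" by (metis injI of_int_to_int_fp)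
  ultimately show "bij_betw (to_int_mod_ring :: fp \<Rightarrow> int) UNIV (carrier (residue_ring (int bad_prime)))"
    by (simp add: bij_betw_def)
  show "to_int_mod_ring (0 :: fp) = \<zero>\<^bsub>residue_ring (int bad_prime)\<^esub>" by (simp add: residue_ring_def)
  show "to_int_mod_ring (x + y) = to_int_mod_ring x \<oplus>\<^bsub>residue_ring (int bad_prime)\<^esub> to_int_mod_ring y" for x y :: fp
    unfolding residue_ring_def ring_record_simps by transfer (simp add: card_bad_index)
  show "to_int_mod_ring (x * y) = to_int_mod_ring x \<otimes>\<^bsub>residue_ring (int bad_prime)\<^esub> to_int_mod_ring y" for x y :: fp
    unfolding residue_ring_def monoid.simps by transfer (simp add: card_bad_index)
qed

lemma fp_crit_prime:
  assumes "prime (p::nat)"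
  shows "fp_crit (int p)"
proof -
  interpret F: field_record "residue_ring (int bad_prime)" "to_int_mod_ring :: fp \<Rightarrow> int"
    by (rule field_record_fp)
  have "fp_crit (int bad_prime)"
    \<comment> \<open>Reading a residue as the embedding of \<open>of_int x\<close> turns each
      clause into a general result about \<open>field_record\<close>.\<close>
    unfolding fp_crit_def of_int_fp[symmetric]
  proof (intro conjI allI impI)
    fix l n \<alpha>
    assume "central_arrangement (residue_ring (int bad_prime)) l n (\<lambda>i j. to_int_mod_ring (of_int (\<alpha> i j) :: fp))"
    from F.free_arrangement_iff[OF this]
    show "free_arrangement (residue_ring (int bad_prime)) l n (\<lambda>i j. to_int_mod_ring (of_int (\<alpha> i j) :: fp)) \<longleftrightarrow>
        crit (int bad_prime) l n \<alpha>"
      unfolding saito_iff_crit[OF prime_field_fp] .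
  next
    fix l \<alpha> and I :: "nat set" assume "I \<noteq> {}"
    then show "{card B | B. B \<subseteq> (\<Inter>i\<in>I. hyperplane (residue_ring (int bad_prime)) l
        (\<lambda>j. to_int_mod_ring (of_int (\<alpha> i j) :: fp))) \<and>
       finite B \<and> lin_indep (residue_ring (int bad_prime)) B} = {k. dim_crit (int bad_prime) l \<alpha> I k}"
      by (rule F.independent_cards_eq[OF prime_field_fp])
  next
    fix l :: nat and a y :: "nat \<Rightarrow> int" assume y: "\<forall>j\<ge>l. y j = 0"
    have "(\<lambda>j. to_int_mod_ring (of_int (y j) :: fp)) \<in> hyperplane (residue_ring (int bad_prime)) l
        (\<lambda>j. to_int_mod_ring (of_int (a j) :: fp)) \<longleftrightarrow> (\<Sum>j<l. of_int (a j) * (of_int (y j) :: fp)) = 0"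
      using y by (intro F.emb_vec_mem_hyperplane) simp
    also have "(\<Sum>j<l. of_int (a j) * (of_int (y j) :: fp)) = of_int (\<Sum>j<l. a j * y j)" by simp
    also have "(of_int (\<Sum>j<l. a j * y j) :: fp) = 0 \<longleftrightarrow> int bad_prime dvd (\<Sum>j<l. a j * y j)"
      by (rule prime_field_of_int_eq_0_iff[OF prime_field_fp])
    finally show "(\<lambda>j. to_int_mod_ring (of_int (y j) :: fp)) \<in> hyperplane (residue_ring (int bad_prime)) l
        (\<lambda>j. to_int_mod_ring (of_int (a j) :: fp)) \<longleftrightarrow> int bad_prime dvd (\<Sum>j<l. a j * y j)" .
  qed
  then show ?thesis using assms fp_crit_if_bad_prime by blast
qed

section \<open>Freeness and dimension as integer conditions\<close>

lemma free_residue_ring_iff: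
  assumes "prime (p::nat)" "central_arrangement (residue_ring (int p)) l n (\<lambda>i j. \<alpha> i j mod int p)"
  shows "free_arrangement (residue_ring (int p)) l n (\<lambda>i j. \<alpha> i j mod int p) \<longleftrightarrow> crit (int p) l n \<alpha>"
  by (rule fp_crit_prime[OF assms(1), unfolded fp_crit_def, THEN conjunct1,
        THEN spec, THEN spec, THEN spec, THEN mp, OF assms(2)])

lemma sub_dim_residue_ring:
  assumes "prime (p::nat)" "I \<noteq> {}"
  shows "sub_dim (residue_ring (int p)) (\<Inter>i\<in>I. hyperplane (residue_ring (int p)) l (\<lambda>j. \<alpha> i j mod int p))
    = Max {k. dim_crit (int p) l \<alpha> I k}"
  unfolding sub_dim_def
  by (rule arg_cong[where f = Max, OF fp_crit_prime[OF assms(1), unfolded fp_crit_def, THEN conjunct2,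
        THEN conjunct1, THEN spec, THEN spec, THEN spec, THEN mp, OF assms(2)]])

lemma mem_hyperplane_residue_ring:
  assumes "prime (p::nat)" "\<forall>j\<ge>l. y j = 0"
  shows "(\<lambda>j. y j mod int p) \<in> hyperplane (residue_ring (int p)) l (\<lambda>j. a j mod int p) \<longleftrightarrow>
    int p dvd (\<Sum>j<l. a j * y j)"
  by (rule fp_crit_prime[OF assms(1), unfolded fp_crit_def, THEN conjunct2, THEN conjunct2,
        THEN spec, THEN spec, THEN spec, THEN mp, OF assms(2)])

interpretation rat: field_record rat_field "\<lambda>x. x"
  by (rule field_record_rat)

lemma free_rat_field_iff:
  assumes "central_arrangement rat_field l n (\<lambda>i j. of_int (\<alpha> i j))"
  shows "free_arrangement rat_field l n (\<lambda>i j. of_int (\<alpha> i j)) \<longleftrightarrow> crit 0 l n \<alpha>"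
  using rat.free_arrangement_iff[OF assms] unfolding saito_iff_crit[OF prime_field_rat] .

lemma sub_dim_rat_field:
  assumes "I \<noteq> {}"
  shows "sub_dim rat_field (\<Inter>i\<in>I. hyperplane rat_field l (\<lambda>j. of_int (\<alpha> i j))) = Max {k. dim_crit 0 l \<alpha> I k}"
  unfolding sub_dim_def rat.independent_cards_eq[OF prime_field_rat assms] ..

section \<open>Good reduction\<close>

text \<open>For each index set the same k are realised over the rationals and modulo p, outside the
  divisors of one integer. The product over all subsets and both arrangements covers every
  intersection at once.\<close>

lemma comb_equivalent_mod_prime:
  assumes "comb_equivalent rat_field rat_field l n (\<lambda>i j. of_int (\<alpha> i j)) (\<lambda>i j. of_int (\<beta> i j))"
  shows "\<exists>N\<noteq>0. \<forall>p::nat. prime p \<longrightarrow> \<not> int p dvd N \<longrightarrow>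
    comb_equivalent (residue_ring (int p)) (residue_ring (int p)) l n (\<lambda>i j. \<alpha> i j mod int p) (\<lambda>i j. \<beta> i j mod int p)"
proof -
  have "\<forall>I. \<exists>N. finite I \<longrightarrow> N \<noteq> 0 \<and>
      (\<forall>p k. prime p \<longrightarrow> \<not> p dvd N \<longrightarrow> (dim_crit p l \<gamma> I k \<longleftrightarrow> dim_crit 0 l \<gamma> I k))" for \<gamma>
    using dim_crit_iff_prime by blast
  then have ex: "\<exists>N. \<forall>I. finite I \<longrightarrow> N I \<noteq> 0 \<and>
      (\<forall>p k. prime p \<longrightarrow> \<not> p dvd N I \<longrightarrow> (dim_crit p l \<gamma> I k \<longleftrightarrow> dim_crit 0 l \<gamma> I k))" for \<gamma>
    by (rule choice)
  obtain Na where Na: "\<forall>I. finite I \<longrightarrow> Na I \<noteq> 0 \<and>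
      (\<forall>p k. prime p \<longrightarrow> \<not> p dvd Na I \<longrightarrow> (dim_crit p l \<alpha> I k \<longleftrightarrow> dim_crit 0 l \<alpha> I k))"
    using ex[of \<alpha>] by (rule exE)
  obtain Nb where Nb: "\<forall>I. finite I \<longrightarrow> Nb I \<noteq> 0 \<and>
      (\<forall>p k. prime p \<longrightarrow> \<not> p dvd Nb I \<longrightarrow> (dim_crit p l \<beta> I k \<longleftrightarrow> dim_crit 0 l \<beta> I k))"
    using ex[of \<beta>] by (rule exE)
  define N where "N = (\<Prod>I\<in>Pow {..<n}. Na I * Nb I)"
  have "Na I * Nb I \<noteq> 0" if "I \<in> Pow {..<n}" for I
  proof -
    have "finite I" using that by (auto intro: finite_subset)
    then show ?thesis using Na Nb by simp
  qed
  then have "N \<noteq> 0" by (simp add: N_def del: mult_eq_0_iff)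
  moreover have "comb_equivalent (residue_ring (int p)) (residue_ring (int p)) l n
      (\<lambda>i j. \<alpha> i j mod int p) (\<lambda>i j. \<beta> i j mod int p)" if p: "prime p" "\<not> int p dvd N" for p :: nat
    unfolding comb_equivalent_def
  proof (intro allI impI)
    fix I assume I: "I \<subseteq> {..<n} \<and> I \<noteq> {}"
    then have fin: "finite I" by (auto intro: finite_subset)
    have "Na I * Nb I dvd N" unfolding N_def using I by (intro dvd_prodI) auto
    then have "\<not> int p dvd Na I" "\<not> int p dvd Nb I" using p(2) by (meson dvd_mult2 dvd_mult dvd_trans)+
    then have eq: "dim_crit (int p) l \<alpha> I k \<longleftrightarrow> dim_crit 0 l \<alpha> I k"
        "dim_crit (int p) l \<beta> I k \<longleftrightarrow> dim_crit 0 l \<beta> I k" for k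
      using Na[rule_format, OF fin] Nb[rule_format, OF fin] p(1) by simp_all
    have "sub_dim rat_field (\<Inter>i\<in>I. hyperplane rat_field l (\<lambda>j. of_int (\<alpha> i j)))
        = sub_dim rat_field (\<Inter>i\<in>I. hyperplane rat_field l (\<lambda>j. of_int (\<beta> i j)))"
      using assms I unfolding comb_equivalent_def by blast
    then show "sub_dim (residue_ring (int p)) (\<Inter>i\<in>I. hyperplane (residue_ring (int p)) l (\<lambda>j. \<alpha> i j mod int p))
        = sub_dim (residue_ring (int p)) (\<Inter>i\<in>I. hyperplane (residue_ring (int p)) l (\<lambda>j. \<beta> i j mod int p))"
      using I p(1) by (simp add: sub_dim_residue_ring sub_dim_rat_field eq)
  qed
  ultimately show ?thesis by blast
qed

lemma integer_multiple:
  fixes y :: "nat \<Rightarrow> rat"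
  assumes "\<forall>j\<ge>l. y j = 0"
  obtains N z where "N \<noteq> 0" "\<And>j. of_int (z j) = of_int N * y j" "\<forall>j\<ge>l. z j = (0::int)"
proof -
  obtain N :: int where N: "N \<noteq> 0" "\<forall>x\<in>y ` {..<l}. of_int N * x \<in> range of_int"
    using common_denominator[of "y ` {..<l}"] by auto
  have "\<exists>z::int. of_int z = of_int N * y j \<and> (j \<ge> l \<longrightarrow> z = 0)" for j
  proof (cases "j < l")
    case True
    then have "of_int N * y j \<in> range of_int" using N(2) by blast
    then show ?thesis using True by (auto elim!: rangeE)
  next
    case False
    then show ?thesis using assms by (intro exI[of _ 0]) simp
  qed
  then have "\<exists>z. \<forall>j. of_int (z j :: int) = of_int N * y j \<and> (j \<ge> l \<longrightarrow> z j = 0)"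
    by (intro choice) blast
  then obtain z where "\<And>j. of_int (z j :: int) = of_int N * y j \<and> (j \<ge> l \<longrightarrow> z j = 0)" by blast
  then show ?thesis using that[of N z] N(1) by blast
qed

lemma central_arrangement_mod_prime:
  assumes "central_arrangement rat_field l n (\<lambda>i j. of_int (\<alpha> i j))"
  shows "\<exists>N\<noteq>0. \<forall>p::nat. prime p \<longrightarrow> \<not> int p dvd N \<longrightarrow>
    central_arrangement (residue_ring (int p)) l n (\<lambda>i j. \<alpha> i j mod int p)"
proof -
  interpret arrangement l n "\<lambda>i j. of_int (\<alpha> i j) :: rat"
    by (rule rat.arrangement_if_central[OF assms])
  have zero: "\<alpha> i j = 0" if "i < n" "j \<ge> l" for i j
  proof -
    have "(\<lambda>j. of_int (\<alpha> i j)) \<in> kspace rat_field l" using assms that(1) by (simp add: central_arrangement_def)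
    then show ?thesis using that(2) by (simp add: kspace_def rat_field_def)
  qed
  \<comment> \<open>A nonzero coefficient of each form; a prime that does not divide it leaves the
    form nonzero.\<close>
  have "\<forall>i. \<exists>N. i < n \<longrightarrow> N \<noteq> 0 \<and> (\<exists>k<l. N = \<alpha> i k)" using nonzero by fastforce
  then have "\<exists>N. \<forall>i<n. N i \<noteq> 0 \<and> (\<exists>k<l. N i = \<alpha> i k)" by (rule choice)
  then obtain Na where Na: "\<And>i. i < n \<Longrightarrow> Na i \<noteq> 0" "\<And>i. i < n \<Longrightarrow> \<exists>k<l. Na i = \<alpha> i k" by blast
  \<comment> \<open>An integer vector on exactly one of the two hyperplanes, to be kept as a witness
    of distinctness modulo p.\<close>
  have "\<exists>z. (\<forall>j\<ge>l. z j = 0) \<and> (((\<Sum>j<l. \<alpha> i j * z j) = 0) \<noteq> ((\<Sum>j<l. \<alpha> i' j * z j) = 0))"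
    if "i < n" "i' < n" "i \<noteq> i'" for i i'
  proof -
    have "hyperplane rat_field l (\<lambda>j. of_int (\<alpha> i j)) \<noteq> hyperplane rat_field l (\<lambda>j. of_int (\<alpha> i' j))"
      using assms that unfolding central_arrangement_def by blast
    then obtain y :: "nat \<Rightarrow> rat" where y: "\<forall>j\<ge>l. y j = 0"
      "((\<Sum>j<l. of_int (\<alpha> i j) * y j) = 0) \<noteq> ((\<Sum>j<l. of_int (\<alpha> i' j) * y j) = 0)"
      unfolding rat.hyperplane_emb by blast
    obtain N z where z: "N \<noteq> 0" "\<And>j. of_int (z j) = of_int N * y j" "\<forall>j\<ge>l. z j = (0::int)"
      using integer_multiple[OF y(1)] by blast
    have "(\<Sum>j<l. \<alpha> r j * z j) = 0 \<longleftrightarrow> (\<Sum>j<l. of_int (\<alpha> r j) * y j) = 0" for r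
    proof -
      have eq: "(of_int (\<Sum>j<l. \<alpha> r j * z j) :: rat) = of_int N * (\<Sum>j<l. of_int (\<alpha> r j) * y j)"
        by (simp add: z(2) sum_distrib_left mult.left_commute)
      have "(\<Sum>j<l. \<alpha> r j * z j) = 0 \<longleftrightarrow> (of_int (\<Sum>j<l. \<alpha> r j * z j) :: rat) = 0"
        by (simp only: of_int_eq_0_iff)
      also have "\<dots> \<longleftrightarrow> (\<Sum>j<l. of_int (\<alpha> r j) * y j) = 0" unfolding eq using z(1) by simp
      finally show ?thesis .
    qed
    then show ?thesis using y(2) z(3) by (intro exI[of _ z]) simp
  qed
  then have "\<forall>x. \<exists>z. fst x < n \<longrightarrow> snd x < n \<longrightarrow> fst x \<noteq> snd x \<longrightarrow> (\<forall>j\<ge>l. z j = 0) \<and>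
      (((\<Sum>j<l. \<alpha> (fst x) j * z j) = 0) \<noteq> ((\<Sum>j<l. \<alpha> (snd x) j * z j) = 0))" by blast
  then have "\<exists>z. \<forall>x. fst x < n \<longrightarrow> snd x < n \<longrightarrow> fst x \<noteq> snd x \<longrightarrow> (\<forall>j\<ge>l. z x j = 0) \<and>
      (((\<Sum>j<l. \<alpha> (fst x) j * z x j) = 0) \<noteq> ((\<Sum>j<l. \<alpha> (snd x) j * z x j) = 0))" by (rule choice)
  then obtain z where z: "\<And>x. fst x < n \<Longrightarrow> snd x < n \<Longrightarrow> fst x \<noteq> snd x \<Longrightarrow> (\<forall>j\<ge>l. z x j = 0) \<and>
      (((\<Sum>j<l. \<alpha> (fst x) j * z x j) = 0) \<noteq> ((\<Sum>j<l. \<alpha> (snd x) j * z x j) = 0))" by blast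
  \<comment> \<open>Exactly one of the two values is 0, so the sum is the nonzero one, whichever it
    is. If p does not divide it, the residues of z still separate the two hyperplanes.\<close>
  define c where "c x = (\<Sum>j<l. \<alpha> (fst x) j * z x j) + (\<Sum>j<l. \<alpha> (snd x) j * z x j)" for x
  define X where "X = {x \<in> {..<n} \<times> {..<n}. fst x \<noteq> snd x}"
  define N where "N = (\<Prod>i<n. Na i) * (\<Prod>x\<in>X. c x)"
  have fin_X: "finite X" by (simp add: X_def)
  have "c x \<noteq> 0" if "x \<in> X" for x using z[of x] that by (auto simp: X_def c_def)
  then have "N \<noteq> 0" using Na(1) fin_X by (simp add: N_def)
  moreover have "central_arrangement (residue_ring (int p)) l n (\<lambda>i j. \<alpha> i j mod int p)"
    if p: "prime p" "\<not> int p dvd N" for p :: nat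
    unfolding central_arrangement_def
  proof (intro conjI allI impI)
    fix i assume i: "i < n"
    show "(\<lambda>j. \<alpha> i j mod int p) \<in> kspace (residue_ring (int p)) l"
      using zero[OF i] prime_gt_0_nat[OF p(1)] by (auto simp: kspace_def residue_ring_def)
    obtain k where k: "Na i = \<alpha> i k" using Na(2)[OF i] by blast
    have "Na i dvd (\<Prod>i<n. Na i)" using i by (intro dvd_prodI) auto
    then have "\<not> int p dvd \<alpha> i k" using p(2) unfolding N_def k by (meson dvd_mult2 dvd_trans)
    then have "\<alpha> i k mod int p \<noteq> 0" by (simp add: dvd_eq_mod_eq_0)
    then show "(\<lambda>j. \<alpha> i j mod int p) \<noteq> (\<lambda>_. \<zero>\<^bsub>residue_ring (int p)\<^esub>)"
      by (auto simp: residue_ring_def fun_eq_iff)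
  next
    fix i i' assume ii: "i < n" "i' < n" "i \<noteq> i'"
    let ?x = "(i, i')"
    have x: "?x \<in> X" using ii by (simp add: X_def)
    have zx: "\<forall>j\<ge>l. z ?x j = 0"
        "((\<Sum>j<l. \<alpha> i j * z ?x j) = 0) \<noteq> ((\<Sum>j<l. \<alpha> i' j * z ?x j) = 0)"
      using z[of ?x] ii by simp_all
    have "c ?x dvd (\<Prod>x\<in>X. c x)" using x fin_X by (intro dvd_prodI)
    then have "\<not> int p dvd c ?x" using p(2) unfolding N_def by (meson dvd_mult dvd_trans)
    then have "(int p dvd (\<Sum>j<l. \<alpha> i j * z ?x j)) \<noteq> (int p dvd (\<Sum>j<l. \<alpha> i' j * z ?x j))"
      using zx(2) by (auto simp: c_def)
    then show "hyperplane (residue_ring (int p)) l (\<lambda>j. \<alpha> i j mod int p)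
        \<noteq> hyperplane (residue_ring (int p)) l (\<lambda>j. \<alpha> i' j mod int p)"
      unfolding mem_hyperplane_residue_ring[OF p(1) zx(1), symmetric] by blast
  qed
  ultimately show ?thesis by blast
qed

text \<open>Clearing the denominators of a form multiplies it by a nonzero scalar, which changes
  neither its hyperplane nor the ideal that it generates, and so none of the logarithmic
  derivations.\<close>

lemma integral_arrangement:
  assumes "central_arrangement rat_field l n \<alpha>"
  shows "\<exists>\<alpha>'. (\<forall>i<n. hyperplane rat_field l (\<lambda>j. of_int (\<alpha>' i j)) = hyperplane rat_field l (\<alpha> i)) \<and>
    central_arrangement rat_field l n (\<lambda>i j. of_int (\<alpha>' i j)) \<and>
    (free_arrangement rat_field l n (\<lambda>i j. of_int (\<alpha>' i j)) \<longleftrightarrow> free_arrangement rat_field l n \<alpha>)"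
proof -
  have zero: "\<forall>j\<ge>l. \<alpha> i j = 0" "\<alpha> i \<noteq> (\<lambda>_. 0)" if "i < n" for i
    using assms that by (auto simp: central_arrangement_def kspace_def rat_field_def)
  have "\<exists>z N. i < n \<longrightarrow> N \<noteq> 0 \<and> (\<forall>j. of_int (z j :: int) = of_int N * \<alpha> i j)" for i
    using integer_multiple[of l "\<alpha> i"] zero(1)[of i] by metis
  then have "\<exists>z. \<forall>i. \<exists>N. i < n \<longrightarrow> N \<noteq> 0 \<and> (\<forall>j. of_int (z i j :: int) = of_int N * \<alpha> i j)"
    by (intro choice) blast
  then obtain \<alpha>' :: "nat \<Rightarrow> nat \<Rightarrow> int" where
    \<alpha>': "\<And>i. i < n \<Longrightarrow> \<exists>N. N \<noteq> 0 \<and> (\<forall>j. of_int (\<alpha>' i j) = of_int N * \<alpha> i j)" by blast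
  have scale: "\<exists>N. N \<noteq> 0 \<and> (\<lambda>j. of_int (\<alpha>' i j)) = (\<lambda>j. N * \<alpha> i j)" if "i < n" for i
    using \<alpha>'[OF that] of_int_eq_0_iff by (metis (no_types, lifting) ext)
  have hyp: "hyperplane rat_field l (\<lambda>j. of_int (\<alpha>' i j)) = hyperplane rat_field l (\<alpha> i)" if i: "i < n" for i
  proof -
    obtain N where N: "N \<noteq> 0" "(\<lambda>j. of_int (\<alpha>' i j)) = (\<lambda>j. N * \<alpha> i j)" using scale[OF i] by blast
    have "(\<Sum>j<l. N * \<alpha> i j * y j) = N * (\<Sum>j<l. \<alpha> i j * y j)" for y
      by (simp add: sum_distrib_left mult.assoc)
    then show ?thesis unfolding N(2) rat.hyperplane_emb using N(1) by simp
  qed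
  have central: "central_arrangement rat_field l n (\<lambda>i j. of_int (\<alpha>' i j))"
    unfolding central_arrangement_def
  proof (intro conjI allI impI)
    fix i assume i: "i < n"
    obtain N where N: "N \<noteq> 0" "(\<lambda>j. of_int (\<alpha>' i j)) = (\<lambda>j. N * \<alpha> i j)" using scale[OF i] by blast
    show "(\<lambda>j. of_int (\<alpha>' i j)) \<in> kspace rat_field l" "(\<lambda>j. of_int (\<alpha>' i j)) \<noteq> (\<lambda>_. \<zero>\<^bsub>rat_field\<^esub>)"
      using zero[OF i] N(1) unfolding N(2) by (auto simp: kspace_def rat_field_def fun_eq_iff)
  next
    fix i j assume "i < n" "j < n" "i \<noteq> j"
    then show "hyperplane rat_field l (\<lambda>k. of_int (\<alpha>' i k)) \<noteq> hyperplane rat_field l (\<lambda>k. of_int (\<alpha>' j k))"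
      using assms by (simp add: hyp central_arrangement_def)
  qed
  have "lform l (\<lambda>j. of_int (\<alpha>' i j)) dvd apply_lform l (\<lambda>j. of_int (\<alpha>' i j)) \<theta> \<longleftrightarrow>
      lform l (\<alpha> i) dvd apply_lform l (\<alpha> i) \<theta>" if i: "i < n" for i \<theta>
  proof -
    obtain N where N: "N \<noteq> 0" "(\<lambda>j. of_int (\<alpha>' i j)) = (\<lambda>j. N * \<alpha> i j)" using scale[OF i] by blast
    have "apply_lform l (\<lambda>j. N * \<alpha> i j) \<theta> = cst N * apply_lform l (\<alpha> i) \<theta>"
      by (simp add: apply_lform_def cst_mult sum_distrib_left mult.assoc)
    then show ?thesis unfolding N(2) using N(1) by (simp add: lform_scale)
  qed
  then have "logder l n (\<lambda>i j. of_int (\<alpha>' i j)) = logder l n \<alpha>" by (simp add: logder_def)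
  then have "free_arrangement rat_field l n (\<lambda>i j. of_int (\<alpha>' i j)) \<longleftrightarrow> free_arrangement rat_field l n \<alpha>"
    using rat.free_arrangement_iff[OF central] rat.free_arrangement_iff[OF assms] by simp
  then show ?thesis using hyp central by blast
qed

text \<open>One implication is enough, combinatorial equivalence being symmetric. The exceptional
  integer for lifting from p depends on b alone, so the prime can be fixed before anything is known
  about freeness of b modulo p.\<close>

lemma free_arrangement_transfer:
  assumes terao: "\<forall>p::int. prime p \<longrightarrow> terao_conjecture_over (residue_ring p)" and l: "l \<ge> 1"
    and central: "central_arrangement rat_field l n \<alpha>" "central_arrangement rat_field l n \<beta>"
    and equiv: "comb_equivalent rat_field rat_field l n \<alpha> \<beta>" and free: "free_arrangement rat_field l n \<alpha>"
  shows "free_arrangement rat_field l n \<beta>"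
proof -
  obtain a where a: "\<forall>i<n. hyperplane rat_field l (\<lambda>j. of_int (a i j)) = hyperplane rat_field l (\<alpha> i)"
    "central_arrangement rat_field l n (\<lambda>i j. of_int (a i j))"
    "free_arrangement rat_field l n (\<lambda>i j. of_int (a i j)) \<longleftrightarrow> free_arrangement rat_field l n \<alpha>"
    using integral_arrangement[OF central(1)] by blast
  obtain b where b: "\<forall>i<n. hyperplane rat_field l (\<lambda>j. of_int (b i j)) = hyperplane rat_field l (\<beta> i)"
    "central_arrangement rat_field l n (\<lambda>i j. of_int (b i j))"
    "free_arrangement rat_field l n (\<lambda>i j. of_int (b i j)) \<longleftrightarrow> free_arrangement rat_field l n \<beta>"
    using integral_arrangement[OF central(2)] by blast
  have "(\<Inter>i\<in>I. hyperplane rat_field l (\<lambda>j. of_int (a i j))) = (\<Inter>i\<in>I. hyperplane rat_field l (\<alpha> i))"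
    "(\<Inter>i\<in>I. hyperplane rat_field l (\<lambda>j. of_int (b i j))) = (\<Inter>i\<in>I. hyperplane rat_field l (\<beta> i))"
    if "I \<subseteq> {..<n}" for I using a(1) b(1) that by (auto intro!: INF_cong)
  then have equiv': "comb_equivalent rat_field rat_field l n (\<lambda>i j. of_int (a i j)) (\<lambda>i j. of_int (b i j))"
    using equiv unfolding comb_equivalent_def by simp
  obtain N1 where N1: "N1 \<noteq> 0" "\<forall>p::nat. prime p \<longrightarrow> \<not> int p dvd N1 \<longrightarrow>
      central_arrangement (residue_ring (int p)) l n (\<lambda>i j. a i j mod int p)"
    using central_arrangement_mod_prime[OF a(2)] by blast
  obtain N2 where N2: "N2 \<noteq> 0" "\<forall>p::nat. prime p \<longrightarrow> \<not> int p dvd N2 \<longrightarrow>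
      central_arrangement (residue_ring (int p)) l n (\<lambda>i j. b i j mod int p)"
    using central_arrangement_mod_prime[OF b(2)] by blast
  obtain N3 where N3: "N3 \<noteq> 0" "\<forall>p::nat. prime p \<longrightarrow> \<not> int p dvd N3 \<longrightarrow>
      comb_equivalent (residue_ring (int p)) (residue_ring (int p)) l n (\<lambda>i j. a i j mod int p) (\<lambda>i j. b i j mod int p)"
    using comb_equivalent_mod_prime[OF equiv'] by blast
  have "crit 0 l n a" using free a(3) free_rat_field_iff[OF a(2)] by blast
  then obtain N4 where N4: "N4 \<noteq> 0" "\<forall>p. \<not> p dvd N4 \<longrightarrow> crit p l n a"
    using crit_mod_prime by blast
  obtain N5 where N5: "N5 \<noteq> 0" "\<forall>p. prime p \<longrightarrow> \<not> p dvd N5 \<longrightarrow> crit p l n b \<longrightarrow> crit 0 l n b"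
    using crit_from_prime by blast
  \<comment> \<open>One prime at which both arrangements stay central and equivalent, freeness of a
    descends, and freeness of b lifts.\<close>
  obtain p where p: "prime (p::nat)" "\<not> int p dvd N1 * N2 * N3 * N4 * N5"
    using ex_prime_not_dvd[of "N1 * N2 * N3 * N4 * N5"] N1(1) N2(1) N3(1) N4(1) N5(1) by auto
  then have not_dvd: "\<not> int p dvd N1" "\<not> int p dvd N2" "\<not> int p dvd N3" "\<not> int p dvd N4" "\<not> int p dvd N5"
    by (meson dvd_mult dvd_mult2)+
  have central_p: "central_arrangement (residue_ring (int p)) l n (\<lambda>i j. a i j mod int p)"
      "central_arrangement (residue_ring (int p)) l n (\<lambda>i j. b i j mod int p)"
    using N1(2) N2(2) not_dvd p(1) by blast+
  have "crit (int p) l n a" using N4(2) not_dvd(4) by blast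
  then have "free_arrangement (residue_ring (int p)) l n (\<lambda>i j. a i j mod int p)"
    using free_residue_ring_iff[OF p(1) central_p(1)] by blast
  moreover have "terao_conjecture_over (residue_ring (int p))" using terao p(1) by simp
  moreover have "comb_equivalent (residue_ring (int p)) (residue_ring (int p)) l n
      (\<lambda>i j. a i j mod int p) (\<lambda>i j. b i j mod int p)" using N3(2) not_dvd(3) p(1) by blast
  ultimately have "free_arrangement (residue_ring (int p)) l n (\<lambda>i j. b i j mod int p)"
    using central_p l unfolding terao_conjecture_over_def by blast
  then have "crit (int p) l n b" using free_residue_ring_iff[OF p(1) central_p(2)] by blast
  then have "crit 0 l n b" using N5(2)[rule_format, of "int p"] not_dvd(5) p(1) by simp
  then show ?thesis using b(3) free_rat_field_iff[OF b(2)] by blast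
qed

theorem theorem5p5:
  assumes "\<forall>p::int. prime p \<longrightarrow> terao_conjecture_over (residue_ring p)"
  shows "terao_conjecture_over rat_field"
  unfolding terao_conjecture_over_def
proof (intro allI impI)
  fix l n and \<alpha> \<beta> :: "nat \<Rightarrow> nat \<Rightarrow> rat"
  assume *: "l \<ge> 1" "central_arrangement rat_field l n \<alpha>" "central_arrangement rat_field l n \<beta>"
    "comb_equivalent rat_field rat_field l n \<alpha> \<beta>"
  then have "comb_equivalent rat_field rat_field l n \<beta> \<alpha>" by (simp add: comb_equivalent_def)
  then show "free_arrangement rat_field l n \<alpha> \<longleftrightarrow> free_arrangement rat_field l n \<beta>"
    using free_arrangement_transfer[OF assms] * by blast
qed

end
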